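(* Let $d\ge 1$, $\lambda\in\mathbb{R}\setminus\{0\}$, $T>0$, and consider the Cauchy problem on the torus $$i\partial_t u+\Delta u+\lambda u\log(|u|^2)=0,\qquad u|_{t=0}=u_0,\qquad x\in\mathbb{T}^d.$$ (1) Let $s\in(0,1)$. For any $u_0\in H^s(\mathbb{T}^d)$, weak $H^s$ solutions of this problem on $[0,T]$ are unique; that is, any two weak $H^s$ solutions on $[0,T]$ with the same initial datum $u_0$ coincide on $[0,T]$. (2) When $d=1$, for any $u_0\in L^2(\mathbb{T})$, weak $L^2$ solutions of this problem on $[0,T]$ are unique; that is, any two weak $L^2$ solutions on $[0,T]$ with the same initial datum $u_0$ coincide on $[0,T]$.
   Context: $\mathbb{T}^d=(\mathbb{R}/2\pi\mathbb{Z})^d$ is the $d$-dimensional flat torus. Functions are complex-valued, and $z\log(|z|^2)$ is understood to be $0$ at $z=0$. Definition. Let $I\subset\mathbb{R}$ be an interval with $0\in I$, let $s\ge 0$ and $u_0\in H^s(\mathbb{T}^d)$. A function $u$ is a weak $H^s$ solution on $I$ if $u\in L^\infty(I,H^s(\mathbb{T}^d))$ and (i) $u$ satisfies $i\partial_t u+\Delta u+\lambda u\log(|u|^2)=0$ in $\mathcal{D}'(I\times\mathbb{T}^d)$, i.e. in the sense of distributions on $I\times\mathbb{T}^d$, and (ii) $u|_{t=0}=u_0$. A weak $L^2$ solution is a weak $H^0$ solution. For $s\in[0,1]$ and $I=[0,T]$, a function $u\in L^\infty([0,T],H^s(\mathbb{T}^d))$ satisfying (i) is (after modification on a null set of times)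 weakly continuous from $[0,T]$ into $H^s(\mathbb{T}^d)$; condition (ii) is understood for this weakly continuous representative. *)

theory Defs
  imports "HOL-Analysis.Analysis"
begin

text \<open>
  Functions on the torus \<open>(\<real> / 2\<pi>\<int>)^d\<close> are functions on \<open>real ^ 'd\<close>, \<open>d = CARD('d)\<close>, that are
  \<open>2\<pi>\<close>-periodic in every coordinate; integrals and null sets refer to the period cell.
  Elements of L^2 and H^s are represented by functions, equality in these spaces
  being equality almost everywhere.
\<close>

definition torus :: "(real ^ 'd) measure" where
  "torus = lebesgue_on (cbox 0 (\<chi> j. 2 * pi))"

definition torus_periodic :: "(real ^ 'd \<Rightarrow> complex) \<Rightarrow> bool" where
  "torus_periodic f \<longleftrightarrow> (\<forall>j x. f (x + (2 * pi) *\<^sub>R axis j 1) = f x)"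

definition torus_L2 :: "(real ^ 'd \<Rightarrow> complex) set" where
  "torus_L2 = {f. torus_periodic f \<and> f \<in> borel_measurable torus
                  \<and> integrable torus (\<lambda>x. (cmod (f x))\<^sup>2)}"

definition fourier_coeff :: "(real ^ 'd \<Rightarrow> complex) \<Rightarrow> int ^ 'd \<Rightarrow> complex" where
  "fourier_coeff f k =
     (LINT x|torus. f x * cis (- (\<Sum>j\<in>UNIV. of_int (k $ j) * x $ j))) / of_real ((2 * pi) ^ CARD('d))"

definition Hs_weight :: "real \<Rightarrow> int ^ 'd \<Rightarrow> real" where
  "Hs_weight s k = (1 + (\<Sum>j\<in>UNIV. (real_of_int (k $ j))\<^sup>2)) powr s"

text \<open>The Sobolev space, for \<open>s \<ge> 0\<close>.\<close>

definition torus_Hs :: "real \<Rightarrow> (real ^ 'd \<Rightarrow> complex) set" where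
  "torus_Hs s = {f \<in> torus_L2. (\<lambda>k. Hs_weight s k * (cmod (fourier_coeff f k))\<^sup>2) summable_on UNIV}"

definition Hs_norm :: "real \<Rightarrow> (real ^ 'd \<Rightarrow> complex) \<Rightarrow> real" where
  "Hs_norm s f = sqrt (\<Sum>\<^sub>\<infinity>k\<in>UNIV. Hs_weight s k * (cmod (fourier_coeff f k))\<^sup>2)"

text \<open>
  Bochner measurability: \<open>u\<close> is, for almost every time, the limit in H^s of simple functions
  with values in H^s.
\<close>

definition Hs_strongly_measurable :: "real \<Rightarrow> real set \<Rightarrow> (real \<Rightarrow> real ^ 'd \<Rightarrow> complex) \<Rightarrow> bool" where
  "Hs_strongly_measurable s I u \<longleftrightarrow>
     (\<exists>S :: nat \<Rightarrow> real \<Rightarrow> real ^ 'd \<Rightarrow> complex.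
        (\<forall>n. simple_function (lebesgue_on I) (S n) \<and> (\<forall>t\<in>I. S n t \<in> torus_Hs s)) \<and>
        (AE t in lebesgue_on I. (\<lambda>n. Hs_norm s (\<lambda>x. S n t x - u t x)) \<longlonglongrightarrow> 0))"

definition Linfty_Hs :: "real \<Rightarrow> real set \<Rightarrow> (real \<Rightarrow> real ^ 'd \<Rightarrow> complex) set" where
  "Linfty_Hs s I = {u. (AE t in lebesgue_on I. u t \<in> torus_Hs s) \<and> Hs_strongly_measurable s I u \<and>
                       (\<exists>C. AE t in lebesgue_on I. Hs_norm s (u t) \<le> C)}"

text \<open>Iterated Frechet derivatives in arbitrary directions; \<open>is_Ck k\<close> is \<open>k\<close>-fold continuous
  differentiability on the whole space.\<close>

definition dir_deriv :: "'a::real_normed_vector \<Rightarrow> ('a \<Rightarrow> complex) \<Rightarrow> 'a \<Rightarrow> complex" where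
  "dir_deriv v f x = frechet_derivative f (at x) v"

primrec is_Ck :: "nat \<Rightarrow> ('a::real_normed_vector \<Rightarrow> complex) \<Rightarrow> bool" where
  "is_Ck 0 f \<longleftrightarrow> continuous_on UNIV f"
| "is_Ck (Suc k) f \<longleftrightarrow> (\<forall>x. f differentiable (at x)) \<and> (\<forall>v. is_Ck k (dir_deriv v f))"

text \<open>
  Test functions on \<open>I \<times> torus\<close>: smooth, periodic in space, with support in \<open>K \<times> torus\<close> for a compact
  subset \<open>K\<close> of the interior of \<open>I\<close>.
\<close>

definition test_functions :: "real set \<Rightarrow> (real \<times> (real ^ 'd) \<Rightarrow> complex) set" where
  "test_functions I = {\<phi>. (\<forall>k. is_Ck k \<phi>) \<and> (\<forall>t. torus_periodic (\<lambda>x. \<phi> (t, x))) \<and>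
      (\<exists>K. compact K \<and> K \<subseteq> interior I \<and> (\<forall>t x. t \<notin> K \<longrightarrow> \<phi> (t, x) = 0))}"

type_synonym 'd distr = "(real \<times> (real ^ 'd) \<Rightarrow> complex) \<Rightarrow> complex"

text \<open>
  The regular distribution of a function. The iterated integral depends only on the classes of the
  \<open>g t\<close> modulo null sets, so no joint measurability of the chosen representatives is needed.
\<close>

definition distr_of :: "real set \<Rightarrow> (real \<Rightarrow> real ^ 'd \<Rightarrow> complex) \<Rightarrow> 'd distr" where
  "distr_of I g \<phi> = (LINT t|lebesgue_on I. LINT x|torus. g t x * \<phi> (t, x))"

definition distr_dt :: "'d distr \<Rightarrow> 'd::finite distr" where
  "distr_dt U \<phi> = - U (dir_deriv (1, 0) \<phi>)"

definition distr_dx :: "'d \<Rightarrow> 'd distr \<Rightarrow> 'd::finite distr" where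
  "distr_dx j U \<phi> = - U (dir_deriv (0, axis j 1) \<phi>)"

definition distr_laplacian :: "'d distr \<Rightarrow> 'd::finite distr" where
  "distr_laplacian U \<phi> = (\<Sum>j\<in>UNIV. distr_dx j (distr_dx j U) \<phi>)"

text \<open>This is \<open>0\<close> at \<open>z = 0\<close>.\<close>

definition log_nonlin :: "complex \<Rightarrow> complex" where
  "log_nonlin z = z * of_real (ln ((cmod z)\<^sup>2))"

definition logNLS_distr :: "real \<Rightarrow> real set \<Rightarrow> (real \<Rightarrow> real ^ 'd::finite \<Rightarrow> complex) \<Rightarrow> bool" where
  "logNLS_distr lam I u \<longleftrightarrow>
     (\<forall>\<phi>\<in>test_functions I.
        \<i> * distr_dt (distr_of I u) \<phi> + distr_laplacian (distr_of I u) \<phi>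
        + of_real lam * distr_of I (\<lambda>t x. log_nonlin (u t x)) \<phi> = 0)"

text \<open>
  Continuous linear functionals on H^s. Boundedness forces \<open>L\<close> to respect equality
  almost everywhere.
\<close>

definition Hs_dual :: "real \<Rightarrow> ((real ^ 'd \<Rightarrow> complex) \<Rightarrow> complex) set" where
  "Hs_dual s = {L. (\<forall>f\<in>torus_Hs s. \<forall>g\<in>torus_Hs s. L (\<lambda>x. f x + g x) = L f + L g) \<and>
                   (\<forall>c. \<forall>f\<in>torus_Hs s. L (\<lambda>x. c * f x) = c * L f) \<and>
                   (\<exists>C. \<forall>f\<in>torus_Hs s. cmod (L f) \<le> C * Hs_norm s f)}"

definition weakly_continuous_Hs :: "real \<Rightarrow> real set \<Rightarrow> (real \<Rightarrow> real ^ 'd \<Rightarrow> complex) \<Rightarrow> bool" where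
  "weakly_continuous_Hs s I w \<longleftrightarrow>
     (\<forall>t\<in>I. w t \<in> torus_Hs s) \<and> (\<forall>L\<in>Hs_dual s. continuous_on I (\<lambda>t. L (w t)))"

definition weakly_continuous_rep ::
  "real \<Rightarrow> real set \<Rightarrow> (real \<Rightarrow> real ^ 'd \<Rightarrow> complex) \<Rightarrow> (real \<Rightarrow> real ^ 'd \<Rightarrow> complex) \<Rightarrow> bool" where
  "weakly_continuous_rep s I u w \<longleftrightarrow>
     weakly_continuous_Hs s I w \<and> (AE t in lebesgue_on I. AE x in torus. w t x = u t x)"

definition weak_Hs_solution ::
  "real \<Rightarrow> real \<Rightarrow> real set \<Rightarrow> (real ^ 'd \<Rightarrow> complex) \<Rightarrow> (real \<Rightarrow> real ^ 'd::finite \<Rightarrow> complex) \<Rightarrow> bool" where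
  "weak_Hs_solution lam s I u0 u \<longleftrightarrow>
     u \<in> Linfty_Hs s I \<and> logNLS_distr lam I u \<and>
     (\<exists>w. weakly_continuous_rep s I u w \<and> (AE x in torus. w 0 x = u0 x))"

text \<open>
  Equality as elements of \<open>L\<^sup>\<infinity>(I, H\<^sup>s)\<close>, and equality of the weakly continuous
  representatives at every time of \<open>I\<close>.
\<close>

definition coincide_on ::
  "real \<Rightarrow> real set \<Rightarrow> (real \<Rightarrow> real ^ 'd \<Rightarrow> complex) \<Rightarrow> (real \<Rightarrow> real ^ 'd \<Rightarrow> complex) \<Rightarrow> bool" where
  "coincide_on s I u v \<longleftrightarrow>
     (AE t in lebesgue_on I. AE x in torus. u t x = v t x) \<and>
     (\<forall>w z. weakly_continuous_rep s I u w \<longrightarrow> weakly_continuous_rep s I v z \<longrightarrow>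
        (\<forall>t\<in>I. AE x in torus. w t x = z t x))"

end

theory Submission
  imports Defs
begin

text \<open>
  The difference \<open>w = u - v\<close> of two solutions solves the equation with right-hand side
  \<open>F = g u - g v\<close>, \<open>g z = z log |z|^2\<close>, and \<open>|Im (g a - g b) (a - b)^*| \<le> 2 |a - b|^2\<close>. The formal identity
  \<open>d/dt \<parallel>w\<parallel>^2 = - 2 lam Im \<langle>F, w\<rangle>\<close> and Gronwall's inequality then give \<open>w = 0\<close>. The identity holds for each
  Fourier mode, and summing it over the modes is legitimate as soon as \<open>g u\<close> and \<open>g v\<close> lie in
  \<open>L^2\<close> of space-time. For this it is enough that the mass of \<open>u\<close> on \<open>{R \<le> |u| < 2 R}\<close> decays like a
  negative power of \<open>R\<close>. In \<open>H^s\<close>, \<open>s > 0\<close>, such a decay follows by comparing \<open>u\<close> with a partial sum of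
  its Fourier series. In \<open>L^2\<close> and dimension one it comes from Zygmund's \<open>L^4\<close> estimate for the free
  evolution: by duality, functions concentrated on \<open>{|u| \<ge> R}\<close> have small free evolution integrals.
\<close>

section \<open>Square integrable functions and Fourier series on the torus\<close>

text \<open>For \<open>u\<close> merely in L^2 of the torus, u log |u|^2 is a logarithm short of
  L^2. Its pairing with the difference of two solutions is then not defined a priori, although every
  single Fourier mode is. Decay of the mass repairs this: on {2^j <= |u| < 2^(j+1)} the nonlinearity
  is at most 2 (j+1) |u|, and a geometric factor beats (j+1)^2. In dimension one the argument
  threatens to be circular, because Duhamel's formula contains the very nonlinearity whose
  integrability is wanted. The way out is that pairing with a free wave in L^4 tolerates |u|^(5/4),
  by Hoelder's inequality with exponents 2, 4, 4. This power dominates u log |u|^2 where |u| is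
  large, and |u|^(1/4) restricted to {|u| >= R} has L^4 norm O(R^(-1/4)). The logarithm lost on {|u|
  < R} is absorbed by this gain. A second obstacle is measurability: a solution is a family of
  classes of functions without a jointly measurable representative, and one has to be built before
  Fubini's theorem can be used.\<close>

definition sq_integrable :: "'a measure \<Rightarrow> ('a \<Rightarrow> complex) \<Rightarrow> bool" where
  "sq_integrable M f \<longleftrightarrow> f \<in> borel_measurable M \<and> integrable M (\<lambda>x. (cmod (f x))\<^sup>2)"

lemma cmod_add_square_le: "(cmod (a + b))\<^sup>2 \<le> 2 * (cmod a)\<^sup>2 + 2 * (cmod b)\<^sup>2"
proof -
  have "(cmod (a + b))\<^sup>2 \<le> (cmod a + cmod b)\<^sup>2"
    by (intro power_mono norm_triangle_ineq) auto
  also have "\<dots> \<le> 2 * (cmod a)\<^sup>2 + 2 * (cmod b)\<^sup>2"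
    using zero_le_power2[of "cmod a - cmod b"] by (simp add: power2_eq_square algebra_simps)
  finally show ?thesis .
qed

lemma sq_integrable_add:
  assumes "sq_integrable M f" "sq_integrable M g"
  shows "sq_integrable M (\<lambda>x. f x + g x)"
proof -
  have [measurable]: "f \<in> borel_measurable M" "g \<in> borel_measurable M"
    using assms by (auto simp: sq_integrable_def)
  have "integrable M (\<lambda>x. 2 * (cmod (f x))\<^sup>2 + 2 * (cmod (g x))\<^sup>2)"
    using assms by (auto simp: sq_integrable_def)
  then have "integrable M (\<lambda>x. (cmod (f x + g x))\<^sup>2)"
    by (rule Bochner_Integration.integrable_bound) (use cmod_add_square_le in auto)
  then show ?thesis by (simp add: sq_integrable_def)
qed

lemma sq_integrable_cmult:
  assumes "sq_integrable M f"
  shows "sq_integrable M (\<lambda>x. c * f x)"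
  using assms by (auto simp: sq_integrable_def norm_mult power_mult_distrib)

lemma sq_integrable_diff:
  assumes "sq_integrable M f" "sq_integrable M g"
  shows "sq_integrable M (\<lambda>x. f x - g x)"
  using sq_integrable_add[OF assms(1) sq_integrable_cmult[OF assms(2), of "-1"]] by simp

lemma sq_integrable_0 [simp]: "sq_integrable M (\<lambda>x. 0)"
  by (simp add: sq_integrable_def)

lemma sq_integrable_sum:
  assumes "\<And>i. i \<in> I \<Longrightarrow> sq_integrable M (f i)"
  shows "sq_integrable M (\<lambda>x. \<Sum>i\<in>I. f i x)"
  using assms by (induction I rule: infinite_finite_induct) (auto intro: sq_integrable_add)

lemma borel_measurable_cnj [measurable (raw)]:
  "f \<in> borel_measurable M \<Longrightarrow> (\<lambda>x. cnj (f x)) \<in> borel_measurable M"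
  by (rule borel_measurable_continuous_on[OF _ , of cnj]) (auto intro!: continuous_intros)

lemma sq_integrable_cnj: "sq_integrable M f \<Longrightarrow> sq_integrable M (\<lambda>x. cnj (f x))"
  by (auto simp: sq_integrable_def)

lemma cmod_mult_le: "cmod (a * b) \<le> ((cmod a)\<^sup>2 + (cmod b)\<^sup>2) / 2"
  using zero_le_power2[of "cmod a - cmod b"]
  by (simp add: norm_mult power2_eq_square algebra_simps)

lemma sq_integrable_mult:
  assumes "sq_integrable M f" "sq_integrable M g"
  shows "integrable M (\<lambda>x. f x * g x)"
proof -
  have [measurable]: "f \<in> borel_measurable M" "g \<in> borel_measurable M"
    using assms by (auto simp: sq_integrable_def)
  have "integrable M (\<lambda>x. ((cmod (f x))\<^sup>2 + (cmod (g x))\<^sup>2) / 2)"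
    using assms by (auto simp: sq_integrable_def)
  then show ?thesis
    by (rule Bochner_Integration.integrable_bound) (use cmod_mult_le in auto)
qed

lemma sq_integrable_const: "finite_measure M \<Longrightarrow> sq_integrable M (\<lambda>x. c)"
  by (simp add: sq_integrable_def finite_measure.integrable_const)

lemma sq_integrable_bounded:
  assumes "finite_measure M" "f \<in> borel_measurable M" "\<And>x. x \<in> space M \<Longrightarrow> cmod (f x) \<le> B"
  shows "sq_integrable M f"
  unfolding sq_integrable_def
proof
  show "integrable M (\<lambda>x. (cmod (f x))\<^sup>2)"
    by (rule finite_measure.integrable_const_bound[OF assms(1), where B="B\<^sup>2"])
       (use assms in \<open>auto intro!: power_mono\<close>)
qed (use assms in auto)

lemma sq_integrable_imp_integrable:
  "finite_measure M \<Longrightarrow> sq_integrable M f \<Longrightarrow> integrable M f"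
  using sq_integrable_mult[OF _ sq_integrable_const[of M 1]] by simp

lemma sq_integrable_cong_AE:
  assumes "sq_integrable M f" "g \<in> borel_measurable M" "AE x in M. f x = g x"
  shows "sq_integrable M g"
  unfolding sq_integrable_def
proof
  show "integrable M (\<lambda>x. (cmod (g x))\<^sup>2)"
    by (rule integrable_cong_AE_imp[of M "\<lambda>x. (cmod (f x))\<^sup>2"])
       (use assms in \<open>auto simp: sq_integrable_def\<close>)
qed fact

lemma Cauchy_Schwarz_integral_real:
  fixes f g :: "'a \<Rightarrow> real"
  assumes [measurable]: "f \<in> borel_measurable M" "g \<in> borel_measurable M"
    and f2: "integrable M (\<lambda>x. (f x)\<^sup>2)" and g2: "integrable M (\<lambda>x. (g x)\<^sup>2)"
  shows "integrable M (\<lambda>x. f x * g x)"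
    and "(LINT x|M. f x * g x)\<^sup>2 \<le> (LINT x|M. (f x)\<^sup>2) * (LINT x|M. (g x)\<^sup>2)"
proof -
  have "integrable M (\<lambda>x. ((f x)\<^sup>2 + (g x)\<^sup>2))" using f2 g2 by auto
  then show fg: "integrable M (\<lambda>x. f x * g x)"
  proof (rule Bochner_Integration.integrable_bound)
    have "\<bar>a * b\<bar> \<le> a\<^sup>2 + b\<^sup>2" for a b :: real
    proof -
      have "\<bar>a * b\<bar> \<le> (a\<^sup>2 + b\<^sup>2) / 2"
        using cmod_mult_le[of "of_real a" "of_real b"] by (simp add: norm_mult abs_mult)
      also have "\<dots> \<le> a\<^sup>2 + b\<^sup>2" by simp
      finally show ?thesis .
    qed
    then show "AE x in M. norm (f x * g x) \<le> norm ((f x)\<^sup>2 + (g x)\<^sup>2)" by (auto simp: abs_mult)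
  qed auto
  define A where "A = (LINT x|M. (f x)\<^sup>2)"
  define B where "B = (LINT x|M. f x * g x)"
  define C where "C = (LINT x|M. (g x)\<^sup>2)"
  have A0: "0 \<le> A" and C0: "0 \<le> C" by (auto simp: A_def C_def)
  have *: "0 \<le> A - 2 * t * B + t\<^sup>2 * C" for t
  proof -
    have "0 \<le> (LINT x|M. (f x - t * g x)\<^sup>2)" by simp
    also have "(LINT x|M. (f x - t * g x)\<^sup>2) = (LINT x|M. (f x)\<^sup>2 - (2*t) * (f x * g x) + t\<^sup>2 * (g x)\<^sup>2)"
      by (intro Bochner_Integration.integral_cong refl) (simp add: power2_eq_square algebra_simps)
    also have "\<dots> = A - 2 * t * B + t\<^sup>2 * C"
      using f2 g2 fg by (simp add: A_def B_def C_def)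
    finally show ?thesis .
  qed
  show "(LINT x|M. f x * g x)\<^sup>2 \<le> (LINT x|M. (f x)\<^sup>2) * (LINT x|M. (g x)\<^sup>2)"
  proof (cases "C = 0")
    case True
    have "AE x in M. (g x)\<^sup>2 = 0"
      using True g2 integral_nonneg_eq_0_iff_AE[of M "\<lambda>x. (g x)\<^sup>2"] by (auto simp: C_def)
    then have "B = (LINT x|M. 0)"
      unfolding B_def by (intro integral_cong_AE) auto
    then show ?thesis using A0 C0 by (simp add: A_def B_def C_def)
  next
    case False
    then have "C > 0" using C0 by simp
    from *[of "B / C"] have "0 \<le> A - B\<^sup>2 / C"
      using \<open>C > 0\<close> by (simp add: field_simps power2_eq_square)
    then have "B\<^sup>2 \<le> A * C" using \<open>C > 0\<close> by (simp add: field_simps)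
    then show ?thesis by (simp add: A_def B_def C_def)
  qed
qed

lemma Cauchy_Schwarz_integral_cmod:
  assumes f: "sq_integrable M f" and g: "sq_integrable M g"
  shows "cmod (LINT x|M. f x * g x) \<le> sqrt (LINT x|M. (cmod (f x))\<^sup>2) * sqrt (LINT x|M. (cmod (g x))\<^sup>2)"
proof -
  have [measurable]: "f \<in> borel_measurable M" "g \<in> borel_measurable M"
    using assms by (auto simp: sq_integrable_def)
  have "cmod (LINT x|M. f x * g x) \<le> (LINT x|M. cmod (f x) * cmod (g x))"
    using integral_norm_bound[of M "\<lambda>x. f x * g x"] by (simp add: norm_mult)
  also have "\<dots> \<le> sqrt ((LINT x|M. (cmod (f x))\<^sup>2) * (LINT x|M. (cmod (g x))\<^sup>2))"
    by (rule real_le_rsqrt, rule Cauchy_Schwarz_integral_real(2))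
       (use assms in \<open>auto simp: sq_integrable_def\<close>)
  finally show ?thesis by (simp add: real_sqrt_mult)
qed

section \<open>Plane waves and their orthogonality\<close>

definition wave :: "int ^ 'd \<Rightarrow> real ^ 'd::finite \<Rightarrow> complex" where
  "wave k x = cis (\<Sum>j\<in>UNIV. of_int (k $ j) * x $ j)"

text \<open>Integer valued, so that differences of these frequencies can be fed to
  \<open>integral_cis_int\<close> and the resonance condition is an equation between
  integers.\<close>

definition freq_sq :: "int ^ 'd::finite \<Rightarrow> int" where
  "freq_sq k = (\<Sum>j\<in>UNIV. (k $ j)\<^sup>2)"

lemma wave_add: "wave (k + l) x = wave k x * wave l x"
  by (simp add: wave_def cis_mult sum.distrib algebra_simps)

lemma wave_0 [simp]: "wave 0 x = 1"
  by (simp add: wave_def)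

lemma cmod_wave [simp]: "cmod (wave k x) = 1"
  by (simp add: wave_def)

lemma cnj_wave: "cnj (wave k x) = wave (- k) x"
  by (simp add: wave_def cis_cnj sum_negf)

lemma wave_mult_cnj: "wave k x * cnj (wave l x) = wave (k - l) x"
  using wave_add[of k "-l" x] by (simp add: cnj_wave)

lemma continuous_on_wave [continuous_intros]: "continuous_on S (wave k)"
  unfolding wave_def by (intro continuous_intros)

lemma borel_measurable_wave [measurable]: "wave k \<in> borel_measurable borel"
  by (rule borel_measurable_continuous_onI[OF continuous_on_wave])

lemma finite_measure_torus: "finite_measure (torus :: (real ^ 'd::finite) measure)"
  unfolding torus_def
  by (rule finite_measure_lebesgue_on) (rule lmeasurable_cbox)

lemma borel_measurable_torus:
  fixes f :: "real ^ 'd::finite \<Rightarrow> 'b::topological_space"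
  shows "f \<in> borel_measurable borel \<Longrightarrow> f \<in> borel_measurable torus"
  unfolding torus_def
  by (intro measurable_restrict_space1 measurable_completion) simp

lemma borel_measurable_wave_torus [measurable]: "wave k \<in> borel_measurable torus"
  by (intro borel_measurable_torus borel_measurable_wave)

lemma sq_integrable_wave: "sq_integrable torus (\<lambda>x. c * wave k x)"
  by (rule sq_integrable_bounded[where B="cmod c"])
     (auto simp: finite_measure_torus norm_mult)

text \<open>The number \<open>m\<close> of periods is a parameter because a side of the cell is one
  period, whereas the L^4 estimate integrates time over as many periods as cover [0, T]. For nonzero
  \<open>n\<close> the primitive itself is periodic.\<close>

lemma integral_cis_int:
  "(LINT y|lborel. indicator {0..2 * pi * real m} y *\<^sub>R cis (of_int n * y)) =
    (if n = 0 then of_real (2 * pi * real m) else 0)"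
proof (cases "n = 0")
  case True
  then show ?thesis by (simp add: scaleR_conv_of_real)
next
  case False
  define F where "F y = cis (of_int n * y) / (\<i> * of_int n)" for y :: real
  have "(F has_vector_derivative cis (of_int n * y)) (at y within S)" for y S
  proof -
    have "((\<lambda>z. exp (\<i> * of_int n * z) / (\<i> * of_int n)) has_field_derivative exp (\<i> * of_int n * z)) (at z)" for z :: complex
      using False by (auto intro!: derivative_eq_intros)
    from has_vector_derivative_real_field[OF this, of y S] show ?thesis
      by (simp add: F_def[abs_def] cis_conv_exp mult_ac)
  qed
  then have "(LINT y|lborel. indicator {0..2 * pi * real m} y *\<^sub>R cis (of_int n * y)) = F (2 * pi * real m) - F 0"
    by (intro integral_FTC_Icc) (auto intro!: continuous_intros)
  also have "cis (of_int n * (2 * pi * real m)) = 1"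
    using cis_multiple_2pi[of "of_int n * of_nat m"] by (simp add: mult_ac)
  then have "F (2 * pi * real m) = F 0" by (simp add: F_def)
  finally show ?thesis using False by simp
qed

lemma integral_wave:
  "(LINT x|torus. wave (k :: int ^ 'd::finite) x) = (if k = 0 then of_real ((2 * pi) ^ CARD('d)) else 0)"
proof -
  \<comment> \<open>With the indicator of [0, 2 pi] inside each factor, the indicator of the cell
    becomes part of the product, and the integral over all of space factors.\<close>
  define f :: "'d \<Rightarrow> real \<Rightarrow> complex" where
    "f j y = indicator {0..2 * pi} y *\<^sub>R cis (of_int (k $ j) * y)" for j y
  have [measurable]: "f j \<in> borel_measurable borel" for j
    unfolding f_def by (intro borel_measurable_scaleR borel_measurable_indicator borel_measurable_continuous_onI)
       (auto intro!: continuous_intros)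
  have fint: "integrable lborel (f j)" for j
  proof -
    have "set_integrable lborel {0..2 * pi} (\<lambda>y. cis (of_int (k $ j) * y))"
      by (rule borel_integrable_atLeastAtMost') (intro continuous_intros)
    then show ?thesis by (simp add: set_integrable_def f_def[abs_def])
  qed
  have prod_f: "(\<Prod>j\<in>UNIV. f j (x $ j)) = indicator (cbox 0 (\<chi> j. 2 * pi)) x *\<^sub>R wave k x" for x
  proof (cases "x \<in> cbox 0 (\<chi> j. 2 * pi)")
    case True
    then have "f j (x $ j) = cis (of_int (k $ j) * x $ j)" for j
      by (auto simp: f_def mem_box_cart)
    then show ?thesis using True
      by (simp add: wave_def cis_conv_exp exp_sum sum_distrib_left)
  next
    case False
    then obtain j where "x $ j \<notin> {0..2 * pi}" by (auto simp: mem_box_cart)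
    then have "f j (x $ j) = 0" by (simp add: f_def)
    then have "(\<Prod>j\<in>UNIV. f j (x $ j)) = 0" by (intro prod_zero) auto
    then show ?thesis using False by simp
  qed
  have Bas: "(Basis :: (real ^ 'd) set) = range (\<lambda>j. axis j 1)" by (auto simp: Basis_vec_def)
  have inj: "inj (\<lambda>j :: 'd. axis j (1 :: real))" by (auto simp: inj_def axis_eq_axis)
  \<comment> \<open>In \<open>lborel_eq\<close> the coordinates are indexed by basis vectors;
    \<open>idx\<close> translates them back to the index type of the vectors.\<close>
  define idx :: "real ^ 'd \<Rightarrow> 'd" where "idx = inv (\<lambda>j. axis j 1)"
  have idx: "idx (axis j 1) = j" for j unfolding idx_def by (rule inv_f_f[OF inj])
  interpret product_sigma_finite "\<lambda>b :: real ^ 'd. lborel :: real measure"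
    by standard
  have "(LINT x|torus. wave k x) = (LINT x|lebesgue. indicator (cbox 0 (\<chi> j. 2 * pi)) x *\<^sub>R wave k x)"
    unfolding torus_def by (subst integral_restrict_space) auto
  also have "\<dots> = (LINT x|lebesgue. (\<Prod>j\<in>UNIV. f j (x $ j)))"
    by (simp add: prod_f)
  also have "\<dots> = (LINT x|lborel. (\<Prod>j\<in>UNIV. f j (x $ j)))"
    by (rule integral_completion) measurable
  also have "\<dots> = (LINT g|(\<Pi>\<^sub>M b\<in>Basis. lborel). (\<Prod>j\<in>UNIV. f j ((\<Sum>b\<in>Basis. g b *\<^sub>R b) $ j)))"
    by (subst lborel_eq, rule integral_distr) measurable
  also have "\<dots> = (LINT g|(\<Pi>\<^sub>M b\<in>Basis. lborel). (\<Prod>b\<in>Basis. f (idx b) (g b)))"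
  proof (intro Bochner_Integration.integral_cong refl)
    fix g :: "real ^ 'd \<Rightarrow> real"
    have "(\<Sum>b\<in>Basis. g b *\<^sub>R b) $ j = g (axis j 1)" for j
      unfolding Bas by (subst sum.reindex[OF inj])
        (simp add: axis_def if_distrib cong: if_cong)
    then show "(\<Prod>j\<in>UNIV. f j ((\<Sum>b\<in>Basis. g b *\<^sub>R b) $ j)) = (\<Prod>b\<in>Basis. f (idx b) (g b))"
      unfolding Bas by (subst prod.reindex[OF inj]) (simp add: idx)
  qed
  also have "\<dots> = (\<Prod>b\<in>Basis. integral\<^sup>L lborel (f (idx b)))"
    by (rule product_integral_prod) (auto intro: fint)
  also have "\<dots> = (\<Prod>j\<in>UNIV. integral\<^sup>L lborel (f j))"
    unfolding Bas by (subst prod.reindex[OF inj]) (simp add: idx)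
  also have "\<dots> = (\<Prod>j\<in>UNIV. if k $ j = 0 then of_real (2 * pi) else 0)"
  proof (intro prod.cong refl)
    show "integral\<^sup>L lborel (f j) = (if k $ j = 0 then of_real (2 * pi) else 0)" for j
      using integral_cis_int[of 1 "k $ j"] unfolding f_def[abs_def] by simp
  qed
  also have "\<dots> = (if k = 0 then of_real ((2 * pi) ^ CARD('d)) else 0)"
    by (auto simp: vec_eq_iff intro!: prod_zero)
  finally show ?thesis .
qed

lemma fourier_coeff_wave_def:
  "fourier_coeff f k = (LINT x|torus. f x * cnj (wave k x)) / of_real ((2 * pi) ^ CARD('d))"
  for k :: "int ^ 'd::finite"
  by (simp add: fourier_coeff_def wave_def cis_cnj)

section \<open>Density of trigonometric polynomials in L^2\<close>

inductive trig_poly :: "(real ^ 'd::finite \<Rightarrow> complex) \<Rightarrow> bool" where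
  trig_wave: "trig_poly (\<lambda>x. c * wave k x)"
| trig_add: "trig_poly p \<Longrightarrow> trig_poly q \<Longrightarrow> trig_poly (\<lambda>x. p x + q x)"

lemma trig_poly_const: "trig_poly (\<lambda>x. c)"
  using trig_wave[of c 0] by simp

lemma trig_poly_wave_mult:
  assumes "trig_poly p"
  shows "trig_poly (\<lambda>x. c * wave k x * p x)"
  using assms
proof induction
  case (trig_wave d l)
  then show ?case using trig_poly.trig_wave[of "c * d" "k + l"] by (simp add: wave_add mult_ac)
next
  case (trig_add p q)
  then show ?case using trig_poly.trig_add by (fastforce simp: ring_distribs)
qed

lemma trig_poly_mult:
  assumes "trig_poly p" "trig_poly q"
  shows "trig_poly (\<lambda>x. p x * q x)"
  using assms
proof induction
  case (trig_wave c k)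
  then show ?case by (rule trig_poly_wave_mult)
next
  case (trig_add p q)
  then show ?case using trig_poly.trig_add by (fastforce simp: ring_distribs)
qed

lemma trig_poly_cmult: "trig_poly p \<Longrightarrow> trig_poly (\<lambda>x. c * p x)"
  using trig_poly_mult[OF trig_poly_const] .

lemma trig_sum: "(\<And>i. i \<in> I \<Longrightarrow> trig_poly (p i)) \<Longrightarrow> trig_poly (\<lambda>x. \<Sum>i\<in>I. p i x)"
  by (induction I rule: infinite_finite_induct) (auto intro: trig_poly_const trig_add)

lemma trig_poly_finite_sum:
  assumes "trig_poly p"
  shows "\<exists>K c. finite K \<and> p = (\<lambda>x. \<Sum>k\<in>K. c k * wave k x)"
  using assms
proof induction
  case (trig_wave c k)
  show ?case by (rule exI[of _ "{k}"], rule exI[of _ "\<lambda>_. c"]) auto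
next
  case (trig_add p q)
  then obtain K c L d where *: "finite K" "p = (\<lambda>x. \<Sum>k\<in>K. c k * wave k x)"
    "finite L" "q = (\<lambda>x. \<Sum>k\<in>L. d k * wave k x)" by blast
  have 1: "p x = (\<Sum>k\<in>K\<union>L. (if k \<in> K then c k else 0) * wave k x)" for x
    using * by (subst *(2)) (intro sum.mono_neutral_cong_left, auto)
  have 2: "q x = (\<Sum>k\<in>K\<union>L. (if k \<in> L then d k else 0) * wave k x)" for x
    using * by (subst *(4)) (intro sum.mono_neutral_cong_left, auto)
  show ?case
    by (rule exI[of _ "K \<union> L"],
        rule exI[of _ "\<lambda>k. (if k \<in> K then c k else 0) + (if k \<in> L then d k else 0)"])
       (use * 1 2 in \<open>auto simp: sum.distrib[symmetric] ring_distribs\<close>)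
qed

lemma trig_poly_measurable: "trig_poly p \<Longrightarrow> p \<in> borel_measurable torus"
  by (induction rule: trig_poly.induct) auto

lemma trig_poly_sq_integrable: "trig_poly p \<Longrightarrow> sq_integrable torus p"
  by (induction rule: trig_poly.induct) (auto intro: sq_integrable_wave sq_integrable_add)

definition circle_map :: "real ^ 'd::finite \<Rightarrow> complex ^ 'd" where
  "circle_map x = (\<chi> j. cis (x $ j))"

lemma continuous_circle_map: "continuous_on S circle_map"
  unfolding circle_map_def by (intro continuous_intros continuous_on_vec_lambda)

text \<open>Bounded linear functionals are the generators of
  \<open>real_polynomial_function\<close>. On the image of \<open>circle_map\<close> they are
  combinations of cos x_j and sin x_j, hence of the waves whose frequency is plus or minus a unit
  vector.\<close>

lemma trig_poly_linear:
  assumes "bounded_linear (g :: complex ^ 'd::finite \<Rightarrow> real)"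
  shows "trig_poly (\<lambda>x. of_real (g (circle_map x)))"
proof -
  interpret bounded_linear g by fact
  have wj: "wave (axis j n) x = cis (of_int n * x $ j)" for j and n :: int and x :: "real ^ 'd"
  proof -
    have "of_int (axis j n $ i) * x $ i = (if i = j then of_int n * x $ j else 0)" for i
      by (simp add: axis_def)
    then show ?thesis by (simp add: wave_def)
  qed
  have "circle_map x = (\<Sum>j\<in>UNIV. cos (x $ j) *\<^sub>R axis j 1 + sin (x $ j) *\<^sub>R axis j \<i>)" for x :: "real ^ 'd"
    by (simp add: vec_eq_iff circle_map_def axis_def if_distrib complex_eq_iff sum.distrib cong: if_cong)
  then have "g (circle_map x) = (\<Sum>j\<in>UNIV. cos (x $ j) * g (axis j 1) + sin (x $ j) * g (axis j \<i>))" for x :: "real ^ 'd"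
    by (simp add: sum add scale)
  then have "of_real (g (circle_map x)) = (\<Sum>j\<in>UNIV.
       (of_real (g (axis j 1)) / 2) * (wave (axis j 1) x) + ((of_real (g (axis j 1)) / 2) * wave (axis j (-1)) x
        + ((of_real (g (axis j \<i>)) / (2 * \<i>)) * wave (axis j 1) x + (- of_real (g (axis j \<i>)) / (2 * \<i>)) * wave (axis j (-1)) x)))" for x
    by (auto simp: wj complex_eq_iff intro!: sum.cong)
  then have "(\<lambda>x. of_real (g (circle_map x))) = (\<lambda>x. \<Sum>j\<in>UNIV.
       (of_real (g (axis j 1)) / 2) * (wave (axis j 1) x) + ((of_real (g (axis j 1)) / 2) * wave (axis j (-1)) x
        + ((of_real (g (axis j \<i>)) / (2 * \<i>)) * wave (axis j 1) x + (- of_real (g (axis j \<i>)) / (2 * \<i>)) * wave (axis j (-1)) x)))"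
    by (rule ext)
  then show ?thesis by (simp only:) (intro trig_sum trig_add trig_wave)
qed

lemma trig_poly_polynomial:
  assumes "real_polynomial_function (g :: complex ^ 'd::finite \<Rightarrow> real)"
  shows "trig_poly (\<lambda>x. of_real (g (circle_map x)))"
  using assms
  by induction (auto intro: trig_poly_linear trig_poly_const trig_add trig_poly_mult)

text \<open>The closed cell is not embedded in the product of circles, since opposite faces are
  glued. Injectivity survives when one of the two points is interior, which is why the bounds on
  \<open>s\<close> and on \<open>t\<close> differ.\<close>

lemma cis_inj_period:
  assumes "cis s = cis t" "0 \<le> s" "s \<le> 2 * pi" "0 < t" "t < 2 * pi"
  shows "s = t"
proof -
  from assms(1) obtain n :: int where n: "s = t + 2 * pi * n"
    using sin_cos_eq_iff[of s t] by (auto simp: complex_eq_iff)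
  have "- 1 < real_of_int n" 
  proof (rule ccontr)
    assume "\<not> ?thesis"
    then have "2 * pi * n \<le> 2 * pi * (-1)" by (intro mult_left_mono) auto
    then show False using n assms by simp
  qed
  moreover have "real_of_int n < 1"
  proof (rule ccontr)
    assume "\<not> ?thesis"
    then have "2 * pi * n \<ge> 2 * pi * 1" by (intro mult_left_mono) auto
    then show False using n assms(2-5) by linarith
  qed
  ultimately have "n = 0" by linarith
  then show ?thesis using n by simp
qed

text \<open>This is the L^2 closure of the trigonometric polynomials. The class of functions known
  to belong to it grows from indicators of compact sets to all square integrable functions.\<close>

definition trig_approx :: "(real ^ 'd::finite \<Rightarrow> complex) \<Rightarrow> bool" where
  "trig_approx f \<longleftrightarrow> sq_integrable torus f \<and>
     (\<forall>e>0. \<exists>p. trig_poly p \<and> (LINT x|torus. (cmod (f x - p x))\<^sup>2) < e)"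

lemma LINT_sq_add_le:
  assumes "sq_integrable M f" "sq_integrable M g"
  shows "(LINT x|M. (cmod (f x + g x))\<^sup>2) \<le> 2 * (LINT x|M. (cmod (f x))\<^sup>2) + 2 * (LINT x|M. (cmod (g x))\<^sup>2)"
proof -
  have "(LINT x|M. (cmod (f x + g x))\<^sup>2) \<le> (LINT x|M. 2 * (cmod (f x))\<^sup>2 + 2 * (cmod (g x))\<^sup>2)"
    by (intro integral_mono cmod_add_square_le)
       (use sq_integrable_add[OF assms] assms in \<open>auto simp: sq_integrable_def\<close>)
  then show ?thesis using assms by (simp add: sq_integrable_def)
qed

lemma trig_approx_close:
  assumes "sq_integrable torus f"
    and "\<And>e. e > 0 \<Longrightarrow> \<exists>g. trig_approx g \<and> (LINT x|torus. (cmod (f x - g x))\<^sup>2) < e"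
  shows "trig_approx f"
  unfolding trig_approx_def
proof (intro conjI allI impI)
  fix e :: real assume "e > 0"
  then obtain g where g: "trig_approx g" "(LINT x|torus. (cmod (f x - g x))\<^sup>2) < e / 4"
    using assms(2)[of "e / 4"] by auto
  obtain p where p: "trig_poly p" "(LINT x|torus. (cmod (g x - p x))\<^sup>2) < e / 4"
    using g(1) \<open>e > 0\<close> unfolding trig_approx_def by (meson divide_pos_pos zero_less_numeral)
  have "(LINT x|torus. (cmod ((f x - g x) + (g x - p x)))\<^sup>2) \<le>
      2 * (LINT x|torus. (cmod (f x - g x))\<^sup>2) + 2 * (LINT x|torus. (cmod (g x - p x))\<^sup>2)"
    using assms(1) g(1) p(1) by (intro LINT_sq_add_le sq_integrable_diff) (auto simp: trig_approx_def trig_poly_sq_integrable)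
  also have "\<dots> < e" using g(2) p(2) by simp
  finally show "\<exists>p. trig_poly p \<and> (LINT x|torus. (cmod (f x - p x))\<^sup>2) < e"
    using p(1) by auto
qed fact

lemma trig_approx_cmult:
  assumes "trig_approx f"
  shows "trig_approx (\<lambda>x. c * f x)"
  unfolding trig_approx_def
proof (intro conjI allI impI)
  show "sq_integrable torus (\<lambda>x. c * f x)"
    using assms by (auto simp: trig_approx_def intro: sq_integrable_cmult)
  fix e :: real assume "e > 0"
  then have "e / ((cmod c)\<^sup>2 + 1) > 0" by (auto intro!: divide_pos_pos add_nonneg_pos)
  then obtain p where p: "trig_poly p" "(LINT x|torus. (cmod (f x - p x))\<^sup>2) < e / ((cmod c)\<^sup>2 + 1)"
    using assms unfolding trig_approx_def by meson
  have "(LINT x|torus. (cmod (c * f x - c * p x))\<^sup>2) = (cmod c)\<^sup>2 * (LINT x|torus. (cmod (f x - p x))\<^sup>2)"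
    by (simp add: right_diff_distrib[symmetric] norm_mult power_mult_distrib)
  also have "\<dots> \<le> (cmod c)\<^sup>2 * (e / ((cmod c)\<^sup>2 + 1))"
    using p(2) by (intro mult_left_mono) auto
  also have "\<dots> < e"
  proof -
    have "0 < (cmod c)\<^sup>2 + 1" by (simp add: add_nonneg_pos)
    then show ?thesis using \<open>e > 0\<close> by (simp add: divide_less_eq algebra_simps)
  qed
  finally show "\<exists>p. trig_poly p \<and> (LINT x|torus. (cmod (c * f x - p x))\<^sup>2) < e"
    using trig_poly_cmult[OF p(1), of c] by blast
qed

lemma trig_approx_add:
  assumes "trig_approx f" "trig_approx g"
  shows "trig_approx (\<lambda>x. f x + g x)"
  unfolding trig_approx_def
proof (intro conjI allI impI)
  show "sq_integrable torus (\<lambda>x. f x + g x)"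
    using assms by (auto simp: trig_approx_def intro: sq_integrable_add)
  fix e :: real assume "e > 0"
  then have "e / 4 > 0" by simp
  obtain p where p: "trig_poly p" "(LINT x|torus. (cmod (f x - p x))\<^sup>2) < e / 4"
    using assms(1) \<open>e / 4 > 0\<close> unfolding trig_approx_def by meson
  obtain q where q: "trig_poly q" "(LINT x|torus. (cmod (g x - q x))\<^sup>2) < e / 4"
    using assms(2) \<open>e / 4 > 0\<close> unfolding trig_approx_def by meson
  have "(LINT x|torus. (cmod (f x + g x - (p x + q x)))\<^sup>2) = (LINT x|torus. (cmod ((f x - p x) + (g x - q x)))\<^sup>2)"
    by (simp add: algebra_simps)
  also have "\<dots> \<le> 2 * (LINT x|torus. (cmod (f x - p x))\<^sup>2) + 2 * (LINT x|torus. (cmod (g x - q x))\<^sup>2)"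
    using assms p(1) q(1) by (intro LINT_sq_add_le sq_integrable_diff) (auto simp: trig_approx_def trig_poly_sq_integrable)
  also have "\<dots> < e" using p(2) q(2) by simp
  finally show "\<exists>p. trig_poly p \<and> (LINT x|torus. (cmod (f x + g x - p x))\<^sup>2) < e"
    using trig_add[OF p(1) q(1)] by blast
qed

lemma trig_poly_approx: "trig_poly p \<Longrightarrow> trig_approx p"
  unfolding trig_approx_def by (auto intro!: exI[of _ p] trig_poly_sq_integrable)

lemma trig_approx_sum: "(\<And>i. i \<in> I \<Longrightarrow> trig_approx (p i)) \<Longrightarrow> trig_approx (\<lambda>x. \<Sum>i\<in>I. p i x)"
  by (induction I rule: infinite_finite_induct) (auto intro: trig_poly_approx trig_poly_const trig_approx_add)

lemma sets_torus_compact: "compact C \<Longrightarrow> C \<subseteq> cbox 0 (\<chi> j. 2 * pi) \<Longrightarrow> C \<in> sets (torus :: (real ^ 'd::finite) measure)"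
  unfolding torus_def by (simp add: sets_restrict_space_iff compact_imp_closed borel_closed)

text \<open>The circle map embeds the open cell into \<open>(S\<^sup>1)\<^sup>d\<close>, where Stone-Weierstrass approximates continuous cutoffs of
  the image of \<open>C\<close> by polynomials; these pull back to trigonometric polynomials.\<close>

lemma trig_approx_compact:
  fixes C :: "(real ^ 'd::finite) set"
  assumes C: "compact C" "C \<subseteq> box 0 (\<chi> j. 2 * pi)"
  shows "trig_approx (indicator C)"
proof (cases "C = {}")
  case True
  then show ?thesis using trig_poly_approx[OF trig_poly_const[of 0]] by (simp add: indicator_def[abs_def])
next
  case False
  have Cs [measurable]: "C \<in> sets torus"
    by (rule sets_torus_compact[OF C(1)]) (use C(2) box_subset_cbox in blast)
  let ?C = "circle_map ` C"
  define K where "K = (circle_map ` cbox 0 (\<chi> j. 2 * pi) :: (complex ^ 'd) set)"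
  have cK: "compact K" unfolding K_def by (intro compact_continuous_image continuous_circle_map compact_cbox)
  have cC: "closed ?C" by (intro compact_imp_closed compact_continuous_image continuous_circle_map C)
  \<comment> \<open>Continuous cutoffs, equal to 1 on the image of \<open>C\<close> and, for
    positive n, to 0 at distance 1/n or more. The image is closed, so they converge to its
    indicator.\<close>
  define h where "h n z = max 0 (1 - real n * infdist z ?C)" for n z
  have "\<exists>g. real_polynomial_function g \<and> (\<forall>z\<in>K. \<bar>h n z - g z\<bar> < inverse (Suc n))" for n
  proof -
    have "continuous_on K (h n)" unfolding h_def by (intro continuous_intros)
    from Stone_Weierstrass_real_polynomial_function[OF cK this, of "inverse (Suc n)"] show ?thesis
      by (metis inverse_positive_iff_positive of_nat_0_less_iff zero_less_Suc)
  qed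
  then obtain g where g: "\<And>n. real_polynomial_function (g n)"
    "\<And>n z. z \<in> K \<Longrightarrow> \<bar>h n z - g n z\<bar> < inverse (Suc n)" by metis
  have h_lim: "(\<lambda>n. h n (circle_map x)) \<longlonglongrightarrow> indicator C x" if x: "x \<in> cbox 0 (\<chi> j. 2 * pi)" for x
  proof (cases "x \<in> C")
    case True
    then have "h n (circle_map x) = 1" for n by (simp add: h_def)
    then show ?thesis using True by simp
  next
    case False
    have "circle_map x \<notin> ?C"
    proof
      assume "circle_map x \<in> ?C"
      then obtain y where y: "y \<in> C" "circle_map x = circle_map y" by auto
      have "x $ j = y $ j" for j
      proof (rule cis_inj_period)
        show "cis (x $ j) = cis (y $ j)" using y(2) by (simp add: circle_map_def vec_eq_iff)
      qed (use x y(1) C(2) in \<open>auto simp: mem_box_cart subset_iff\<close>)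
      then have "x = y" by (simp add: vec_eq_iff)
      then show False using y False by simp
    qed
    then have pos: "infdist (circle_map x) ?C > 0"
      using cC \<open>C \<noteq> {}\<close> in_closed_iff_infdist_zero[of ?C "circle_map x"] infdist_nonneg[of "circle_map x" ?C]
      by (auto simp: less_le)
    have "\<forall>\<^sub>F n in sequentially. h n (circle_map x) = 0"
    proof -
      obtain n0 :: nat where n0: "1 < real n0 * infdist (circle_map x) ?C"
        using reals_Archimedean3[OF pos] by blast
      have "h n (circle_map x) = 0" if "n \<ge> n0" for n
      proof -
        have "real n0 * infdist (circle_map x) ?C \<le> real n * infdist (circle_map x) ?C"
          using that pos by (intro mult_right_mono) auto
        then show ?thesis using n0 by (simp add: h_def)
      qed
      then show ?thesis unfolding eventually_sequentially by blast
    qed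
    then show ?thesis using False by (simp add: tendsto_eventually)
  qed
  have h_bd: "0 \<le> h n z" "h n z \<le> 1" for n z by (auto simp: h_def infdist_nonneg)
  define p where "p n x = complex_of_real (g n (circle_map x))" for n and x :: "real ^ 'd"
  have tp: "trig_poly (p n)" for n unfolding p_def by (rule trig_poly_polynomial[OF g(1)])
  have Kx: "circle_map x \<in> K" if "x \<in> space torus" for x
    using that by (auto simp: K_def torus_def space_restrict_space)
  have "(\<lambda>n. LINT x|torus. (cmod (indicator C x - p n x))\<^sup>2) \<longlonglongrightarrow> (LINT (x::real ^ 'd)|torus. 0)"
  proof (rule integral_dominated_convergence[where w = "\<lambda>_. 9"])
    \<comment> \<open>On the cell |p n| <= 1 + 1/(n+1) <= 2, so the difference from an indicator is
      at most 3, and 9 is its square.\<close>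
    show "integrable torus (\<lambda>x. 9::real)" by (simp add: finite_measure_torus finite_measure.integrable_const)
    show "(\<lambda>x. (cmod (indicator C x - p n x))\<^sup>2) \<in> borel_measurable torus" for n
      using trig_poly_measurable[OF tp[of n]] by measurable
    show "AE x in torus. (\<lambda>n. (cmod (indicator C x - p n x))\<^sup>2) \<longlonglongrightarrow> 0"
    proof (rule AE_I2)
      fix x assume x: "x \<in> space (torus :: (real ^ 'd) measure)"
      have "(\<lambda>n. h n (circle_map x) - g n (circle_map x)) \<longlonglongrightarrow> 0"
        by (rule Lim_null_comparison[OF _ LIMSEQ_inverse_real_of_nat])
           (use g(2)[OF Kx[OF x]] in \<open>auto intro!: always_eventually less_imp_le\<close>)
      then have "(\<lambda>n. h n (circle_map x) - (h n (circle_map x) - g n (circle_map x))) \<longlonglongrightarrow> indicator C x - 0"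
        using x by (intro tendsto_diff h_lim) (auto simp: torus_def space_restrict_space)
      then have "(\<lambda>n. p n x) \<longlonglongrightarrow> of_real (indicator C x)"
        unfolding p_def by (intro tendsto_of_real) simp
      then have "(\<lambda>n. (cmod (indicator C x - p n x))\<^sup>2) \<longlonglongrightarrow> (cmod (indicator C x - of_real (indicator C x)))\<^sup>2"
        by (intro tendsto_intros)
      then show "(\<lambda>n. (cmod (indicator C x - p n x))\<^sup>2) \<longlonglongrightarrow> 0"
        by (cases "x \<in> C") simp_all
    qed
    show "AE x in torus. norm ((cmod (indicator C x - p n x))\<^sup>2) \<le> 9" for n
    proof (rule AE_I2)
      fix x assume x: "x \<in> space (torus :: (real ^ 'd) measure)"
      have "\<bar>g n (circle_map x)\<bar> \<le> 1 + inverse (Suc n)"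
        using g(2)[OF Kx[OF x], of n] h_bd[of n "circle_map x"] by linarith
      also have "\<dots> \<le> 2" by (simp add: field_simps)
      finally have "cmod (p n x) \<le> 2" by (simp add: p_def)
      then have "cmod (indicator C x - p n x) \<le> 3"
        using norm_triangle_ineq4[of "indicator C x" "p n x"] by (auto simp: indicator_def split: if_splits)
      then have "(cmod (indicator C x - p n x))\<^sup>2 \<le> 3\<^sup>2" by (intro power_mono) auto
      then show "norm ((cmod (indicator C x - p n x))\<^sup>2) \<le> 9" by simp
    qed
  qed auto
  then have lim: "(\<lambda>n. LINT x|torus. (cmod (indicator C x - p n x))\<^sup>2) \<longlonglongrightarrow> 0" by simp
  show ?thesis unfolding trig_approx_def
  proof (intro conjI allI impI)
    show "sq_integrable torus (indicator C)"
      by (rule sq_integrable_bounded[where B=1]) (auto simp: finite_measure_torus indicator_def)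
    fix e :: real assume "e > 0"
    from order_tendstoD(2)[OF lim this] obtain n where "(LINT x|torus. (cmod (indicator C x - p n x))\<^sup>2) < e"
      by (auto simp: eventually_sequentially)
    then show "\<exists>p. trig_poly p \<and> (LINT x|torus. (cmod (indicator C x - p x))\<^sup>2) < e"
      using tp by blast
  qed
qed

text \<open>Inner regularity replaces a measurable set by a compact one. Intersecting with the open
  cell first costs only the negligible boundary and makes the compact set fit
  \<open>trig_approx_compact\<close>.\<close>

lemma trig_approx_indicator:
  fixes A :: "(real ^ 'd::finite) set"
  assumes A: "A \<in> sets torus"
  shows "trig_approx (indicator A)"
proof (rule trig_approx_close)
  interpret finite_measure "torus :: (real ^ 'd) measure" by (rule finite_measure_torus)
  note [measurable] = A
  show "sq_integrable torus (indicator A)"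
    by (rule sq_integrable_bounded[where B=1]) (auto simp: finite_measure_torus indicator_def)
  fix e :: real assume "e > 0"
  let ?Q = "cbox 0 (\<chi> j. 2 * pi) :: (real ^ 'd) set"
  let ?B = "box 0 (\<chi> j. 2 * pi) :: (real ^ 'd) set"
  have AL: "A \<in> sets lebesgue" "A \<subseteq> ?Q"
    using A by (auto simp: torus_def sets_restrict_space_iff)
  then have AB: "A \<inter> ?B \<in> sets lebesgue" by auto
  obtain C where C: "closed C" "C \<subseteq> A \<inter> ?B" "(A \<inter> ?B) - C \<in> lmeasurable" "emeasure lebesgue ((A \<inter> ?B) - C) < ennreal e"
    using sets_lebesgue_inner_closed[OF AB \<open>e > 0\<close>] by metis
  have cC: "compact C"
    using C(1,2) bounded_subset[OF bounded_box] by (auto simp: compact_eq_bounded_closed)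
  have Cs [measurable]: "C \<in> sets torus"
    by (rule sets_torus_compact[OF cC]) (use C(2) box_subset_cbox in blast)
  have "negligible (?Q - ?B)" by (rule negligible_frontier_interval)
  then have neg: "negligible (A - C - (A \<inter> ?B - C))"
    by (rule negligible_subset) (use AL in auto)
  have "(LINT x|torus. (cmod (indicator A x - indicator C x))\<^sup>2) = (LINT x|torus. indicator (A - C) x)"
    using C(2) by (intro Bochner_Integration.integral_cong refl) (auto simp: indicator_def)
  also have "\<dots> = measure torus (A - C)" by simp
  also have "\<dots> = measure lebesgue (A - C)"
    unfolding torus_def by (rule measure_restrict_space) (use AL in auto)
  also have "\<dots> = measure lebesgue (A \<inter> ?B - C)"
    by (rule measure_negligible_symdiff)
       (use neg C(3) in \<open>auto elim!: negligible_subset\<close>)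
  also have "\<dots> < e"
    using C(3,4) \<open>e > 0\<close> by (simp add: emeasure_eq_measure2 ennreal_less_iff)
  finally show "\<exists>g. trig_approx g \<and> (LINT x|torus. (cmod (indicator A x - g x))\<^sup>2) < e"
    using trig_approx_compact[OF cC] C(2) by blast
qed

text \<open>Completeness of the waves. Simple functions that converge to \<open>f\<close> and are
  bounded by 2 |f| converge in L^2 by dominated convergence, and each of them is a combination of
  indicators.\<close>

lemma trig_approx_sq_integrable:
  fixes f :: "real ^ 'd::finite \<Rightarrow> complex"
  assumes f: "sq_integrable torus f"
  shows "trig_approx f"
proof (rule trig_approx_close[OF f])
  fix e :: real assume "e > 0"
  have fm [measurable]: "f \<in> borel_measurable torus" using f by (simp add: sq_integrable_def)
  have *: "\<exists>s. \<forall>i. simple_function torus (s i) \<and> (\<forall>x\<in>space torus. (\<lambda>i. s i x) \<longlonglongrightarrow> f x \<and> cmod (s i x) \<le> 2 * cmod (f x))"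
    using borel_measurable_implies_sequence_metric[OF fm, of 0] unfolding dist_norm diff_zero by meson
  obtain s where
    s: "\<And>i. simple_function torus (s i)" "\<And>x. x \<in> space torus \<Longrightarrow> (\<lambda>i. s i x) \<longlonglongrightarrow> f x"
    "\<And>i x. x \<in> space torus \<Longrightarrow> cmod (s i x) \<le> 2 * cmod (f x)" using * by blast
  have sm [measurable]: "s i \<in> borel_measurable torus" for i
    by (rule borel_measurable_simple_function[OF s(1)])
  have "(\<lambda>n. LINT x|torus. (cmod (f x - s n x))\<^sup>2) \<longlonglongrightarrow> (LINT (x::real ^ 'd)|torus. 0)"
  proof (rule integral_dominated_convergence[where w = "\<lambda>x. 9 * (cmod (f x))\<^sup>2"])
    show "integrable torus (\<lambda>x. 9 * (cmod (f x))\<^sup>2)" using f by (simp add: sq_integrable_def)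
    show "AE x in torus. (\<lambda>n. (cmod (f x - s n x))\<^sup>2) \<longlonglongrightarrow> 0"
    proof (rule AE_I2)
      fix x assume x: "x \<in> space (torus :: (real ^ 'd) measure)"
      have "(\<lambda>n. (cmod (f x - s n x))\<^sup>2) \<longlonglongrightarrow> (cmod (f x - f x))\<^sup>2"
        by (intro tendsto_intros s(2)[OF x])
      then show "(\<lambda>n. (cmod (f x - s n x))\<^sup>2) \<longlonglongrightarrow> 0" by simp
    qed
    show "AE x in torus. norm ((cmod (f x - s n x))\<^sup>2) \<le> 9 * (cmod (f x))\<^sup>2" for n
    proof (rule AE_I2)
      fix x assume x: "x \<in> space (torus :: (real ^ 'd) measure)"
      have "cmod (f x - s n x) \<le> 3 * cmod (f x)"
        using norm_triangle_ineq4[of "f x" "s n x"] s(3)[OF x, of n] by simp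
      then have "(cmod (f x - s n x))\<^sup>2 \<le> (3 * cmod (f x))\<^sup>2" by (intro power_mono) auto
      then show "norm ((cmod (f x - s n x))\<^sup>2) \<le> 9 * (cmod (f x))\<^sup>2" by (simp add: power_mult_distrib)
    qed
  qed measurable
  then have "(\<lambda>n. LINT x|torus. (cmod (f x - s n x))\<^sup>2) \<longlonglongrightarrow> 0" by simp
  from order_tendstoD(2)[OF this \<open>e > 0\<close>] obtain n where n: "(LINT x|torus. (cmod (f x - s n x))\<^sup>2) < e"
    by (auto simp: eventually_sequentially)
  define g where "g x = (\<Sum>y\<in>s n ` space torus. y * indicator (s n -` {y} \<inter> space torus) x)" for x
  have "trig_approx g"
    unfolding g_def by (intro trig_approx_sum trig_approx_cmult trig_approx_indicator simple_functionD(2)[OF s(1)])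
  moreover have "g x = s n x" if "x \<in> space torus" for x
  proof -
    have "g x = (\<Sum>y\<in>s n ` space torus. if y = s n x then y else 0)"
      unfolding g_def using that by (intro sum.cong) (auto simp: indicator_def)
    also have "\<dots> = s n x" using simple_functionD(1)[OF s(1), of n] that by (simp add: sum.delta)
    finally show ?thesis .
  qed
  then have "(LINT x|torus. (cmod (f x - g x))\<^sup>2) = (LINT x|torus. (cmod (f x - s n x))\<^sup>2)"
    by (intro Bochner_Integration.integral_cong) auto
  then have "(LINT x|torus. (cmod (f x - g x))\<^sup>2) < e"
    using n by simp
  ultimately show "\<exists>g. trig_approx g \<and> (LINT x|torus. (cmod (f x - g x))\<^sup>2) < e" by blast
qed

section \<open>Fourier sums, Bessel's inequality and Parseval's identity\<close>

lemma wave_orthogonal: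
  "(LINT x|torus. wave k x * cnj (wave l x)) = (if k = l then of_real ((2 * pi) ^ CARD('d)) else 0)"
  for k l :: "int ^ 'd::finite"
  using integral_wave[of "k - l"] by (simp add: wave_mult_cnj)

lemma LINT_mult_trig_sum:
  fixes c :: "int ^ 'd::finite \<Rightarrow> complex"
  assumes f: "sq_integrable torus f"
  shows "(LINT x|torus. f x * cnj (\<Sum>k\<in>K. c k * wave k x)) =
     of_real ((2 * pi) ^ CARD('d)) * (\<Sum>k\<in>K. fourier_coeff f k * cnj (c k))"
proof -
  have I: "integrable torus (\<lambda>x. f x * cnj (wave k x))" for k
    by (intro sq_integrable_mult f sq_integrable_cnj) (use sq_integrable_wave[of 1 k] in simp)
  have "(LINT x|torus. f x * cnj (\<Sum>k\<in>K. c k * wave k x)) = (LINT x|torus. (\<Sum>k\<in>K. cnj (c k) * (f x * cnj (wave k x))))"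
    by (intro Bochner_Integration.integral_cong refl) (simp add: sum_distrib_left mult_ac)
  also have "\<dots> = (\<Sum>k\<in>K. cnj (c k) * (LINT x|torus. f x * cnj (wave k x)))"
    using I by (subst Bochner_Integration.integral_sum) auto
  also have "\<dots> = of_real ((2 * pi) ^ CARD('d)) * (\<Sum>k\<in>K. fourier_coeff f k * cnj (c k))"
    by (simp add: fourier_coeff_wave_def sum_distrib_left mult_ac)
  finally show ?thesis .
qed

lemma fourier_coeff_trig_sum:
  fixes c :: "int ^ 'd::finite \<Rightarrow> complex"
  assumes "finite K"
  shows "fourier_coeff (\<lambda>x. \<Sum>k\<in>K. c k * wave k x) l = (if l \<in> K then c l else 0)"
proof -
  have I: "integrable torus (\<lambda>x. wave k x * cnj (wave l x))" for k
    by (intro sq_integrable_mult sq_integrable_cnj)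
       (use sq_integrable_wave[of 1 k] sq_integrable_wave[of 1 l] in simp_all)
  have "(LINT x|torus. (\<Sum>k\<in>K. c k * wave k x) * cnj (wave l x)) = (LINT x|torus. (\<Sum>k\<in>K. c k * (wave k x * cnj (wave l x))))"
    by (intro Bochner_Integration.integral_cong refl) (simp add: sum_distrib_right mult.assoc)
  also have "\<dots> = (\<Sum>k\<in>K. c k * (LINT x|torus. wave k x * cnj (wave l x)))"
    using I by (subst Bochner_Integration.integral_sum) auto
  also have "\<dots> = (if l \<in> K then c l else 0) * of_real ((2 * pi) ^ CARD('d))"
  proof -
    have "c k * (LINT x|torus. wave k x * cnj (wave l x)) = (if k = l then c l * of_real ((2 * pi) ^ CARD('d)) else 0)" for k
      by (simp add: wave_orthogonal)
    then show ?thesis using assms by simp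
  qed
  finally show ?thesis by (simp add: fourier_coeff_wave_def)
qed

lemma LINT_mult_cnj_self: "(LINT x|M. f x * cnj (f x)) = complex_of_real (LINT x|M. (cmod (f x))\<^sup>2)"
  unfolding complex_norm_square[symmetric] by (rule integral_complex_of_real)

text \<open>Completing the square. The sum of |f_k - c_k|^2 is the excess over the best
  approximation with frequencies in \<open>K\<close>; it vanishes for the Fourier coefficients,
  which yields Bessel's inequality and the optimality of Fourier sums.\<close>

lemma trig_sum_L2_dist:
  fixes c :: "int ^ 'd::finite \<Rightarrow> complex"
  assumes f: "sq_integrable torus f" and K: "finite K"
  shows "(LINT x|torus. (cmod (f x - (\<Sum>k\<in>K. c k * wave k x)))\<^sup>2) =
     (LINT x|torus. (cmod (f x))\<^sup>2) + (2 * pi) ^ CARD('d) *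
       ((\<Sum>k\<in>K. (cmod (fourier_coeff f k - c k))\<^sup>2) - (\<Sum>k\<in>K. (cmod (fourier_coeff f k))\<^sup>2))"
proof -
  let ?V = "(2 * pi) ^ CARD('d)"
  define p where "p x = (\<Sum>k\<in>K. c k * wave k x)" for x
  have p: "sq_integrable torus p"
    unfolding p_def by (intro sq_integrable_sum sq_integrable_wave)
  have pp: "(LINT x|torus. p x * cnj (p x)) = of_real (?V * (\<Sum>k\<in>K. (cmod (c k))\<^sup>2))"
  proof -
    have "fourier_coeff p k = c k" if "k \<in> K" for k
      unfolding p_def[abs_def] using fourier_coeff_trig_sum[OF K, of c k] that by simp
    then show ?thesis
      using LINT_mult_trig_sum[OF p, of c K]
      unfolding of_real_mult of_real_sum complex_norm_square by (simp add: p_def)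
  qed
  have fp: "(LINT x|torus. f x * cnj (p x)) = of_real ?V * (\<Sum>k\<in>K. fourier_coeff f k * cnj (c k))"
    using LINT_mult_trig_sum[OF f, of c K] by (simp add: p_def)
  note I = sq_integrable_mult[OF f sq_integrable_cnj[OF f]] sq_integrable_mult[OF p sq_integrable_cnj[OF p]]
    sq_integrable_mult[OF f sq_integrable_cnj[OF p]] sq_integrable_mult[OF p sq_integrable_cnj[OF f]]
  have "complex_of_real (LINT x|torus. (cmod (f x - p x))\<^sup>2) = (LINT x|torus. (f x - p x) * cnj (f x - p x))"
    by (rule LINT_mult_cnj_self[symmetric])
  also have "\<dots> = (LINT x|torus. f x * cnj (f x) - f x * cnj (p x) - p x * cnj (f x) + p x * cnj (p x))"
    by (simp add: algebra_simps)
  also have "\<dots> = (LINT x|torus. f x * cnj (f x)) - (LINT x|torus. f x * cnj (p x)) - (LINT x|torus. p x * cnj (f x)) + (LINT x|torus. p x * cnj (p x))"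
    using I by simp
  also have "(LINT x|torus. p x * cnj (f x)) = cnj (LINT x|torus. f x * cnj (p x))"
    unfolding Bochner_Integration.integral_cnj[symmetric] by (intro Bochner_Integration.integral_cong) (auto simp: mult.commute)
  also have "(LINT x|torus. f x * cnj (f x)) = of_real (LINT x|torus. (cmod (f x))\<^sup>2)"
    by (rule LINT_mult_cnj_self)
  finally have "complex_of_real (LINT x|torus. (cmod (f x - p x))\<^sup>2) =
      of_real (LINT x|torus. (cmod (f x))\<^sup>2) - of_real ?V * (\<Sum>k\<in>K. fourier_coeff f k * cnj (c k))
       - cnj (of_real ?V * (\<Sum>k\<in>K. fourier_coeff f k * cnj (c k))) + of_real (?V * (\<Sum>k\<in>K. (cmod (c k))\<^sup>2))"
    unfolding pp fp .
  also have "\<dots> = of_real (LINT x|torus. (cmod (f x))\<^sup>2) + of_real ?V *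
     (\<Sum>k\<in>K. of_real ((cmod (c k))\<^sup>2) - fourier_coeff f k * cnj (c k) - cnj (fourier_coeff f k) * c k)"
    by (simp add: sum_subtractf sum.distrib algebra_simps)
  also have "\<dots> = of_real (LINT x|torus. (cmod (f x))\<^sup>2) + of_real ?V *
     (\<Sum>k\<in>K. of_real ((cmod (fourier_coeff f k - c k))\<^sup>2 - (cmod (fourier_coeff f k))\<^sup>2))"
    unfolding of_real_diff complex_norm_square by (simp add: algebra_simps)
  also have "\<dots> = of_real ((LINT x|torus. (cmod (f x))\<^sup>2) + ?V *
       ((\<Sum>k\<in>K. (cmod (fourier_coeff f k - c k))\<^sup>2) - (\<Sum>k\<in>K. (cmod (fourier_coeff f k))\<^sup>2)))"
    by (simp add: sum_subtractf)
  finally show ?thesis unfolding p_def of_real_eq_iff .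
qed

text \<open>Truncation by cubes instead of balls keeps the count in \<open>card_modes_le\<close>
  elementary; that count later bounds the sup norm of a Fourier sum.\<close>

definition modes :: "nat \<Rightarrow> (int ^ 'd::finite) set" where
  "modes N = {k. \<forall>j. \<bar>k $ j\<bar> \<le> int N}"

lemma modes_subset_PiE:
  "(modes N :: (int ^ 'd::finite) set) \<subseteq> (\<lambda>f. \<chi> j. f j) ` (UNIV \<rightarrow>\<^sub>E {- int N..int N})"
proof
  fix k :: "int ^ 'd" assume "k \<in> modes N"
  then show "k \<in> (\<lambda>f. \<chi> j. f j) ` (UNIV \<rightarrow>\<^sub>E {- int N..int N})"
    by (intro image_eqI[of _ _ "\<lambda>j. k $ j"]) (auto simp: modes_def abs_le_iff minus_le_iff)
qed

lemma finite_modes: "finite (modes N :: (int ^ 'd::finite) set)"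
  by (rule finite_subset[OF modes_subset_PiE]) (intro finite_imageI finite_PiE, auto)

lemma card_modes_le: "card (modes N :: (int ^ 'd::finite) set) \<le> (2 * N + 1) ^ CARD('d)"
proof -
  have "card (modes N :: (int ^ 'd) set) \<le> card (UNIV \<rightarrow>\<^sub>E {- int N..int N} :: ('d \<Rightarrow> int) set)"
    by (rule surj_card_le[OF _ modes_subset_PiE]) (intro finite_PiE, auto)
  also have "\<dots> = (2 * N + 1) ^ CARD('d)"
    by (simp add: card_PiE nat_add_distrib nat_mult_distrib)
  finally show ?thesis .
qed

lemma modes_mono: "m \<le> n \<Longrightarrow> modes m \<subseteq> modes n"
  unfolding modes_def by (auto intro: order_trans)

lemma finite_subset_modes:
  assumes "finite (K :: (int ^ 'd::finite) set)"
  shows "\<exists>N. K \<subseteq> modes N"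
  using assms
proof induction
  case (insert k K)
  then obtain N where "K \<subseteq> modes N" by blast
  moreover have "k \<in> modes (\<Sum>j\<in>UNIV. nat \<bar>k $ j\<bar>)"
  proof -
    have "nat \<bar>k $ j\<bar> \<le> (\<Sum>j\<in>UNIV. nat \<bar>k $ j\<bar>)" for j
      by (rule member_le_sum) auto
    then show ?thesis unfolding modes_def by (auto simp: nat_le_iff)
  qed
  ultimately have "insert k K \<subseteq> modes (max N (\<Sum>j\<in>UNIV. nat \<bar>k $ j\<bar>))"
    using modes_mono[of N "max N (\<Sum>j\<in>UNIV. nat \<bar>k $ j\<bar>)"]
      modes_mono[of "\<Sum>j\<in>UNIV. nat \<bar>k $ j\<bar>" "max N (\<Sum>j\<in>UNIV. nat \<bar>k $ j\<bar>)"] by auto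
  then show ?case by blast
qed auto

definition fourier_sum :: "nat \<Rightarrow> (real ^ 'd::finite \<Rightarrow> complex) \<Rightarrow> real ^ 'd \<Rightarrow> complex" where
  "fourier_sum N f x = (\<Sum>k\<in>modes N. fourier_coeff f k * wave k x)"

lemma sq_integrable_fourier_sum: "sq_integrable torus (fourier_sum N f)"
  unfolding fourier_sum_def[abs_def] by (intro sq_integrable_sum sq_integrable_wave)

lemma fourier_sum_L2_dist:
  fixes f :: "real ^ 'd::finite \<Rightarrow> complex"
  assumes "sq_integrable torus f"
  shows "(LINT x|torus. (cmod (f x - fourier_sum N f x))\<^sup>2) =
     (LINT x|torus. (cmod (f x))\<^sup>2) - (2 * pi) ^ CARD('d) * (\<Sum>k\<in>modes N. (cmod (fourier_coeff f k))\<^sup>2)"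
  using trig_sum_L2_dist[OF assms finite_modes, of "fourier_coeff f" N] by (simp add: fourier_sum_def)

lemma Bessel_inequality:
  fixes f :: "real ^ 'd::finite \<Rightarrow> complex"
  assumes "sq_integrable torus f" "finite K"
  shows "(2 * pi) ^ CARD('d) * (\<Sum>k\<in>K. (cmod (fourier_coeff f k))\<^sup>2) \<le> (LINT x|torus. (cmod (f x))\<^sup>2)"
proof -
  have "0 \<le> (LINT x|torus. (cmod (f x - (\<Sum>k\<in>K. fourier_coeff f k * wave k x)))\<^sup>2)" by simp
  then show ?thesis using trig_sum_L2_dist[OF assms, of "fourier_coeff f"] by simp
qed

text \<open>A Fourier sum is the best approximation by its frequencies, so it is at least as close
  to \<open>f\<close> as any trigonometric polynomial whose frequencies lie in
  \<open>modes n\<close>. Density of the latter does the rest.\<close>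

lemma fourier_sum_tendsto:
  fixes f :: "real ^ 'd::finite \<Rightarrow> complex"
  assumes f: "sq_integrable torus f"
  shows "(\<lambda>N. LINT x|torus. (cmod (f x - fourier_sum N f x))\<^sup>2) \<longlonglongrightarrow> 0"
proof (rule LIMSEQ_I)
  fix e :: real assume "0 < e"
  then obtain p where p: "trig_poly p" "(LINT x|torus. (cmod (f x - p x))\<^sup>2) < e"
    using trig_approx_sq_integrable[OF f] unfolding trig_approx_def by blast
  then obtain K c where K: "finite K" "p = (\<lambda>x. \<Sum>k\<in>K. c k * wave k x)"
    using trig_poly_finite_sum by blast
  obtain N where N: "K \<subseteq> modes N" using finite_subset_modes[OF K(1)] by blast
  show "\<exists>no. \<forall>n\<ge>no. norm ((LINT x|torus. (cmod (f x - fourier_sum n f x))\<^sup>2) - 0) < e"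
  proof (intro exI[of _ N] allI impI)
    fix n assume "N \<le> n"
    then have "K \<subseteq> modes n" using N modes_mono by blast
    then have "(\<Sum>k\<in>K. (cmod (fourier_coeff f k))\<^sup>2) \<le> (\<Sum>k\<in>modes n. (cmod (fourier_coeff f k))\<^sup>2)"
      by (intro sum_mono2 finite_modes) auto
    moreover have "0 \<le> (\<Sum>k\<in>K. (cmod (fourier_coeff f k - c k))\<^sup>2)" by (intro sum_nonneg) auto
    ultimately have "(2 * pi) ^ CARD('d) * - (\<Sum>k\<in>modes n. (cmod (fourier_coeff f k))\<^sup>2) \<le>
       (2 * pi) ^ CARD('d) * ((\<Sum>k\<in>K. (cmod (fourier_coeff f k - c k))\<^sup>2) - (\<Sum>k\<in>K. (cmod (fourier_coeff f k))\<^sup>2))"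
      by (intro mult_left_mono) auto
    then have "(LINT x|torus. (cmod (f x - fourier_sum n f x))\<^sup>2) \<le> (LINT x|torus. (cmod (f x - p x))\<^sup>2)"
      unfolding K(2) trig_sum_L2_dist[OF f K(1)] fourier_sum_L2_dist[OF f] by simp
    then show "norm ((LINT x|torus. (cmod (f x - fourier_sum n f x))\<^sup>2) - 0) < e"
      using p(2) by simp
  qed
qed

lemma Parseval:
  fixes f :: "real ^ 'd::finite \<Rightarrow> complex"
  assumes f: "sq_integrable torus f"
  shows "(\<lambda>N. (2 * pi) ^ CARD('d) * (\<Sum>k\<in>modes N. (cmod (fourier_coeff f k))\<^sup>2)) \<longlonglongrightarrow> (LINT x|torus. (cmod (f x))\<^sup>2)"
  using tendsto_diff[OF tendsto_const[of "LINT x|torus. (cmod (f x))\<^sup>2"] fourier_sum_tendsto[OF f]]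
  by (simp add: fourier_sum_L2_dist[OF f])

text \<open>Only \<open>g\<close> is replaced by its partial sums, and Cauchy-Schwarz controls the
  error. The identity is kept as a limit of truncations because it is later passed through time
  integrals by dominated convergence.\<close>

lemma Parseval_inner:
  fixes f g :: "real ^ 'd::finite \<Rightarrow> complex"
  assumes f: "sq_integrable torus f" and g: "sq_integrable torus g"
  shows "(\<lambda>N. of_real ((2 * pi) ^ CARD('d)) * (\<Sum>k\<in>modes N. fourier_coeff f k * cnj (fourier_coeff g k)))
    \<longlonglongrightarrow> (LINT x|torus. f x * cnj (g x))"
proof -
  let ?d = "\<lambda>N. (LINT x|torus. f x * cnj (g x)) - of_real ((2 * pi) ^ CARD('d)) * (\<Sum>k\<in>modes N. fourier_coeff f k * cnj (fourier_coeff g k))"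
  let ?e = "\<lambda>N. sqrt (LINT x|torus. (cmod (f x))\<^sup>2) * sqrt (LINT x|torus. (cmod (g x - fourier_sum N g x))\<^sup>2)"
  have le: "cmod (?d N) \<le> ?e N" for N
  proof -
    have I: "integrable torus (\<lambda>x. f x * cnj (g x))" "integrable torus (\<lambda>x. f x * cnj (fourier_sum N g x))"
      by (rule sq_integrable_mult[OF f sq_integrable_cnj[OF g]],
          rule sq_integrable_mult[OF f sq_integrable_cnj[OF sq_integrable_fourier_sum]])
    have "?d N = (LINT x|torus. f x * cnj (g x)) - (LINT x|torus. f x * cnj (fourier_sum N g x))"
      using LINT_mult_trig_sum[OF f, of "fourier_coeff g" "modes N"] by (simp add: fourier_sum_def)
    also have "\<dots> = (LINT x|torus. f x * cnj (g x) - f x * cnj (fourier_sum N g x))"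
      using I by (rule Bochner_Integration.integral_diff[symmetric])
    also have "\<dots> = (LINT x|torus. f x * cnj (g x - fourier_sum N g x))"
      by (simp add: right_diff_distrib)
    finally have "?d N = (LINT x|torus. f x * cnj (g x - fourier_sum N g x))" .
    also have "cmod \<dots> \<le> sqrt (LINT x|torus. (cmod (f x))\<^sup>2) * sqrt (LINT x|torus. (cmod (cnj (g x - fourier_sum N g x)))\<^sup>2)"
      by (rule Cauchy_Schwarz_integral_cmod[OF f sq_integrable_cnj[OF sq_integrable_diff[OF g sq_integrable_fourier_sum]]])
    finally show ?thesis unfolding complex_mod_cnj .
  qed
  have "?e \<longlonglongrightarrow> sqrt (LINT x|torus. (cmod (f x))\<^sup>2) * sqrt 0"
    by (intro tendsto_mult tendsto_const tendsto_real_sqrt fourier_sum_tendsto g)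
  then have "?e \<longlonglongrightarrow> 0" by simp
  then have "?d \<longlonglongrightarrow> 0"
    by (rule Lim_null_comparison[OF always_eventually, rotated]) (use le in blast)
  from tendsto_diff[OF tendsto_const[of "LINT x|torus. f x * cnj (g x)"] this] show ?thesis by simp
qed

section \<open>Test functions\<close>

lemma dir_deriv_eq: "(f has_derivative f') (at x) \<Longrightarrow> dir_deriv v f x = f' v"
  unfolding dir_deriv_def using frechet_derivative_at by metis

lemma is_Ck_Suc_imp: "is_Ck (Suc k) f \<Longrightarrow> is_Ck k f"
proof (induction k arbitrary: f)
  case 0
  then show ?case
    by (auto intro!: differentiable_imp_continuous_on simp: differentiable_on_def differentiable_at_withinI)
next
  case (Suc k)
  then show ?case by (metis is_Ck.simps(2))
qed

lemma is_Ck_const: "is_Ck k (\<lambda>x. c)"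
proof (induction k arbitrary: c)
  case (Suc k)
  have "dir_deriv v (\<lambda>x. c) = (\<lambda>x. 0)" for v :: 'a
    by (rule ext, rule dir_deriv_eq, rule has_derivative_const)
  then show ?case using Suc by auto
qed auto

lemma is_Ck_add:
  assumes "is_Ck k f" "is_Ck k g"
  shows "is_Ck k (\<lambda>x. f x + g x)"
  using assms
proof (induction k arbitrary: f g)
  case (Suc k)
  then have d: "f differentiable at x" "g differentiable at x" for x by auto
  have "dir_deriv v (\<lambda>x. f x + g x) = (\<lambda>x. dir_deriv v f x + dir_deriv v g x)" for v
  proof
    fix x
    show "dir_deriv v (\<lambda>x. f x + g x) x = dir_deriv v f x + dir_deriv v g x"
      unfolding dir_deriv_def[of v f] dir_deriv_def[of v g]
      by (rule dir_deriv_eq, rule has_derivative_add) (use d in \<open>simp_all add: frechet_derivative_works\<close>)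
  qed
  then show ?case using Suc d by auto
qed (auto intro: continuous_intros)

lemma is_Ck_mult:
  assumes "is_Ck k f" "is_Ck k g"
  shows "is_Ck k (\<lambda>x. f x * g x)"
  using assms
proof (induction k arbitrary: f g)
  case (Suc k)
  then have d: "f differentiable at x" "g differentiable at x" for x by auto
  have "dir_deriv v (\<lambda>x. f x * g x) = (\<lambda>x. f x * dir_deriv v g x + dir_deriv v f x * g x)" for v
  proof
    fix x
    show "dir_deriv v (\<lambda>x. f x * g x) x = f x * dir_deriv v g x + dir_deriv v f x * g x"
      unfolding dir_deriv_def[of v f] dir_deriv_def[of v g]
      by (rule dir_deriv_eq, rule has_derivative_mult) (use d in \<open>simp_all add: frechet_derivative_works\<close>)
  qed
  moreover have "is_Ck k f" "is_Ck k g" using Suc.prems is_Ck_Suc_imp by auto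
  ultimately show ?case using Suc d by (auto intro!: is_Ck_add)
qed (auto intro: continuous_intros)

lemma is_Ck_compose_affine:
  assumes "is_Ck k f" and L: "bounded_linear L"
  shows "is_Ck k (\<lambda>x. f (L x + a))"
  using assms(1)
proof (induction k arbitrary: f)
  case 0
  then show ?case
    using linear_continuous_on[OF L, of UNIV]
    by (auto intro!: continuous_on_compose2[of UNIV f] continuous_intros)
next
  case (Suc k)
  then have d: "f differentiable at x" for x by auto
  have D: "((\<lambda>x. f (L x + a)) has_derivative (\<lambda>v. frechet_derivative f (at (L x + a)) (L v))) (at x)" for x
  proof (rule has_derivative_compose[of "\<lambda>x. L x + a" L x UNIV])
    show "((\<lambda>x. L x + a) has_derivative L) (at x)"
      using has_derivative_add[OF bounded_linear_imp_has_derivative[OF L] has_derivative_const[of a]] by simp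
    show "(f has_derivative frechet_derivative f (at (L x + a))) (at (L x + a))"
      using d frechet_derivative_works by blast
  qed
  have "dir_deriv v (\<lambda>x. f (L x + a)) = (\<lambda>x. dir_deriv (L v) f (L x + a))" for v
  proof
    fix x
    show "dir_deriv v (\<lambda>x. f (L x + a)) x = dir_deriv (L v) f (L x + a)"
      unfolding dir_deriv_def[of "L v"] by (rule dir_deriv_eq[OF D])
  qed
  then show ?case using Suc differentiableI[OF D] by simp
qed

section \<open>Smooth cutoffs on the real line\<close>

lemma is_Ck_Suc_real:
  fixes f :: "real \<Rightarrow> complex"
  assumes D: "\<And>t. (f has_vector_derivative f' t) (at t)" and k: "is_Ck k f'"
  shows "is_Ck (Suc k) f"
proof -
  have "dir_deriv v f = (\<lambda>t. of_real v * f' t)" for v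
  proof
    show "dir_deriv v f t = of_real v * f' t" for t
      using dir_deriv_eq[OF D[of t, unfolded has_vector_derivative_def], of v] by (simp add: scaleR_conv_of_real)
  qed
  moreover have "f differentiable at t" for t
    using D[of t] unfolding has_vector_derivative_def differentiable_def by blast
  ultimately show ?thesis using k by (auto intro!: is_Ck_mult is_Ck_const)
qed

lemma is_Ck_cis: "is_Ck k (\<lambda>t. c * cis t)"
proof (induction k arbitrary: c)
  case 0
  then show ?case by (auto intro!: continuous_intros)
next
  case (Suc k)
  have "((\<lambda>t. c * cis t) has_vector_derivative (c * \<i>) * cis t) (at t)" for t
    unfolding has_vector_derivative_def
    by (auto intro!: derivative_eq_intros simp: scaleR_conv_of_real mult_ac)
  then show ?case using Suc by (intro is_Ck_Suc_real)
qed

text \<open>For n = 0 this is Cauchy's flat function e^(-1/t). The powers of 1/t make the span of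
  the family closed under differentiation, so that one induction proves smoothness for all n
  together.\<close>

definition flat :: "nat \<Rightarrow> real \<Rightarrow> real" where
  "flat n t = (if t > 0 then (1 / t) ^ n * exp (- (1 / t)) else 0)"

lemma flat_tendsto_0: "((\<lambda>t. flat n t) \<longlongrightarrow> 0) (at 0)"
proof -
  have "((\<lambda>t. inverse t ^ n / exp (inverse t)) \<longlongrightarrow> (0::real)) (at_right 0)"
    using filterlim_compose[OF tendsto_power_div_exp_0 filterlim_inverse_at_top_right] .
  then have r: "((\<lambda>t. flat n t) \<longlongrightarrow> 0) (at_right 0)"
    by (rule Lim_transform_eventually)
       (auto simp: flat_def exp_minus field_simps eventually_at_right_field intro!: exI[of _ 1])
  have l: "((\<lambda>t. flat n t) \<longlongrightarrow> 0) (at_left 0)"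
    by (rule tendsto_eventually) (auto simp: flat_def eventually_at_left_field intro!: exI[of _ "-1"])
  show ?thesis using r l filterlim_split_at by blast
qed

lemma flat_has_derivative:
  "(flat n has_real_derivative (flat (n + 2) t - real n * flat (n + 1) t)) (at t)"
proof -
  consider "t > 0" | "t < 0" | "t = 0" by linarith
  then show ?thesis
  proof cases
    case 1
    have "((\<lambda>t. (1 / t) ^ n * exp (- (1 / t))) has_real_derivative
        (1 / t) ^ (n + 2) * exp (- (1 / t)) - real n * ((1 / t) ^ (n + 1) * exp (- (1 / t)))) (at t)"
    proof -
      have i: "((\<lambda>t. 1 / t) has_real_derivative - ((1 / t)\<^sup>2)) (at t)"
        using 1 by (auto intro!: derivative_eq_intros simp: power2_eq_square)
      have e: "((\<lambda>t. exp (- (1 / t))) has_real_derivative exp (- (1 / t)) * - (- ((1 / t)\<^sup>2))) (at t)"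
        by (rule DERIV_chain2[OF DERIV_exp DERIV_minus[OF i]])
      have "(1 / t) ^ (n + 2) * exp (- (1 / t)) - real n * ((1 / t) ^ (n + 1) * exp (- (1 / t))) =
          (real n * (- ((1 / t)\<^sup>2) * (1 / t) ^ (n - Suc 0))) * exp (- (1 / t)) + (exp (- (1 / t)) * - (- ((1 / t)\<^sup>2))) * (1 / t) ^ n"
        by (cases n) (simp_all add: power2_eq_square algebra_simps del: power_divide power_one_over)
      then show ?thesis using DERIV_mult[OF DERIV_power[OF i, of n] e] by simp
    qed
    then have "(flat n has_real_derivative
        (1 / t) ^ (n + 2) * exp (- (1 / t)) - real n * ((1 / t) ^ (n + 1) * exp (- (1 / t)))) (at t)"
      by (rule has_field_derivative_transform_within_open[of _ _ _ "{0<..}"]) (use 1 in \<open>auto simp: flat_def\<close>)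
    then show ?thesis using 1 by (simp add: flat_def)
  next
    case 2
    have "(flat n has_real_derivative 0) (at t)"
      by (rule has_field_derivative_transform_within_open[of "\<lambda>_. 0" _ _ "{..<0}"]) (use 2 in \<open>auto simp: flat_def\<close>)
    then show ?thesis using 2 by (simp add: flat_def)
  next
    case 3
    \<comment> \<open>The difference quotient of \<open>flat n\<close> at 0 is
      \<open>flat (n + 1)\<close>, which tends to 0.\<close>
    have "((\<lambda>h. (flat n (0 + h) - flat n 0) / h) \<longlongrightarrow> 0) (at 0)"
      by (rule Lim_transform_eventually[OF flat_tendsto_0[of "n + 1"]])
         (auto simp: flat_def intro!: always_eventually)
    then show ?thesis using 3 by (simp add: DERIV_def flat_def)
  qed
qed

lemma is_Ck_flat: "is_Ck k (\<lambda>t. of_real (flat n t))"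
proof (induction k arbitrary: n)
  case 0
  have "continuous_on UNIV (flat n)"
    by (rule DERIV_continuous_on, rule has_field_derivative_at_within, rule flat_has_derivative)
  then show ?case by (auto intro!: continuous_intros)
next
  case (Suc k)
  have D: "((\<lambda>t. complex_of_real (flat n t)) has_vector_derivative
       of_real (flat (n + 2) t) + of_real (- real n) * of_real (flat (n + 1) t)) (at t)" for t
    using has_vector_derivative_of_real[OF flat_has_derivative[of n t, THEN has_field_derivative_at_within]]
    by (simp add: has_real_derivative_iff_has_vector_derivative)
  show ?case by (rule is_Ck_Suc_real[OF D]) (intro is_Ck_add is_Ck_mult is_Ck_const Suc)
qed

lemma continuous_has_antiderivative:
  fixes f :: "real \<Rightarrow> real"
  assumes "continuous_on UNIV f"
  obtains F where "\<And>t. (F has_real_derivative f t) (at t)"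
proof
  define F where "F t = (if t \<ge> 0 then integral {0..t} f else - integral {t..0} f)" for t
  fix t :: real
  \<comment> \<open>The fundamental theorem is applied on a compact interval. [-m, m] has
    \<open>t\<close> in its interior, and inside it \<open>F\<close> is the integral from -m up to a
    constant.\<close>
  define m where "m = \<bar>t\<bar> + 1"
  have c: "continuous_on S f" for S using assms continuous_on_subset by blast
  have i: "f integrable_on {a..b}" for a b by (rule integrable_continuous_interval[OF c])
  have eq: "integral {-m..s} f - integral {-m..0} f = F s" if "s \<in> {-m<..<m}" for s
  proof (cases "s \<ge> 0")
    case True
    then have "integral {-m..0} f + integral {0..s} f = integral {-m..s} f"
      by (intro Henstock_Kurzweil_Integration.integral_combine i) (auto simp: m_def)
    then show ?thesis using True by (simp add: F_def)
  next
    case False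
    then have "integral {-m..s} f + integral {s..0} f = integral {-m..0} f"
      using that by (intro Henstock_Kurzweil_Integration.integral_combine i) auto
    then show ?thesis using False by (simp add: F_def)
  qed
  have tm: "t \<in> {-m<..<m}" by (auto simp: m_def)
  have "((\<lambda>s. integral {-m..s} f) has_real_derivative f t) (at t within {-m..m})"
    by (rule integral_has_real_derivative[OF c]) (auto simp: m_def)
  then have "((\<lambda>s. integral {-m..s} f) has_real_derivative f t) (at t within {-m<..<m})"
    by (rule DERIV_subset) auto
  then have "((\<lambda>s. integral {-m..s} f) has_real_derivative f t) (at t)"
    by (subst (asm) at_within_open) (auto simp: m_def)
  then have "((\<lambda>s. integral {-m..s} f - integral {-m..0} f) has_real_derivative f t) (at t)"
    by (auto intro!: derivative_eq_intros)
  then show "(F has_real_derivative f t) (at t)"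
    by (rule has_field_derivative_transform_within_open[of _ _ _ "{-m<..<m}"]) (use tm eq in auto)
qed

text \<open>\<open>H\<close> is the normalized primitive of the bump e^(-1/t) e^(-1/(1-t)) on (0,
  1). The density \<open>h\<close> is exported along with it because n h(n (t - a)) will serve as an
  approximate identity.\<close>

lemma smooth_step:
  obtains H h :: "real \<Rightarrow> real" where
    "\<And>k. is_Ck k (\<lambda>t. of_real (H t))" "\<And>t. (H has_real_derivative h t) (at t)" "continuous_on UNIV h"
    "\<And>t. h t \<ge> 0" "\<And>t. t \<le> 0 \<Longrightarrow> h t = 0" "\<And>t. t \<ge> 1 \<Longrightarrow> h t = 0"
    "\<And>t. t \<le> 0 \<Longrightarrow> H t = 0" "\<And>t. t \<ge> 1 \<Longrightarrow> H t = 1" "\<And>t. 0 \<le> H t \<and> H t \<le> 1"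
proof -
  define b where "b t = flat 0 t * flat 0 (1 - t)" for t
  have flat_cont: "continuous_on S (flat n)" for n S
    by (rule DERIV_continuous_on, rule has_field_derivative_at_within, rule flat_has_derivative)
  have bc: "continuous_on UNIV b"
    unfolding b_def
  proof (rule continuous_on_mult[OF flat_cont])
    show "continuous_on UNIV (\<lambda>t. flat 0 (1 - t))"
      by (rule continuous_on_compose2[OF flat_cont[of UNIV 0]]) (auto intro!: continuous_on_diff continuous_on_const continuous_on_id)
  qed
  obtain F where F: "\<And>t. (F has_real_derivative b t) (at t)"
    using continuous_has_antiderivative[OF bc] by blast
  have b0: "b t \<ge> 0" for t by (simp add: b_def flat_def)
  have bpos: "b t > 0" if "0 < t" "t < 1" for t using that by (simp add: b_def flat_def)
  have mono: "F s \<le> F t" if "s \<le> t" for s t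
    by (rule DERIV_nonneg_imp_nondecreasing[OF that]) (rule exI conjI F b0)+
  have "F 0 < F 1"
  proof -
    obtain z where "0 < z" "z < 1" "F 1 - F 0 = (1 - 0) * b z"
      using MVT2[OF zero_less_one, of F b] F by blast
    then show ?thesis using bpos[of z] by simp
  qed
  define c where "c = F 1 - F 0"
  have c: "c > 0" using \<open>F 0 < F 1\<close> by (simp add: c_def)
  define H where "H t = (F t - F 0) / c" for t
  define h where "h t = b t / c" for t
  have D: "(H has_real_derivative h t) (at t)" for t
    unfolding H_def h_def by (rule DERIV_cdivide) (use DERIV_diff[OF F DERIV_const] in simp)
  have Fl: "F t = F 0" if "t \<le> 0" for t
  proof (cases "t < 0")
    case True
    have "F 0 = F t"
    proof (rule DERIV_isconst_end[of t 0 F])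
      show "continuous_on {t..0} F" by (rule DERIV_continuous_on, rule has_field_derivative_at_within, rule F)
      show "(F has_real_derivative 0) (at x)" if "t < x" "x < 0" for x
        using F[of x] that by (simp add: b_def flat_def)
    qed (use True in auto)
    then show ?thesis by simp
  qed (use that in auto)
  have Fr: "F t = F 1" if "t \<ge> 1" for t
  proof (cases "t > 1")
    case True
    show "F t = F 1"
    proof (rule DERIV_isconst_end[of 1 t F])
      show "continuous_on {1..t} F" by (rule DERIV_continuous_on, rule has_field_derivative_at_within, rule F)
      show "(F has_real_derivative 0) (at x)" if "1 < x" "x < t" for x
        using F[of x] that by (simp add: b_def flat_def)
    qed (use True in auto)
  qed (use that in auto)
  have bck: "is_Ck k (\<lambda>t. complex_of_real (h t))" for k
  proof -
    have "is_Ck k (\<lambda>t. of_real (1 / c) * (complex_of_real (flat 0 t) * of_real (flat 0 (- t + 1))))"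
      by (rule is_Ck_mult[OF is_Ck_const is_Ck_mult[OF is_Ck_flat
            is_Ck_compose_affine[OF is_Ck_flat bounded_linear_minus[OF bounded_linear_ident]]]])
    then show ?thesis by (simp add: h_def b_def)
  qed
  have Dv: "((\<lambda>t. complex_of_real (H t)) has_vector_derivative of_real (h t)) (at t)" for t
    by (rule has_vector_derivative_of_real[OF D])
  show thesis
  proof (rule that[of H h])
    show "is_Ck k (\<lambda>t. complex_of_real (H t))" for k
      by (rule is_Ck_Suc_imp, rule is_Ck_Suc_real[OF Dv bck])
    show "(H has_real_derivative h t) (at t)" for t by (rule D)
    show "continuous_on UNIV h" unfolding h_def by (rule continuous_on_divide[OF bc continuous_on_const]) (use c in auto)
    show "h t \<ge> 0" for t using b0 c by (simp add: h_def)
    show "t \<le> 0 \<Longrightarrow> h t = 0" for t by (simp add: h_def b_def flat_def)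
    show "t \<ge> 1 \<Longrightarrow> h t = 0" for t by (simp add: h_def b_def flat_def)
    show H0: "H t = 0" if "t \<le> 0" for t unfolding H_def Fl[OF that] by simp
    show H1: "H t = 1" if "t \<ge> 1" for t unfolding H_def Fr[OF that] using c by (simp add: c_def)
    show "0 \<le> H t \<and> H t \<le> 1" for t
    proof (cases "t \<le> 0 \<or> t \<ge> 1")
      case True
      then show ?thesis using H0 H1 by auto
    next
      case False
      then show ?thesis using mono[of 0 t] mono[of t 1] c by (auto simp: H_def c_def)
    qed
  qed
qed

section \<open>Weak differential equations in one time variable\<close>

lemma integrable_bounded_mult:
  fixes f g :: "'a \<Rightarrow> complex"
  assumes "integrable M f" "g \<in> borel_measurable M" "\<And>x. x \<in> space M \<Longrightarrow> cmod (g x) \<le> B"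
  shows "integrable M (\<lambda>x. g x * f x)"
proof (rule Bochner_Integration.integrable_bound)
  show "integrable M (\<lambda>x. B * cmod (f x))" using assms(1) by auto
  show "AE x in M. cmod (g x * f x) \<le> norm (B * cmod (f x))"
  proof (rule AE_I2)
    fix x assume x: "x \<in> space M"
    have "cmod (g x) * cmod (f x) \<le> B * cmod (f x)" by (intro mult_right_mono assms(3) x) auto
    also have "\<dots> \<le> norm (B * cmod (f x))" by simp
    finally show "cmod (g x * f x) \<le> norm (B * cmod (f x))" by (simp add: norm_mult)
  qed
qed (use assms in \<open>auto dest: borel_measurable_integrable\<close>)

lemma continuous_on_measurable_Icc:
  fixes f :: "real \<Rightarrow> 'b::{euclidean_space}"
  assumes "continuous_on {0..T} f"
  shows "f \<in> borel_measurable (lebesgue_on {0..T})"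
  by (rule continuous_imp_measurable_on_sets_lebesgue[OF assms]) auto

lemma integrable_continuous_mult:
  fixes f g :: "real \<Rightarrow> complex"
  assumes "integrable (lebesgue_on {0..T}) f" "continuous_on {0..T} g"
  shows "integrable (lebesgue_on {0..T}) (\<lambda>x. g x * f x)"
proof -
  have "compact (g ` {0..T})" by (rule compact_continuous_image[OF assms(2) compact_Icc])
  then have "bounded (g ` {0..T})" by (rule compact_imp_bounded)
  then obtain B where "\<forall>x\<in>{0..T}. cmod (g x) \<le> B"
    by (auto simp: bounded_iff)
  then show ?thesis
    by (intro integrable_bounded_mult[where B=B] assms(1) continuous_on_measurable_Icc assms(2))
       (auto simp: space_restrict_space)
qed

lemma AE_lebesgue_on_neq: "AE s in lebesgue_on {0..T::real}. s \<noteq> t"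
proof -
  have "AE s in lebesgue. s \<noteq> t"
    using AE_lborel_singleton[of t] by (rule AE_completion)
  then show ?thesis by (subst AE_restrict_space_iff) auto
qed

text \<open>Dominated convergence: the indicators of {..x n} converge to that of {..a} everywhere
  except possibly at \<open>a\<close> itself, which is a null set.\<close>

lemma continuous_on_indefinite:
  fixes Y :: "real \<Rightarrow> complex"
  assumes Y: "integrable (lebesgue_on {0..T}) Y"
  shows "continuous_on S (\<lambda>t. LINT s|lebesgue_on {0..T}. indicator {..t} s * Y s)"
  unfolding continuous_on_sequentially comp_def
proof (intro allI ballI impI)
  fix x :: "nat \<Rightarrow> real" and a assume x: "(\<forall>n. x n \<in> S) \<and> x \<longlonglongrightarrow> a"
  have [measurable]: "Y \<in> borel_measurable (lebesgue_on {0..T})" using Y by auto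
  have [measurable]: "(\<lambda>s. indicator {..t} s :: complex) \<in> borel_measurable (lebesgue_on {0..T})" for t :: real
    by (intro measurable_restrict_space1 borel_measurable_indicator) auto
  show "(\<lambda>n. LINT s|lebesgue_on {0..T}. indicator {..x n} s * Y s) \<longlonglongrightarrow> (LINT s|lebesgue_on {0..T}. indicator {..a} s * Y s)"
  proof (rule integral_dominated_convergence[where w = "\<lambda>s. cmod (Y s)"])
    show "AE s in lebesgue_on {0..T}. (\<lambda>n. indicator {..x n} s * Y s) \<longlonglongrightarrow> indicator {..a} s * Y s"
      using AE_lebesgue_on_neq[of a T]
    proof eventually_elim
      case (elim s)
      have "\<forall>\<^sub>F n in sequentially. indicator {..x n} s = (indicator {..a} s :: complex)"
      proof (cases "s < a")
        case True
        from order_tendstoD(1)[OF conjunct2[OF x] this] show ?thesis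
          by eventually_elim (use True in \<open>auto simp: indicator_def\<close>)
      next
        case False
        then have "a < s" using elim by simp
        from order_tendstoD(2)[OF conjunct2[OF x] this] show ?thesis
          by eventually_elim (use \<open>a < s\<close> in \<open>auto simp: indicator_def\<close>)
      qed
      then have "(\<lambda>n. indicator {..x n} s) \<longlonglongrightarrow> (indicator {..a} s :: complex)" by (rule tendsto_eventually)
      then show ?case by (intro tendsto_mult tendsto_const)
    qed
    show "AE s in lebesgue_on {0..T}. cmod (indicator {..x n} s * Y s) \<le> cmod (Y s)" for n
      by (auto simp: indicator_def)
  qed (use Y in \<open>auto intro!: borel_measurable_times\<close>)
qed

text \<open>These are the time factors of the test functions. The derivative is carried as a second
  argument because the weak equation is expressed through it.\<close>

definition cutoff_on :: "real \<Rightarrow> (real \<Rightarrow> real) \<Rightarrow> (real \<Rightarrow> real) \<Rightarrow> bool" where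
  "cutoff_on T \<psi> \<psi>' \<longleftrightarrow> (\<forall>k. is_Ck k (\<lambda>t. of_real (\<psi> t))) \<and> (\<forall>t. (\<psi> has_real_derivative \<psi>' t) (at t))
     \<and> continuous_on UNIV \<psi>' \<and> (\<exists>K. compact K \<and> K \<subseteq> {0<..<T} \<and> (\<forall>t. t \<notin> K \<longrightarrow> \<psi> t = 0))"

lemma space_lebesgue_on_Icc [simp]: "space (lebesgue_on {0..T::real}) = {0..T}"
  by (simp add: space_restrict_space)

lemma continuous_on_affine_arg:
  fixes h :: "real \<Rightarrow> real"
  assumes "continuous_on UNIV h"
  shows "continuous_on S (\<lambda>t. h (r * (t - a)))"
proof (rule continuous_on_compose2[OF assms])
  show "continuous_on S (\<lambda>t. r * (t - a))" by (intro continuous_on_mult continuous_on_diff continuous_on_const continuous_on_id)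
qed auto

text \<open>The functions n h(n (t - a)) form a one-sided approximate identity: they live on
  [a, a + 1/n], and their mass is an increment of \<open>H\<close>, equal to 1 for large n.\<close>

lemma bump_concentrates:
  fixes X :: "real \<Rightarrow> complex"
  assumes X: "continuous_on {0..T} X" and a: "0 < a" "a < T"
    and H: "\<And>t. (H has_real_derivative h t) (at t)" "continuous_on UNIV h"
    "\<And>t. h t \<ge> 0" "\<And>t. t \<le> 0 \<Longrightarrow> h t = 0" "\<And>t. t \<ge> 1 \<Longrightarrow> h t = 0"
    "\<And>t. t \<le> 0 \<Longrightarrow> H t = 0" "\<And>t. t \<ge> 1 \<Longrightarrow> H t = 1"
  shows "(\<lambda>n. LINT t|lebesgue_on {0..T}. of_real (real n * h (real n * (t - a))) * X t) \<longlonglongrightarrow> X a"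
proof (rule LIMSEQ_I)
  fix e :: real assume e: "e > 0"
  let ?M = "lebesgue_on {0..T}"
  have "isCont X a"
    using X a by (intro continuous_on_interior[of "{0..T}"]) auto
  then obtain d where d: "d > 0" "\<And>t. \<bar>t - a\<bar> < d \<Longrightarrow> cmod (X t - X a) < e / 2"
    using half_gt_zero[OF e] unfolding continuous_at_eps_delta dist_norm real_norm_def by blast
  \<comment> \<open>For n >= n0 the interval [a, a + 1/n] lies within distance \<open>d\<close> of
    \<open>a\<close> and ends before \<open>T\<close>.\<close>
  obtain n0 :: nat where n0: "1 < real n0 * min d (T - a)" using reals_Archimedean3[of "min d (T - a)"] d a by auto
  show "\<exists>no. \<forall>n\<ge>no. norm ((LINT t|?M. of_real (real n * h (real n * (t - a))) * X t) - X a) < e"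
  proof (intro exI[of _ n0] allI impI)
    fix n assume n: "n0 \<le> n"
    have "real n0 * min d (T - a) \<le> real n * min d (T - a)" using n d a by (intro mult_right_mono) auto
    then have n1: "1 < real n * min d (T - a)" using n0 by linarith
    then have npos: "real n > 0" by (cases "n = 0") auto
    have "real n * min d (T - a) \<le> real n * d" "real n * min d (T - a) \<le> real n * (T - a)"
      using npos by (auto intro!: mult_left_mono)
    then have n2: "1 < real n * d" "1 < real n * (T - a)" using n1 by linarith+
    define p where "p t = real n * h (real n * (t - a))" for t
    have pc: "continuous_on S p" for S
      unfolding p_def by (intro continuous_on_mult continuous_on_const continuous_on_affine_arg H(2))
    have p0: "p t \<ge> 0" for t using H(3) npos by (simp add: p_def)
    have D: "((\<lambda>t. H (real n * (t - a))) has_real_derivative p t) (at t)" for t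
    proof -
      have "((\<lambda>t. real n * (t - a)) has_real_derivative real n) (at t)"
        by (auto intro!: derivative_eq_intros)
      from DERIV_chain2[OF H(1) this] show ?thesis by (simp add: p_def mult.commute)
    qed
    have pI: "integrable ?M p" by (rule continuous_imp_integrable_real[OF pc])
    have "(p has_integral (H (real n * (T - a)) - H (real n * (0 - a)))) {0..T}"
      by (rule fundamental_theorem_of_calculus)
         (use a D in \<open>auto simp: has_real_derivative_iff_has_vector_derivative[symmetric] intro: has_field_derivative_at_within\<close>)
    then have "integral\<^sup>L ?M p = H (real n * (T - a)) - H (real n * (0 - a))"
      using lebesgue_integral_eq_integral[OF pI] by (simp add: integral_unique)
    also have "\<dots> = 1" using H(6)[of "real n * (0 - a)"] H(7)[of "real n * (T - a)"] n2 npos a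
      by (simp add: mult_nonneg_nonpos)
    finally have p1: "integral\<^sup>L ?M p = 1" .
    have pXc: "continuous_on {0..T} (\<lambda>t. of_real (p t) * X t)" by (intro continuous_on_mult continuous_on_of_real pc X)
    have pXI: "integrable ?M (\<lambda>t. of_real (p t) * X t)" by (rule continuous_imp_integrable_real[OF pXc])
    have pI2: "integrable ?M (\<lambda>t. of_real (p t) * X a)" using pI by auto
    have "(LINT t|?M. of_real (p t) * X t) - X a = (LINT t|?M. of_real (p t) * X t) - (LINT t|?M. of_real (p t) * X a)"
      by (simp add: p1)
    also have "\<dots> = (LINT t|?M. of_real (p t) * X t - of_real (p t) * X a)"
      by (rule Bochner_Integration.integral_diff[OF pXI pI2, symmetric])
    finally have "cmod ((LINT t|?M. of_real (p t) * X t) - X a) \<le> (LINT t|?M. cmod (of_real (p t) * X t - of_real (p t) * X a))"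
      by (simp only: integral_norm_bound)
    also have "\<dots> \<le> (LINT t|?M. p t * (e / 2))"
    proof (rule integral_mono)
      show "integrable ?M (\<lambda>t. cmod (of_real (p t) * X t - of_real (p t) * X a))"
        using pXI pI2 by (intro integrable_norm Bochner_Integration.integrable_diff)
      show "integrable ?M (\<lambda>t. p t * (e / 2))" by (intro integrable_mult_left pI)
      fix t assume "t \<in> space ?M"
      have "cmod (of_real (p t) * X t - of_real (p t) * X a) = p t * cmod (X t - X a)"
        using p0[of t] by (simp add: right_diff_distrib[symmetric] norm_mult)
      also have "\<dots> \<le> p t * (e / 2)"
      proof (cases "p t = 0")
        case False
        then have "\<not> real n * (t - a) \<le> 0" "\<not> 1 \<le> real n * (t - a)"
          using H(4)[of "real n * (t - a)"] H(5)[of "real n * (t - a)"] unfolding p_def by force+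
        then have "0 < real n * (t - a)" "real n * (t - a) < 1" by linarith+
        then have "real n * (t - a) < real n * d" "0 < t - a" using n2 npos by (linarith, simp add: zero_less_mult_iff)
        then have "\<bar>t - a\<bar> < d" using npos by simp
        then show ?thesis using p0[of t] d(2)[of t] by (intro mult_left_mono) auto
      qed simp
      finally show "cmod (of_real (p t) * X t - of_real (p t) * X a) \<le> p t * (e / 2)" .
    qed
    also have "\<dots> = e / 2" using p1 by simp
    also have "\<dots> < e" using e by simp
    finally show "norm ((LINT t|?M. of_real (real n * h (real n * (t - a))) * X t) - X a) < e"
      by (simp add: p_def)
  qed
qed

text \<open>The test functions are smoothed indicators of (a, b]. Their derivatives tend to the
  difference of the point masses at \<open>a\<close> and \<open>b\<close>, so the weak equation
  tends to X a - X b = - c times the integral of \<open>Y\<close> over (a, b].\<close>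

lemma weak_ODE:
  fixes X Y :: "real \<Rightarrow> complex"
  assumes T: "T > 0" and X: "continuous_on {0..T} X" and Y: "integrable (lebesgue_on {0..T}) Y"
    and eq: "\<And>\<psi> \<psi>'. cutoff_on T \<psi> \<psi>' \<Longrightarrow>
      (LINT t|lebesgue_on {0..T}. of_real (\<psi>' t) * X t) = - c * (LINT t|lebesgue_on {0..T}. of_real (\<psi> t) * Y t)"
    and t: "t \<in> {0..T}"
  shows "X t = X 0 + c * (LINT s|lebesgue_on {0..T}. indicator {..t} s * Y s)"
proof -
  let ?M = "lebesgue_on {0..T}"
  obtain H h :: "real \<Rightarrow> real" where H:
    "\<And>k. is_Ck k (\<lambda>t. of_real (H t))" "\<And>t. (H has_real_derivative h t) (at t)" "continuous_on UNIV h"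
    "\<And>t. h t \<ge> 0" "\<And>t. t \<le> 0 \<Longrightarrow> h t = 0" "\<And>t. t \<ge> 1 \<Longrightarrow> h t = 0"
    "\<And>t. t \<le> 0 \<Longrightarrow> H t = 0" "\<And>t. t \<ge> 1 \<Longrightarrow> H t = 1" "\<And>t. 0 \<le> H t \<and> H t \<le> 1"
    using smooth_step by blast
  have [measurable]: "Y \<in> borel_measurable ?M" using Y by auto
  have indm [measurable]: "(\<lambda>s. indicator {..t} s :: complex) \<in> borel_measurable ?M" for t :: real
    by (intro measurable_restrict_space1 borel_measurable_indicator) auto
  have indI: "integrable ?M (\<lambda>s. indicator {..t} s * Y s)" for t
    by (rule integrable_bounded_mult[OF Y indm, of _ 1]) (auto simp: indicator_def)
  define Z where "Z t = X t - c * (LINT s|?M. indicator {..t} s * Y s)" for t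
  have Zc: "continuous_on {0..T} Z"
    unfolding Z_def by (intro continuous_on_diff continuous_on_mult continuous_on_const X continuous_on_indefinite Y)
  have key: "Z a = Z b" if ab: "0 < a" "a \<le> b" "b < T" for a b
  proof -
    \<comment> \<open>A step up just after \<open>a\<close> followed by a step down just after
      \<open>b\<close>: for large n this is a smooth version of the indicator of (a, b].\<close>
    define \<psi> where "\<psi> n t = H (real n * (t - a)) - H (real n * (t - b))" for n :: nat and t
    define \<psi>' where "\<psi>' n t = real n * h (real n * (t - a)) - real n * h (real n * (t - b))" for n :: nat and t
    \<comment> \<open>The support lies in [a, b + 1/n], which stays inside the open interval once n
      (T - b) > 1.\<close>
    obtain n0 :: nat where n0: "1 < real n0 * (T - b)" using reals_Archimedean3[of "T - b"] ab by auto
    have cut: "cutoff_on T (\<psi> n) (\<psi>' n)" if n: "n \<ge> n0" for n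
    proof -
      have "real n0 * (T - b) \<le> real n * (T - b)" using n ab by (intro mult_right_mono) auto
      then have n1: "1 < real n * (T - b)" using n0 by linarith
      then have npos: "real n > 0" by (cases "n = 0") auto
      have Hc: "is_Ck k (\<lambda>t. complex_of_real (H (real n * (t - s))))" for k s
        using is_Ck_compose_affine[OF H(1) bounded_linear_mult_right[of "real n"], of k "- (real n * s)"]
        by (simp add: right_diff_distrib)
      have "is_Ck k (\<lambda>t. complex_of_real (\<psi> n t))" for k
        using is_Ck_add[OF Hc[of k a] is_Ck_mult[OF is_Ck_const[of k "-1"] Hc[of k b]]]
        by (simp add: \<psi>_def)
      moreover have "(\<psi> n has_real_derivative \<psi>' n t) (at t)" for t
      proof -
        have "((\<lambda>t. H (real n * (t - s))) has_real_derivative real n * h (real n * (t - s))) (at t)" for s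
        proof -
          have "((\<lambda>t. real n * (t - s)) has_real_derivative real n) (at t)"
            by (auto intro!: derivative_eq_intros)
          from DERIV_chain2[OF H(2) this] show ?thesis by (simp add: mult.commute)
        qed
        then show ?thesis unfolding \<psi>_def \<psi>'_def by (intro DERIV_diff)
      qed
      moreover have "continuous_on UNIV (\<psi>' n)"
        unfolding \<psi>'_def by (intro continuous_on_diff continuous_on_mult continuous_on_const continuous_on_affine_arg H(3))
      moreover have "\<psi> n t = 0" if "t \<notin> {a..b + 1 / real n}" for t
      proof (cases "t < a")
        case True
        then have "real n * (t - a) \<le> 0" "real n * (t - b) \<le> 0" using npos ab by (auto simp: mult_le_0_iff)
        then show ?thesis using H(7) by (simp add: \<psi>_def)
      next
        case False
        then have "t > b + 1 / real n" using that by auto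
        then have "1 \<le> real n * (t - b)" using npos by (simp add: field_simps)
        moreover have "real n * (t - b) \<le> real n * (t - a)" using npos ab by (intro mult_left_mono) auto
        ultimately show ?thesis using H(8) by (simp add: \<psi>_def)
      qed
      moreover have "b + 1 / real n < T" using n1 npos by (simp add: field_simps)
      then have "{a..b + 1 / real n} \<subseteq> {0<..<T}" using ab by auto
      ultimately show ?thesis unfolding cutoff_on_def by (meson compact_Icc)
    qed
    have hX: "integrable ?M (\<lambda>t. of_real (real n * h (real n * (t - s))) * X t)" for n :: nat and s
      by (intro continuous_imp_integrable_real continuous_on_mult continuous_on_of_real continuous_on_const continuous_on_affine_arg X H(3))
    have "(\<lambda>n. LINT t|?M. of_real (\<psi>' n t) * X t) \<longlonglongrightarrow> X a - X b"
    proof -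
      have "(LINT t|?M. of_real (\<psi>' n t) * X t) = (LINT t|?M. of_real (real n * h (real n * (t - a))) * X t)
           - (LINT t|?M. of_real (real n * h (real n * (t - b))) * X t)" for n
        by (subst Bochner_Integration.integral_diff[OF hX hX, symmetric])
           (simp add: \<psi>'_def algebra_simps)
      moreover have "(\<lambda>n. (LINT t|?M. of_real (real n * h (real n * (t - a))) * X t)
           - (LINT t|?M. of_real (real n * h (real n * (t - b))) * X t)) \<longlonglongrightarrow> X a - X b"
        by (intro tendsto_diff; rule bump_concentrates[OF X _ _ H(2-8)]) (use ab in auto)
      ultimately show ?thesis by simp
    qed
    moreover have "(\<lambda>n. LINT t|?M. of_real (\<psi> n t) * Y t) \<longlonglongrightarrow> (LINT t|?M. (indicator {..b} t - indicator {..a} t) * Y t)"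
    proof (rule integral_dominated_convergence[where w = "\<lambda>s. cmod (Y s)"])
      have Hm: "continuous_on S H" for S
        by (rule DERIV_continuous_on, rule has_field_derivative_at_within, rule H(2))
      have "continuous_on {0..T} (\<lambda>t. complex_of_real (\<psi> n t))" for n
        unfolding \<psi>_def by (intro continuous_on_of_real continuous_on_diff continuous_on_affine_arg Hm)
      from continuous_on_measurable_Icc[OF this]
      show "(\<lambda>t. of_real (\<psi> n t) * Y t) \<in> borel_measurable ?M" for n by measurable
      show "AE t in ?M. (\<lambda>n. of_real (\<psi> n t) * Y t) \<longlonglongrightarrow> (indicator {..b} t - indicator {..a} t) * Y t"
      proof (rule AE_I2)
        fix t
        have lim: "(\<lambda>n. H (real n * (t - s))) \<longlonglongrightarrow> 1 - indicator {..s} t" for s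
        proof (cases "t \<le> s")
          case True
          then have "H (real n * (t - s)) = 0" for n by (intro H(7)) (auto simp: mult_le_0_iff)
          then show ?thesis using True by simp
        next
          case False
          then obtain n1 :: nat where n1: "1 < real n1 * (t - s)" using reals_Archimedean3[of "t - s"] by auto
          have "H (real n * (t - s)) = 1" if "n \<ge> n1" for n
          proof (rule H(8))
            have "real n1 * (t - s) \<le> real n * (t - s)" using that False by (intro mult_right_mono) auto
            then show "1 \<le> real n * (t - s)" using n1 by linarith
          qed
          then have "\<forall>\<^sub>F n in sequentially. H (real n * (t - s)) = 1 - indicator {..s} t"
            unfolding eventually_sequentially using False by auto
          then show ?thesis by (rule tendsto_eventually)
        qed
        have "(\<lambda>n. \<psi> n t) \<longlonglongrightarrow> (1 - indicator {..a} t) - (1 - indicator {..b} t)"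
          unfolding \<psi>_def by (intro tendsto_diff lim)
        then have "(\<lambda>n. of_real (\<psi> n t) * Y t) \<longlonglongrightarrow> of_real ((1 - indicator {..a} t) - (1 - indicator {..b} t)) * Y t"
          by (intro tendsto_mult tendsto_of_real tendsto_const)
        also have "complex_of_real ((1 - indicator {..a} t) - (1 - indicator {..b} t)) = indicator {..b} t - indicator {..a} t"
          by (simp add: indicator_def)
        finally show "(\<lambda>n. of_real (\<psi> n t) * Y t) \<longlonglongrightarrow> (indicator {..b} t - indicator {..a} t) * Y t" .
      qed
      show "AE t in ?M. norm (of_real (\<psi> n t) * Y t) \<le> cmod (Y t)" for n
      proof (rule AE_I2)
        fix t
        have "\<bar>x - y\<bar> \<le> 1" if "0 \<le> x \<and> x \<le> 1" "0 \<le> y \<and> y \<le> 1" for x y :: real using that by linarith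
        then have "\<bar>\<psi> n t\<bar> \<le> 1" unfolding \<psi>_def using H(9) by blast
        then have "\<bar>\<psi> n t\<bar> * cmod (Y t) \<le> 1 * cmod (Y t)" by (intro mult_right_mono) auto
        then show "norm (of_real (\<psi> n t) * Y t) \<le> cmod (Y t)" by (simp add: norm_mult)
      qed
    qed (use Y in auto)
    then have "(\<lambda>n. - c * (LINT t|?M. of_real (\<psi> n t) * Y t)) \<longlonglongrightarrow> - c * (LINT t|?M. (indicator {..b} t - indicator {..a} t) * Y t)"
      by (intro tendsto_mult tendsto_const)
    moreover have "\<forall>\<^sub>F n in sequentially. - c * (LINT t|?M. of_real (\<psi> n t) * Y t) = (LINT t|?M. of_real (\<psi>' n t) * X t)"
      unfolding eventually_sequentially using eq[OF cut] by (intro exI[of _ n0]) simp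
    then have "(\<lambda>n. LINT t|?M. of_real (\<psi>' n t) * X t) \<longlonglongrightarrow> - c * (LINT t|?M. (indicator {..b} t - indicator {..a} t) * Y t)"
      using calculation(2) by (rule Lim_transform_eventually[rotated])
    ultimately have "X a - X b = - c * (LINT t|?M. (indicator {..b} t - indicator {..a} t) * Y t)"
      using LIMSEQ_unique by blast
    also have "(LINT t|?M. (indicator {..b} t - indicator {..a} t) * Y t) =
        (LINT t|?M. indicator {..b} t * Y t) - (LINT t|?M. indicator {..a} t * Y t)"
      unfolding left_diff_distrib by (rule Bochner_Integration.integral_diff[OF indI indI])
    finally show ?thesis by (simp add: Z_def algebra_simps)
  qed
  \<comment> \<open>Test functions see only the open interval. Continuity of \<open>Z\<close>
    carries its constancy to the end points, in particular to the initial time.\<close>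
  have cl: "closure {0<..<T} = {0..T}" using T by simp
  have const: "Z s = Z (T / 2)" if "s \<in> {0..T}" for s
  proof (rule continuous_constant_on_closure[of "{0<..<T}" Z "Z (T / 2)"])
    show "continuous_on (closure {0<..<T}) Z" unfolding cl by (rule Zc)
    show "Z x = Z (T / 2)" if "x \<in> {0<..<T}" for x
      using key[of x "T / 2"] key[of "T / 2" x] that by (cases "x \<le> T / 2") auto
    show "s \<in> closure {0<..<T}" unfolding cl by fact
  qed
  have "Z t = Z 0" using const[OF t] const[of 0] T by (metis atLeastAtMost_iff less_imp_le order_refl)
  moreover have "(LINT s|?M. indicator {..0} s * Y s) = (LINT s|?M. 0)"
  proof (rule integral_cong_AE)
    show "AE s in ?M. indicator {..0} s * Y s = 0"
      using AE_lebesgue_on_neq[of 0 T] AE_space[of ?M] by eventually_elim (auto simp: indicator_def)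
  qed auto
  ultimately show ?thesis by (simp add: Z_def algebra_simps)
qed

section \<open>Plane waves with a time cutoff as test functions\<close>

lemma wave_periodic: "wave k (x + (2 * pi) *\<^sub>R axis j 1) = wave k x"
proof -
  have "(\<Sum>i\<in>UNIV. of_int (k $ i) * (x + (2 * pi) *\<^sub>R axis j 1) $ i) =
     (\<Sum>i\<in>UNIV. of_int (k $ i) * x $ i) + (\<Sum>i\<in>UNIV. if i = j then 2 * pi * of_int (k $ j) else 0)"
    unfolding sum.distrib[symmetric] by (intro sum.cong) (auto simp: axis_def algebra_simps)
  also have "\<dots> = (\<Sum>i\<in>UNIV. of_int (k $ i) * x $ i) + 2 * pi * of_int (k $ j)" by simp
  finally show ?thesis
    using cis_multiple_2pi[of "of_int (k $ j)"] by (simp add: wave_def cis_mult[symmetric])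
qed

context
  fixes T :: real and \<psi> \<psi>' :: "real \<Rightarrow> real" and k :: "int ^ 'd::finite"
  assumes cut: "cutoff_on T \<psi> \<psi>'"
begin

text \<open>\<open>cis (phase (t, x))\<close> is the conjugate of the plane wave e^(i (k.x - |k|^2
  t)), which solves the free equation. Testing with it times a cutoff makes the Laplacian cancel the
  derivative of the time phase, and only the derivative of the cutoff survives.\<close>

private definition phase :: "real \<times> (real ^ 'd) \<Rightarrow> real" where
  "phase p = of_int (freq_sq k) * fst p - (\<Sum>j\<in>UNIV. of_int (k $ j) * snd p $ j)"

private definition \<phi> :: "real \<times> (real ^ 'd) \<Rightarrow> complex" where
  "\<phi> p = of_real (\<psi> (fst p)) * cis (phase p)"

private lemma phase_linear: "bounded_linear phase"
  unfolding linear_conv_bounded_linear[symmetric]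
  by (rule linearI) (simp_all add: phase_def algebra_simps sum.distrib sum_distrib_left)

private lemma cis_phase: "cis (phase (t, x)) = cis (of_int (freq_sq k) * t) * cnj (wave k x)"
  by (simp add: phase_def wave_def cis_cnj cis_mult)

private lemma dphi:
  "dir_deriv v \<phi> p = (of_real (\<psi>' (fst p) * fst v) + \<i> * of_real (\<psi> (fst p) * phase v)) * cis (phase p)"
proof -
  have D: "(\<psi> has_real_derivative \<psi>' t) (at t)" for t using cut by (simp add: cutoff_on_def)
  have 1: "((\<lambda>p. complex_of_real (\<psi> (fst p))) has_derivative (\<lambda>v. of_real (\<psi>' (fst p) * fst v))) (at p)" for p :: "real \<times> (real ^ 'd)"
  proof (rule has_derivative_of_real)
    show "((\<lambda>p. \<psi> (fst p)) has_derivative (\<lambda>v. \<psi>' (fst p) * fst v)) (at p)"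
      by (rule has_derivative_compose[OF bounded_linear_imp_has_derivative[OF bounded_linear_fst]])
         (use D[of "fst p"] in \<open>simp add: has_field_derivative_def\<close>)
  qed
  have 2: "((\<lambda>p. cis (phase p)) has_derivative (\<lambda>v. phase v *\<^sub>R (\<i> * cis (phase p)))) (at p)" for p
    by (rule has_derivative_cis[OF bounded_linear_imp_has_derivative[OF phase_linear]])
  show ?thesis
    unfolding \<phi>_def[abs_def]
    by (subst dir_deriv_eq[OF has_derivative_mult[OF 1 2]]) (simp add: scaleR_conv_of_real algebra_simps)
qed

private lemma is_Ck_phi: "is_Ck n \<phi>"
proof -
  have "is_Ck n (\<lambda>t. complex_of_real (\<psi> t))" using cut by (simp add: cutoff_on_def)
  from is_Ck_compose_affine[OF this bounded_linear_fst, of 0]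
  have 1: "is_Ck n (\<lambda>p :: real \<times> (real ^ 'd). complex_of_real (\<psi> (fst p)))" by simp
  from is_Ck_compose_affine[OF is_Ck_cis[of n 1] phase_linear, of 0]
  have 2: "is_Ck n (\<lambda>p. cis (phase p))" by simp
  show ?thesis unfolding \<phi>_def[abs_def] by (rule is_Ck_mult[OF 1 2])
qed

private lemma phi_test: "\<phi> \<in> test_functions {0..T}"
  unfolding test_functions_def
proof (intro CollectI conjI allI)
  show "is_Ck n \<phi>" for n by (rule is_Ck_phi)
  show "torus_periodic (\<lambda>x. \<phi> (t, x))" for t
    by (simp add: torus_periodic_def \<phi>_def cis_phase wave_periodic)
  show "\<exists>K. compact K \<and> K \<subseteq> interior {0..T} \<and> (\<forall>t x. t \<notin> K \<longrightarrow> \<phi> (t, x) = 0)"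
    using cut by (auto simp: cutoff_on_def \<phi>_def)
qed

private lemma distr_phi:
  assumes "\<And>t x. \<eta> (t, x) = A t * cnj (wave k x)"
  shows "distr_of {0..T} u \<eta> = of_real ((2 * pi) ^ CARD('d)) * (LINT t|lebesgue_on {0..T}. A t * fourier_coeff (u t) k)"
proof -
  define V where "V = complex_of_real ((2 * pi) ^ CARD('d))"
  have "(LINT x|torus. u t x * \<eta> (t, x)) = V * (A t * fourier_coeff (u t) k)" for t
  proof -
    have "(LINT x|torus. u t x * \<eta> (t, x)) = (LINT x|torus. A t * (u t x * cnj (wave k x)))"
      by (simp add: assms mult.left_commute)
    also have "\<dots> = A t * (LINT x|torus. u t x * cnj (wave k x))" by (rule integral_mult_right_zero)
    finally show ?thesis by (simp add: fourier_coeff_wave_def V_def)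
  qed
  then have "distr_of {0..T} u \<eta> = (LINT t|lebesgue_on {0..T}. V * (A t * fourier_coeff (u t) k))"
    unfolding distr_of_def by simp
  also have "\<dots> = V * (LINT t|lebesgue_on {0..T}. A t * fourier_coeff (u t) k)" by (rule integral_mult_right_zero)
  finally show ?thesis by (simp add: V_def)
qed

private lemma phase_axis: "phase (0, axis j 1) = - of_int (k $ j)"
proof -
  have "(\<Sum>i\<in>UNIV. of_int (k $ i) * (axis j 1 :: real ^ 'd) $ i) = (\<Sum>i\<in>UNIV. if i = j then of_int (k $ j) else 0)"
    by (intro sum.cong) (auto simp: axis_def)
  then show ?thesis by (simp add: phase_def)
qed

private lemma phase_time: "phase (1, 0) = of_int (freq_sq k)"
  by (simp add: phase_def)

text \<open>The k-th mode in the interaction picture: multiplied by e^(i |k|^2 t), the coefficient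
  no longer feels the linear part, and the equation becomes X' = i lam Y in the weak form required
  by \<open>weak_ODE\<close>.\<close>

lemma logNLS_cutoff:
  assumes eq: "logNLS_distr lam {0..T} u"
    and a: "integrable (lebesgue_on {0..T}) (\<lambda>t. fourier_coeff (u t) k)"
  shows "(LINT t|lebesgue_on {0..T}. of_real (\<psi>' t) * (cis (of_int (freq_sq k) * t) * fourier_coeff (u t) k)) =
     - (\<i> * of_real lam) * (LINT t|lebesgue_on {0..T}. of_real (\<psi> t) *
        (cis (of_int (freq_sq k) * t) * fourier_coeff (\<lambda>x. log_nonlin (u t x)) k))"
proof -
  let ?M = "lebesgue_on {0..T}"
  define V where "V = complex_of_real ((2 * pi) ^ CARD('d))"
  have V0: "V \<noteq> 0" by (simp add: V_def)
  define e where "e t = cis (of_int (freq_sq k) * t)" for t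
  define f where "f = of_int (freq_sq k) * \<i>"
  define a where "a t = fourier_coeff (u t) k" for t
  define b where "b t = fourier_coeff (\<lambda>x. log_nonlin (u t x)) k" for t
  have D: "(\<psi> has_real_derivative \<psi>' t) (at t)" and c': "continuous_on UNIV \<psi>'" for t
    using cut unfolding cutoff_on_def by blast+
  have psic: "continuous_on S \<psi>" "continuous_on S \<psi>'" for S
    by (rule DERIV_continuous_on, rule has_field_derivative_at_within, rule D)
       (rule continuous_on_subset[OF c' subset_UNIV])
  have ec: "continuous_on S e" for S unfolding e_def by (intro continuous_intros)
  have I1: "integrable ?M (\<lambda>t. (of_real (\<psi>' t) * e t) * a t)"
    unfolding a_def by (intro integrable_continuous_mult assms(2) continuous_on_mult continuous_on_of_real psic ec)
  have I2: "integrable ?M (\<lambda>t. (of_real (\<psi> t) * e t) * a t)"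
    unfolding a_def by (intro integrable_continuous_mult assms(2) continuous_on_mult continuous_on_of_real psic ec)
  define A where "A = (LINT t|?M. (of_real (\<psi>' t) * e t) * a t)"
  define B where "B = (LINT t|?M. (of_real (\<psi> t) * e t) * a t)"
  define C where "C = (LINT t|?M. (of_real (\<psi> t) * e t) * b t)"
  have pa: "\<phi> (t, x) = (of_real (\<psi> t) * e t) * cnj (wave k x)" for t x
    by (simp add: \<phi>_def cis_phase e_def)
  have dt: "dir_deriv (1, 0) \<phi> (t, x) = ((of_real (\<psi>' t) + f * of_real (\<psi> t)) * e t) * cnj (wave k x)" for t x
    by (simp add: dphi phase_time cis_phase e_def f_def mult_ac)
  have dx: "dir_deriv (0, axis j 1) \<phi> = (\<lambda>p. (- \<i> * of_int (k $ j)) * \<phi> p)" for j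
    by (rule ext) (simp add: dphi phase_axis \<phi>_def)
  have d\<phi>: "(\<phi> has_derivative frechet_derivative \<phi> (at p)) (at p)" for p
    using is_Ck_phi[of "Suc 0"] unfolding is_Ck.simps frechet_derivative_works by blast
  have dc: "dir_deriv v (\<lambda>p. c * \<phi> p) q = c * dir_deriv v \<phi> q" for v c q
    unfolding dir_deriv_def[of v \<phi>] by (rule dir_deriv_eq[OF has_derivative_mult_right[OF d\<phi>]])
  have sq: "(- \<i> * c) * ((- \<i> * c) * z) = - (c * c) * z" for c z
    by (simp add: mult.assoc mult.left_commute[of c \<i>])
  have dxx: "dir_deriv (0, axis j 1) (dir_deriv (0, axis j 1) \<phi>) (t, x) = (- (of_int ((k $ j)\<^sup>2)) * (of_real (\<psi> t) * e t)) * cnj (wave k x)" for j t x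
  proof -
    have "dir_deriv (0, axis j 1) (dir_deriv (0, axis j 1) \<phi>) (t, x) = (- \<i> * of_int (k $ j)) * ((- \<i> * of_int (k $ j)) * \<phi> (t, x))"
      unfolding dx[of j] dc by (simp only: dx)
    then show ?thesis unfolding sq pa by (simp only: of_int_mult power2_eq_square mult.assoc)
  qed
  have U: "distr_of {0..T} u (dir_deriv (1, 0) \<phi>) = V * (A + f * B)"
  proof -
    have "distr_of {0..T} u (dir_deriv (1, 0) \<phi>) = V * (LINT t|?M. ((of_real (\<psi>' t) + f * of_real (\<psi> t)) * e t) * a t)"
      unfolding V_def a_def by (rule distr_phi) (rule dt)
    also have "(LINT t|?M. ((of_real (\<psi>' t) + f * of_real (\<psi> t)) * e t) * a t)
        = (LINT t|?M. (of_real (\<psi>' t) * e t) * a t + f * ((of_real (\<psi> t) * e t) * a t))"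
      by (simp only: distrib_right mult.assoc)
    also have "\<dots> = A + (LINT t|?M. f * ((of_real (\<psi> t) * e t) * a t))"
      unfolding A_def by (rule Bochner_Integration.integral_add[OF I1 integrable_mult_right[OF I2]])
    also have "(LINT t|?M. f * ((of_real (\<psi> t) * e t) * a t)) = f * B"
      unfolding B_def by (rule integral_mult_right_zero)
    finally show ?thesis .
  qed
  have L: "distr_laplacian (distr_of {0..T} u) \<phi> = - of_int (freq_sq k) * (V * B)"
  proof -
    have "distr_of {0..T} u (dir_deriv (0, axis j 1) (dir_deriv (0, axis j 1) \<phi>)) =
        - of_int ((k $ j)\<^sup>2) * (V * B)" for j
    proof -
      have "distr_of {0..T} u (dir_deriv (0, axis j 1) (dir_deriv (0, axis j 1) \<phi>)) =
        V * (LINT t|?M. (- (of_int ((k $ j)\<^sup>2)) * (of_real (\<psi> t) * e t)) * a t)"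
        unfolding V_def a_def by (rule distr_phi) (rule dxx)
      also have "(LINT t|?M. (- (of_int ((k $ j)\<^sup>2)) * (of_real (\<psi> t) * e t)) * a t) = (LINT t|?M. - of_int ((k $ j)\<^sup>2) * ((of_real (\<psi> t) * e t) * a t))"
        by (simp only: mult.assoc)
      also have "\<dots> = - of_int ((k $ j)\<^sup>2) * B"
        unfolding B_def by (rule integral_mult_right_zero)
      finally show ?thesis by (simp only: mult.left_commute)
    qed
    then show ?thesis
      by (simp add: distr_laplacian_def distr_dx_def freq_sq_def sum_distrib_right sum_negf)
  qed
  have N: "distr_of {0..T} (\<lambda>t x. log_nonlin (u t x)) \<phi> = V * C"
    unfolding V_def C_def b_def by (rule distr_phi) (rule pa)
  have "\<i> * distr_dt (distr_of {0..T} u) \<phi> + distr_laplacian (distr_of {0..T} u) \<phi>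
        + of_real lam * distr_of {0..T} (\<lambda>t x. log_nonlin (u t x)) \<phi> = 0"
    using eq phi_test unfolding logNLS_distr_def by blast
  then have "\<i> * (- (V * (A + f * B))) + (- of_int (freq_sq k) * (V * B)) + of_real lam * (V * C) = 0"
    unfolding distr_dt_def U L N .
  then have "(\<i> * V) * (\<i> * (- (V * (A + f * B))) + (- of_int (freq_sq k) * (V * B)) + of_real lam * (V * C)) = 0"
    by simp
  \<comment> \<open>Since \<open>f\<close> is i |k|^2, the two terms |k|^2 V B cancel, and the
    factor i V turns the remaining - i V A into V V A.\<close>
  also have "(\<i> * V) * (\<i> * (- (V * (A + f * B))) + (- of_int (freq_sq k) * (V * B)) + of_real lam * (V * C))
     = (V * V) * (A + \<i> * of_real lam * C)"
  proof -
    have "\<i> * (\<i> * (- (V * (A + \<kappa> * \<i> * B))) + (- \<kappa> * (V * B)) + l * (V * C)) = V * (A + \<i> * l * C)" for \<kappa> l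
      by (simp add: complex_eq_iff algebra_simps)
    from arg_cong[OF this[of "of_int (freq_sq k)" "of_real lam"], of "(*) V"] show ?thesis
      by (simp only: f_def mult.assoc mult.left_commute[of \<i> V])
  qed
  finally have "A = - (\<i> * of_real lam) * C"
    using V0 by (simp add: add_eq_0_iff)
  then show ?thesis unfolding A_def C_def e_def a_def b_def by (simp only: mult.assoc)
qed

end

section \<open>Representatives satisfying Duhamel's formula\<close>

lemma finite_measure_Icc: "finite_measure (lebesgue_on {0..T::real})"
  using finite_measure_lebesgue_on[of "{0..T}"] lmeasurable_cbox[of 0 T] by simp

lemma pair_sigma_finite_Icc_torus: "pair_sigma_finite (lebesgue_on {0..T::real}) (torus :: (real ^ 'd::finite) measure)"
  by (intro pair_sigma_finite.intro finite_measure.axioms(1) finite_measure_Icc finite_measure_torus)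

lemma complete_measure_Icc: "complete_measure (lebesgue_on {0..T::real})"
proof
  fix A B :: "real set" assume "B \<subseteq> A" "A \<in> null_sets (lebesgue_on {0..T})"
  then have "A \<in> null_sets lebesgue" "A \<subseteq> {0..T}"
    by (auto simp: null_sets_restrict_space)
  then have "B \<in> sets lebesgue" "B \<subseteq> {0..T}" using \<open>B \<subseteq> A\<close> completion.complete by auto
  then show "B \<in> sets (lebesgue_on {0..T})" by (auto simp: sets_restrict_space_iff)
qed

text \<open>By completeness, measurability in time passes from the Fourier coefficients of a good
  representative to those of the solution itself, which agree with them only at almost every
  time.\<close>

lemma borel_measurable_AE_cong:
  assumes M: "complete_measure M" and f: "f \<in> borel_measurable M" and ae: "AE x in M. f x = g x"
  shows "g \<in> borel_measurable M"
proof (rule measurableI)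
  fix A :: "'b set" assume A: "A \<in> sets borel"
  show "g -` A \<inter> space M \<in> sets M"
  proof (rule complete_measure.in_sets_AE[OF M])
    show "AE x in M. (x \<in> f -` A \<inter> space M) = (x \<in> g -` A \<inter> space M)"
      using ae by eventually_elim auto
    show "f -` A \<inter> space M \<in> sets M" using f A by (rule measurable_sets)
  qed auto
qed auto

text \<open>The set where the bound holds is closed, and a closed set of full measure in an open
  interval contains it, hence also its closure. Bounds at almost every time thus become bounds at
  every time.\<close>

lemma AE_le_continuous:
  fixes f :: "real \<Rightarrow> real"
  assumes "T > 0" and f: "continuous_on {0..T} f" and ae: "AE t in lebesgue_on {0..T}. f t \<le> C"
    and t: "t \<in> {0..T}"
  shows "f t \<le> C"
proof -
  define K where "K = {t \<in> {0..T}. f t \<le> C}"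
  have K: "closed K"
    unfolding K_def using continuous_closed_preimage[OF f closed_atLeastAtMost closed_atMost[of C]]
    by (simp add: vimage_def Int_def)
  have "AE t in lebesgue. t \<in> {0..T} \<longrightarrow> f t \<le> C"
    using ae by (subst (asm) AE_restrict_space_iff) auto
  then have *: "AE t\<in>{0<..<T} in lebesgue. t \<in> K"
    by eventually_elim (auto simp: K_def)
  have "{0<..<T} \<subseteq> K"
    using mem_closed_if_AE_lebesgue_open[OF open_greaterThanLessThan K *] by auto
  then have "closure {0<..<T} \<subseteq> K" using K by (rule closure_minimal)
  then show ?thesis using t \<open>T > 0\<close> by (auto simp: K_def)
qed

lemma fourier_coeff_add:
  assumes "sq_integrable torus f" "sq_integrable torus g"
  shows "fourier_coeff (\<lambda>x. f x + g x) k = fourier_coeff f k + fourier_coeff g k"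
proof -
  have I: "integrable torus (\<lambda>x. h x * cnj (wave k x))" if "sq_integrable torus h" for h
    by (rule sq_integrable_mult[OF that sq_integrable_cnj]) (use sq_integrable_wave[of 1 k] in simp)
  show ?thesis
    unfolding fourier_coeff_wave_def distrib_right add_divide_distrib[symmetric]
    by (simp add: Bochner_Integration.integral_add[OF I[OF assms(1)] I[OF assms(2)]])
qed

lemma fourier_coeff_cmult: "fourier_coeff (\<lambda>x. c * f x) k = c * fourier_coeff f k"
  unfolding fourier_coeff_def by (simp add: mult.assoc)

lemma fourier_coeff_cong_AE:
  assumes "f \<in> borel_measurable torus" "g \<in> borel_measurable torus" "AE x in torus. f x = g x"
  shows "fourier_coeff f k = fourier_coeff g k"
proof -
  have "(LINT x|torus. f x * cnj (wave k x)) = (LINT x|torus. g x * cnj (wave k x))"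
    by (rule integral_cong_AE) (use assms in auto)
  then show ?thesis by (simp add: fourier_coeff_wave_def)
qed

lemma Hs_weight_ge_1: "s \<ge> 0 \<Longrightarrow> 1 \<le> Hs_weight s k"
  unfolding Hs_weight_def by (intro ge_one_powr_ge_zero) (auto intro: sum_nonneg)

lemma torus_Hs_sq_integrable: "f \<in> torus_Hs s \<Longrightarrow> sq_integrable torus f"
  by (auto simp: torus_Hs_def torus_L2_def sq_integrable_def)

lemma Hs_sum_le:
  assumes f: "f \<in> torus_Hs s" and K: "finite K"
  shows "(\<Sum>k\<in>K. Hs_weight s k * (cmod (fourier_coeff f k))\<^sup>2) \<le> (Hs_norm s f)\<^sup>2"
proof -
  let ?h = "\<lambda>k. Hs_weight s k * (cmod (fourier_coeff f k))\<^sup>2"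
  have nn: "0 \<le> ?h k" for k by (simp add: Hs_weight_def)
  have "sum ?h K \<le> infsum ?h UNIV"
    by (rule finite_sum_le_infsum) (use f K nn in \<open>auto simp: torus_Hs_def\<close>)
  moreover have "0 \<le> infsum ?h UNIV" by (rule infsum_nonneg) (rule nn)
  ultimately show ?thesis by (simp add: Hs_norm_def)
qed

text \<open>Weak continuity enters the proof through these functionals: each Fourier coefficient is
  continuous in time. The bound keeps the single term \<open>k\<close> of the norm, whose weight is
  at least 1.\<close>

lemma fourier_coeff_Hs_dual:
  fixes k :: "int ^ 'd::finite"
  assumes "s \<ge> 0"
  shows "(\<lambda>f. fourier_coeff f k) \<in> Hs_dual s"
  unfolding Hs_dual_def
proof (intro CollectI conjI ballI allI)
  show "\<exists>C. \<forall>f\<in>torus_Hs s. cmod (fourier_coeff f k) \<le> C * Hs_norm s f"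
  proof (intro exI[of _ 1] ballI)
    fix f :: "real ^ 'd \<Rightarrow> complex" assume f: "f \<in> torus_Hs s"
    have "1 * (cmod (fourier_coeff f k))\<^sup>2 \<le> Hs_weight s k * (cmod (fourier_coeff f k))\<^sup>2"
      by (intro mult_right_mono Hs_weight_ge_1 assms) auto
    also have "\<dots> \<le> (Hs_norm s f)\<^sup>2" using Hs_sum_le[OF f, of "{k}"] by simp
    finally have "(cmod (fourier_coeff f k))\<^sup>2 \<le> (Hs_norm s f)\<^sup>2" by simp
    then show "cmod (fourier_coeff f k) \<le> 1 * Hs_norm s f"
      by (rule power2_le_imp_le[THEN order_trans]) (auto simp: Hs_norm_def intro!: infsum_nonneg simp: Hs_weight_def)
  qed
qed (auto simp: fourier_coeff_add torus_Hs_sq_integrable fourier_coeff_cmult)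

text \<open>Crude, but a quadratic bound puts the nonlinearity of an L^2 function in L^1, so that
  its Fourier coefficients make sense and are bounded in time. Near 0 it rests on - r ln r <=
  1.\<close>

lemma cmod_log_nonlin_le: "cmod (log_nonlin z) \<le> 2 + 2 * (cmod z)\<^sup>2"
proof (cases "z = 0")
  case False
  define r where "r = cmod z"
  have r: "r > 0" using False by (simp add: r_def)
  have l: "ln (r\<^sup>2) = 2 * ln r" using r by (simp add: ln_realpow)
  have "r * \<bar>2 * ln r\<bar> \<le> 2 + 2 * r\<^sup>2"
  proof (cases "r \<ge> 1")
    case True
    have "r * \<bar>2 * ln r\<bar> = 2 * (r * ln r)" using True by (simp add: abs_mult)
    also have "\<dots> \<le> 2 * (r * (r - 1))" using True ln_le_minus_one[of r] by (intro mult_left_mono) auto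
    also have "\<dots> \<le> 2 + 2 * r\<^sup>2" using True by (simp add: power2_eq_square algebra_simps)
    finally show ?thesis .
  next
    case False
    then have "ln r \<le> 0" using r by simp
    have "- ln r \<le> 1 / r - 1" using ln_le_minus_one[of "1 / r"] r by (simp add: ln_div)
    then have "r * (- ln r) \<le> r * (1 / r - 1)" using r by (intro mult_left_mono) auto
    also have "\<dots> = 1 - r" using r by (simp add: field_simps)
    finally have "r * (- ln r) \<le> 1" using r by linarith
    then have "r * \<bar>2 * ln r\<bar> \<le> 2" using \<open>ln r \<le> 0\<close> by (simp add: abs_mult)
    then show ?thesis using zero_le_power2[of r] by linarith
  qed
  then show ?thesis using l by (simp add: log_nonlin_def norm_mult r_def[symmetric])
qed (simp add: log_nonlin_def)

lemma log_nonlin_measurable [measurable]: "log_nonlin \<in> borel_measurable borel"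
  unfolding log_nonlin_def[abs_def] by measurable

lemma measurable_pair_const_snd:
  assumes "(\<lambda>(t, x). u t x) \<in> borel_measurable (M \<Otimes>\<^sub>M N)" "t \<in> space M"
  shows "u t \<in> borel_measurable N"
  using measurable_compose[OF measurable_Pair1'[OF assms(2)] assms(1)] by simp

lemma sq_integrable_bound_log_nonlin:
  fixes f :: "real ^ 'd::finite \<Rightarrow> complex"
  assumes "sq_integrable torus f"
  shows "integrable torus (\<lambda>x. log_nonlin (f x))"
    and "(LINT x|torus. cmod (log_nonlin (f x))) \<le> 2 * measure (torus :: (real ^ 'd::finite) measure) (space torus) + 2 * (LINT x|torus. (cmod (f x))\<^sup>2)"
proof -
  interpret finite_measure "torus :: (real ^ 'd) measure" by (rule finite_measure_torus)
  have [measurable]: "f \<in> borel_measurable torus" using assms by (simp add: sq_integrable_def)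
  have I2: "integrable torus (\<lambda>x. 2 * (cmod (f x))\<^sup>2)" using assms by (simp add: sq_integrable_def)
  have I: "integrable torus (\<lambda>x. 2 + 2 * (cmod (f x))\<^sup>2)"
    by (intro Bochner_Integration.integrable_add finite_measure.integrable_const[OF finite_measure_torus] I2)
  show J: "integrable torus (\<lambda>x. log_nonlin (f x))"
    by (rule Bochner_Integration.integrable_bound[OF I])
       (use cmod_log_nonlin_le in \<open>auto intro!: AE_I2\<close>)
  have "(LINT x|torus. cmod (log_nonlin (f x))) \<le> (LINT x|torus. 2 + 2 * (cmod (f x))\<^sup>2)"
    by (intro integral_mono integrable_norm J I cmod_log_nonlin_le)
  also have "\<dots> = 2 * measure (torus :: (real ^ 'd) measure) (space torus) + 2 * (LINT x|torus. (cmod (f x))\<^sup>2)"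
    by (subst Bochner_Integration.integral_add[OF finite_measure.integrable_const[OF finite_measure_torus] I2]) simp
  finally show "(LINT x|torus. cmod (log_nonlin (f x))) \<le> \<dots>" .
qed

lemma cmod_fourier_coeff_le:
  fixes f :: "real ^ 'd::finite \<Rightarrow> complex"
  assumes "integrable torus f"
  shows "cmod (fourier_coeff f k) \<le> (LINT x|torus. cmod (f x)) / (2 * pi) ^ CARD('d)"
proof -
  have "cmod (LINT x|torus. f x * cnj (wave k x)) \<le> (LINT x|torus. cmod (f x * cnj (wave k x)))"
    by (rule integral_norm_bound)
  also have "\<dots> = (LINT x|torus. cmod (f x))" by (simp add: norm_mult)
  finally have "cmod (LINT x|torus. f x * cnj (wave k x)) / (2 * pi) ^ CARD('d) \<le> (LINT x|torus. cmod (f x)) / (2 * pi) ^ CARD('d)"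
    by (rule divide_right_mono) simp
  then show ?thesis by (simp add: fourier_coeff_wave_def norm_divide norm_mult norm_power)
qed

section \<open>Joint measurability in time and space\<close>

lemma fourier_coeff_measurable_time:
  fixes u :: "real \<Rightarrow> real ^ 'd::finite \<Rightarrow> complex"
  assumes "(\<lambda>(t, x). u t x) \<in> borel_measurable (lebesgue_on {0..T} \<Otimes>\<^sub>M torus)"
  shows "(\<lambda>t. fourier_coeff (u t) k) \<in> borel_measurable (lebesgue_on {0..T})"
proof -
  interpret finite_measure "torus :: (real ^ 'd) measure" by (rule finite_measure_torus)
  note [measurable] = assms
  show ?thesis unfolding fourier_coeff_wave_def by measurable
qed

text \<open>Partial Fourier sums are jointly measurable. Cutting them off at a frequency that depends measurably
  on the time makes them converge almost everywhere in space for every time.\<close>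

lemma joint_representative:
  fixes w :: "real \<Rightarrow> real ^ 'd::finite \<Rightarrow> complex"
  assumes sq: "\<And>t. t \<in> {0..T} \<Longrightarrow> sq_integrable torus (w t)"
    and m: "\<And>k. (\<lambda>t. fourier_coeff (w t) k) \<in> borel_measurable (lebesgue_on {0..T})"
  obtains u :: "real \<Rightarrow> real ^ 'd::finite \<Rightarrow> complex" where
    "(\<lambda>(t, x). u t x) \<in> borel_measurable (lebesgue_on {0..T} \<Otimes>\<^sub>M torus)"
    "\<And>t. t \<in> {0..T} \<Longrightarrow> AE x in torus. u t x = w t x"
proof -
  let ?M = "lebesgue_on {0..T}"
  define V where "V = (2 * pi) ^ CARD('d)"
  have V: "V > 0" by (simp add: V_def)
  define c where "c k t = fourier_coeff (w t) k" for k t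
  have [measurable]: "c k \<in> borel_measurable ?M" for k using m by (simp add: c_def[abs_def])
  define \<Sigma> where "\<Sigma> N t = (\<Sum>k\<in>modes N. (cmod (c k t))\<^sup>2)" for N :: nat and t
  \<comment> \<open>By Parseval this says that the N-th Fourier sum is within 4^(-j) of
    \<open>w t\<close> in squared L^2 distance. It mentions only countably many measurable functions
    of t, so the least such N is measurable in t.\<close>
  define P where "P j t N \<longleftrightarrow> (\<forall>M\<ge>N. V * (\<Sigma> M t - \<Sigma> N t) \<le> (1/4) ^ j)" for j :: nat and t and N :: nat
  define \<nu> where "\<nu> j t = (LEAST N. P j t N)" for j t
  have [measurable]: "\<Sigma> N \<in> borel_measurable ?M" for N unfolding \<Sigma>_def by measurable
  have nu [measurable]: "\<nu> j \<in> measurable ?M (count_space UNIV)" for j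
    unfolding \<nu>_def P_def by measurable
  define R where "R j t x = fourier_sum (\<nu> j t) (w t) x" for j t x
  have Rm [measurable]: "(\<lambda>(t, x). R j t x) \<in> borel_measurable (?M \<Otimes>\<^sub>M torus)" for j
  proof -
    have "(\<lambda>p. (\<lambda>n p. fourier_sum n (w (fst p)) (snd p)) (\<nu> j (fst p)) p) \<in> borel_measurable (?M \<Otimes>\<^sub>M torus)"
    proof (rule measurable_compose_countable)
      show "(\<lambda>p. fourier_sum n (w (fst p)) (snd p)) \<in> borel_measurable (?M \<Otimes>\<^sub>M torus)" for n
        unfolding fourier_sum_def c_def[symmetric] by measurable
    qed measurable
    then show ?thesis by (simp add: R_def case_prod_beta')
  qed
  \<comment> \<open>Where the sequence diverges, \<open>lim\<close> takes an unspecified value;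
    \<open>u\<close> is measurable all the same, and for each t in [0, T] divergence is confined to
    a null set of x.\<close>
  define u where "u t x = lim (\<lambda>j. R j t x)" for t x
  have um: "(\<lambda>(t, x). u t x) \<in> borel_measurable (?M \<Otimes>\<^sub>M torus)"
    unfolding u_def case_prod_beta' by (rule borel_measurable_lim_metric) (use Rm in \<open>simp add: case_prod_beta'\<close>)
  have "AE x in torus. u t x = w t x" if t: "t \<in> {0..T}" for t
  proof -
    have w: "sq_integrable torus (w t)" by (rule sq[OF t])
    have d: "(LINT x|torus. (cmod (w t x - fourier_sum N (w t) x))\<^sup>2) = (LINT x|torus. (cmod (w t x))\<^sup>2) - V * \<Sigma> N t" for N
      unfolding fourier_sum_L2_dist[OF w] V_def \<Sigma>_def c_def by simp
    have Pex: "\<exists>N. P j t N" for j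
    proof -
      have "\<forall>\<^sub>F N in sequentially. (LINT x|torus. (cmod (w t x - fourier_sum N (w t) x))\<^sup>2) < (1/4) ^ j"
        by (rule order_tendstoD(2)[OF fourier_sum_tendsto[OF w]]) simp
      then obtain N where N: "(LINT x|torus. (cmod (w t x - fourier_sum N (w t) x))\<^sup>2) < (1/4) ^ j"
        by (auto simp: eventually_sequentially)
      have "V * (\<Sigma> M t - \<Sigma> N t) \<le> (1/4) ^ j" for M
      proof -
        have "0 \<le> (LINT x|torus. (cmod (w t x - fourier_sum M (w t) x))\<^sup>2)" by simp
        then show ?thesis using N unfolding d right_diff_distrib by linarith
      qed
      then show ?thesis unfolding P_def by blast
    qed
    have Rd: "(LINT x|torus. (cmod (w t x - R j t x))\<^sup>2) \<le> (1/4) ^ j" for j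
    proof -
      have P: "P j t (\<nu> j t)" unfolding \<nu>_def by (rule LeastI_ex[OF Pex])
      have "(\<lambda>M. V * (\<Sigma> M t - \<Sigma> (\<nu> j t) t)) \<longlonglongrightarrow> (LINT x|torus. (cmod (w t x))\<^sup>2) - V * \<Sigma> (\<nu> j t) t"
        using tendsto_diff[OF Parseval[OF w] tendsto_const[of "V * \<Sigma> (\<nu> j t) t"]]
        by (simp add: V_def \<Sigma>_def c_def right_diff_distrib)
      then have "(LINT x|torus. (cmod (w t x))\<^sup>2) - V * \<Sigma> (\<nu> j t) t \<le> (1/4) ^ j"
        by (rule LIMSEQ_le_const2) (use P in \<open>auto simp: P_def\<close>)
      then show ?thesis by (simp add: R_def d)
    qed
    have sqd: "sq_integrable torus (\<lambda>x. w t x - R j t x)" for j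
      unfolding R_def by (rule sq_integrable_diff[OF w sq_integrable_fourier_sum])
    have meas [measurable]: "(\<lambda>x. w t x - R j t x) \<in> borel_measurable torus" for j
      using sqd by (simp add: sq_integrable_def)
    \<comment> \<open>The squared distances are summable, so the series of |w - R j|^2 is finite
      almost everywhere and its terms tend to 0. This upgrades L^2 convergence to pointwise
      convergence.\<close>
    have "(\<integral>\<^sup>+x. (\<Sum>j. ennreal ((cmod (w t x - R j t x))\<^sup>2)) \<partial>torus) = (\<Sum>j. \<integral>\<^sup>+x. ennreal ((cmod (w t x - R j t x))\<^sup>2) \<partial>torus)"
      by (rule nn_integral_suminf) measurable
    also have "\<dots> \<le> (\<Sum>j. ennreal ((1/4) ^ j))"
    proof (intro suminf_le summableI allI)
      fix j
      have "(\<integral>\<^sup>+x. ennreal ((cmod (w t x - R j t x))\<^sup>2) \<partial>torus) = ennreal (LINT x|torus. (cmod (w t x - R j t x))\<^sup>2)"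
        by (rule nn_integral_eq_integral) (use sqd in \<open>auto simp: sq_integrable_def\<close>)
      also have "\<dots> \<le> ennreal ((1/4) ^ j)" using Rd by (rule ennreal_leI)
      finally show "(\<integral>\<^sup>+x. ennreal ((cmod (w t x - R j t x))\<^sup>2) \<partial>torus) \<le> ennreal ((1/4) ^ j)" .
    qed
    also have "\<dots> < \<infinity>"
      by (subst suminf_ennreal2) (auto intro!: summable_geometric)
    finally have fin: "(\<integral>\<^sup>+x. (\<Sum>j. ennreal ((cmod (w t x - R j t x))\<^sup>2)) \<partial>torus) \<noteq> \<infinity>" by simp
    have "AE x in torus. (\<Sum>j. ennreal ((cmod (w t x - R j t x))\<^sup>2)) \<noteq> \<infinity>"
      by (rule nn_integral_PInf_AE[OF _ fin]) measurable
    then show ?thesis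
    proof eventually_elim
      case (elim x)
      then have "summable (\<lambda>j. (cmod (w t x - R j t x))\<^sup>2)"
        by (intro summable_suminf_not_top) auto
      then have "(\<lambda>j. (cmod (w t x - R j t x))\<^sup>2) \<longlonglongrightarrow> 0" by (rule summable_LIMSEQ_zero)
      then have "(\<lambda>j. sqrt ((cmod (w t x - R j t x))\<^sup>2)) \<longlonglongrightarrow> sqrt 0" by (rule tendsto_real_sqrt)
      then have "(\<lambda>j. w t x - R j t x) \<longlonglongrightarrow> 0" by (simp add: tendsto_norm_zero_iff)
      from tendsto_diff[OF tendsto_const[of "w t x"] this] have "(\<lambda>j. R j t x) \<longlonglongrightarrow> w t x" by simp
      then show ?case unfolding u_def by (rule limI)
    qed
  qed
  with um show thesis by (rule that)
qed

text \<open>Duhamel's formula for the Fourier coefficients, multiplied by the phases that undo the free evolution.\<close>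

definition duhamel :: "real \<Rightarrow> real \<Rightarrow> (real \<Rightarrow> real ^ 'd::finite \<Rightarrow> complex) \<Rightarrow> bool" where
  "duhamel lam T u \<longleftrightarrow>
     (\<lambda>(t, x). u t x) \<in> borel_measurable (lebesgue_on {0..T} \<Otimes>\<^sub>M torus) \<and>
     (\<forall>t\<in>{0..T}. sq_integrable torus (u t)) \<and>
     (\<exists>C. \<forall>t\<in>{0..T}. (LINT x|torus. (cmod (u t x))\<^sup>2) \<le> C) \<and>
     (\<forall>k. \<forall>t\<in>{0..T}. cis (of_int (freq_sq k) * t) * fourier_coeff (u t) k = fourier_coeff (u 0) k +
        \<i> * of_real lam * (LINT s|lebesgue_on {0..T}. indicator {..t} s *
           (cis (of_int (freq_sq k) * s) * fourier_coeff (\<lambda>x. log_nonlin (u s x)) k)))"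

lemma duhamelD:
  assumes "duhamel lam T u"
  shows "(\<lambda>(t, x). u t x) \<in> borel_measurable (lebesgue_on {0..T} \<Otimes>\<^sub>M torus)"
    and "\<And>t. t \<in> {0..T} \<Longrightarrow> sq_integrable torus (u t)"
    and "\<And>k t. t \<in> {0..T} \<Longrightarrow> cis (of_int (freq_sq k) * t) * fourier_coeff (u t) k = fourier_coeff (u 0) k +
        \<i> * of_real lam * (LINT s|lebesgue_on {0..T}. indicator {..t} s *
           (cis (of_int (freq_sq k) * s) * fourier_coeff (\<lambda>x. log_nonlin (u s x)) k))"
  using assms unfolding duhamel_def by blast+

lemma duhamel_bounded:
  assumes "duhamel lam T u"
  obtains C where "C > 0" "\<And>t. t \<in> {0..T} \<Longrightarrow> (LINT x|torus. (cmod (u t x))\<^sup>2) \<le> C"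
proof -
  obtain C where C: "\<forall>t\<in>{0..T}. (LINT x|torus. (cmod (u t x))\<^sup>2) \<le> C"
    using assms unfolding duhamel_def by blast
  show thesis
  proof (rule that[of "max C 1"])
    show "(LINT x|torus. (cmod (u t x))\<^sup>2) \<le> max C 1" if "t \<in> {0..T}" for t
      using C[rule_format, OF that] by simp
  qed simp
qed

section \<open>From weak solutions to Duhamel's formula\<close>

lemma log_nonlin_measurable_joint:
  fixes u :: "real \<Rightarrow> real ^ 'd::finite \<Rightarrow> complex"
  assumes "(\<lambda>(t, x). u t x) \<in> borel_measurable (lebesgue_on {0..T} \<Otimes>\<^sub>M torus)"
  shows "(\<lambda>(t, x). log_nonlin (u t x)) \<in> borel_measurable (lebesgue_on {0..T} \<Otimes>\<^sub>M torus)"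
  using measurable_compose[OF assms log_nonlin_measurable] by (simp add: case_prod_beta')

lemma fourier_coeff_log_integrable:
  fixes u :: "real \<Rightarrow> real ^ 'd::finite \<Rightarrow> complex"
  assumes m: "(\<lambda>(t, x). u t x) \<in> borel_measurable (lebesgue_on {0..T} \<Otimes>\<^sub>M torus)"
    and sq: "\<And>t. t \<in> {0..T} \<Longrightarrow> sq_integrable torus (u t)"
    and C: "\<And>t. t \<in> {0..T} \<Longrightarrow> (LINT x|torus. (cmod (u t x))\<^sup>2) \<le> C"
  shows "integrable (lebesgue_on {0..T}) (\<lambda>t. fourier_coeff (\<lambda>x. log_nonlin (u t x)) k)"
proof (rule finite_measure.integrable_const_bound[OF finite_measure_Icc])
  let ?B = "(2 * measure (torus :: (real ^ 'd) measure) (space torus) + 2 * C) / (2 * pi) ^ CARD('d)"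
  show "(\<lambda>t. fourier_coeff (\<lambda>x. log_nonlin (u t x)) k) \<in> borel_measurable (lebesgue_on {0..T})"
    by (rule fourier_coeff_measurable_time[OF log_nonlin_measurable_joint[OF m]])
  show "AE t in lebesgue_on {0..T}. norm (fourier_coeff (\<lambda>x. log_nonlin (u t x)) k) \<le> ?B"
  proof (rule AE_I2)
    fix t assume "t \<in> space (lebesgue_on {0..T})"
    then have t: "t \<in> {0..T}" by simp
    note b = sq_integrable_bound_log_nonlin[OF sq[OF t]]
    have "(LINT x|torus. cmod (log_nonlin (u t x))) / (2 * pi) ^ CARD('d) \<le> ?B"
      by (intro divide_right_mono order_trans[OF b(2)] add_left_mono mult_left_mono C[OF t]) auto
    with cmod_fourier_coeff_le[OF b(1), of k]
    show "norm (fourier_coeff (\<lambda>x. log_nonlin (u t x)) k) \<le> ?B" by linarith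
  qed
qed

text \<open>Three versions of one solution are in play: \<open>u\<close> satisfies the equation,
  \<open>w\<close> is weakly continuous, and \<open>v\<close> is jointly measurable. The Fourier
  coefficients of \<open>v\<close> and \<open>w\<close> agree at every time and those of
  \<open>u\<close> at almost every time, so the equation, continuity and Fubini's theorem all become
  available for \<open>v\<close>.\<close>

lemma weak_solution_representative:
  fixes u :: "real \<Rightarrow> real ^ 'd::finite \<Rightarrow> complex"
  assumes T: "T > 0" and s: "s \<ge> 0" and sol: "weak_Hs_solution lam s {0..T} u0 u"
  obtains w v where "weakly_continuous_rep s {0..T} u w" "AE x in torus. w 0 x = u0 x" "duhamel lam T v"
    "\<And>t. t \<in> {0..T} \<Longrightarrow> AE x in torus. v t x = w t x"
    "\<exists>C. \<forall>t\<in>{0..T}. \<forall>K. finite K \<longrightarrow> (\<Sum>k\<in>K. Hs_weight s k * (cmod (fourier_coeff (v t) k))\<^sup>2) \<le> C"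
proof -
  let ?M = "lebesgue_on {0..T}"
  from sol obtain w where w: "weakly_continuous_rep s {0..T} u w" "AE x in torus. w 0 x = u0 x"
    unfolding weak_Hs_solution_def by blast
  from sol obtain C where uC: "AE t in ?M. u t \<in> torus_Hs s" "AE t in ?M. Hs_norm s (u t) \<le> C"
    and eq: "logNLS_distr lam {0..T} u"
    unfolding weak_Hs_solution_def Linfty_Hs_def by blast
  have wHs: "w t \<in> torus_Hs s" if "t \<in> {0..T}" for t
    using w(1) that unfolding weakly_continuous_rep_def weakly_continuous_Hs_def by blast
  have wc: "continuous_on {0..T} (\<lambda>t. fourier_coeff (w t) k)" for k
  proof -
    have "\<forall>L\<in>Hs_dual s. continuous_on {0..T} (\<lambda>t. L (w t))"
      using w(1) unfolding weakly_continuous_rep_def weakly_continuous_Hs_def by blast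
    from bspec[OF this fourier_coeff_Hs_dual[OF s, of k]] show ?thesis .
  qed
  have wu: "AE t in ?M. AE x in torus. w t x = u t x"
    using w(1) unfolding weakly_continuous_rep_def by blast
  have wsq: "sq_integrable torus (w t)" if "t \<in> {0..T}" for t
    by (rule torus_Hs_sq_integrable[OF wHs[OF that]])
  have wm: "(\<lambda>t. fourier_coeff (w t) k) \<in> borel_measurable ?M" for k
    by (rule continuous_on_measurable_Icc[OF wc])
  obtain v :: "real \<Rightarrow> real ^ 'd \<Rightarrow> complex" where
    vm: "(\<lambda>(t, x). v t x) \<in> borel_measurable (?M \<Otimes>\<^sub>M torus)" and
    vw: "\<And>t. t \<in> {0..T} \<Longrightarrow> AE x in torus. v t x = w t x"
    using joint_representative[of T w, OF wsq wm] by blast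
  have vtm: "v t \<in> borel_measurable torus" if "t \<in> {0..T}" for t
    using measurable_pair_const_snd[OF vm] that by simp
  have wtm: "w t \<in> borel_measurable torus" if "t \<in> {0..T}" for t
    using wsq[OF that] by (simp add: sq_integrable_def)
  have vsq: "sq_integrable torus (v t)" if "t \<in> {0..T}" for t
    by (rule sq_integrable_cong_AE[OF wsq[OF that] vtm[OF that]]) (use vw[OF that] in \<open>auto elim: AE_mp\<close>)
  have vc: "fourier_coeff (v t) k = fourier_coeff (w t) k" if "t \<in> {0..T}" for t k
    by (rule fourier_coeff_cong_AE[OF vtm[OF that] wtm[OF that] vw[OF that]])
  have uw: "AE t in ?M. t \<in> {0..T} \<and> u t \<in> borel_measurable torus \<and> (AE x in torus. u t x = v t x)"
    using uC(1) wu AE_space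
  proof eventually_elim
    case (elim t)
    then have t: "t \<in> {0..T}" by simp
    have "u t \<in> borel_measurable torus"
      using torus_Hs_sq_integrable[OF elim(1)] by (simp add: sq_integrable_def)
    moreover have "AE x in torus. u t x = v t x"
      using elim(2) vw[OF t] by eventually_elim simp
    ultimately show ?case using t by blast
  qed
  have uv: "AE t in ?M. \<forall>k. fourier_coeff (u t) k = fourier_coeff (v t) k \<and>
      fourier_coeff (\<lambda>x. log_nonlin (u t x)) k = fourier_coeff (\<lambda>x. log_nonlin (v t x)) k"
    using uw
  proof eventually_elim
    case (elim t)
    have t: "t \<in> {0..T}" and um: "u t \<in> borel_measurable torus" and ae: "AE x in torus. u t x = v t x"
      using elim by blast+
    have ae': "AE x in torus. log_nonlin (u t x) = log_nonlin (v t x)"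
      using ae by eventually_elim simp
    show ?case
      by (intro allI conjI fourier_coeff_cong_AE[OF um vtm[OF t] ae]
           fourier_coeff_cong_AE[OF measurable_compose[OF um log_nonlin_measurable] measurable_compose[OF vtm[OF t] log_nonlin_measurable] ae'])
  qed
  \<comment> \<open>The norm of \<open>w t\<close> need not be continuous in t, but finite partial
    sums of its square are. For them the essential bound on \<open>u\<close> holds at every
    time.\<close>
  have bound: "(\<Sum>k\<in>K. Hs_weight s k * (cmod (fourier_coeff (v t) k))\<^sup>2) \<le> C\<^sup>2"
    if t: "t \<in> {0..T}" and K: "finite K" for t K
  proof -
    have "(\<Sum>k\<in>K. Hs_weight s k * (cmod (fourier_coeff (w t) k))\<^sup>2) \<le> C\<^sup>2"
    proof (rule AE_le_continuous[OF T _ _ t])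
      show "continuous_on {0..T} (\<lambda>t. \<Sum>k\<in>K. Hs_weight s k * (cmod (fourier_coeff (w t) k))\<^sup>2)"
        by (intro continuous_on_sum continuous_on_mult continuous_on_const continuous_on_power continuous_on_norm wc)
      show "AE t in ?M. (\<Sum>k\<in>K. Hs_weight s k * (cmod (fourier_coeff (w t) k))\<^sup>2) \<le> C\<^sup>2"
        using uC uv AE_space
      proof eventually_elim
        case (elim t)
        then have t: "t \<in> {0..T}" by simp
        have "fourier_coeff (w t) k = fourier_coeff (u t) k" for k using elim(3) vc[OF t] by simp
        then have "(\<Sum>k\<in>K. Hs_weight s k * (cmod (fourier_coeff (w t) k))\<^sup>2) \<le> (Hs_norm s (u t))\<^sup>2"
          using Hs_sum_le[OF elim(1) K] by simp
        also have "\<dots> \<le> C\<^sup>2"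
          by (intro power_mono elim(2)) (auto simp: Hs_norm_def Hs_weight_def intro!: infsum_nonneg)
        finally show ?case .
      qed
    qed
    then show ?thesis using vc[OF t] by simp
  qed
  have L2: "(LINT x|torus. (cmod (v t x))\<^sup>2) \<le> (2 * pi) ^ CARD('d) * C\<^sup>2" if t: "t \<in> {0..T}" for t
  proof (rule LIMSEQ_le_const2[OF Parseval[OF vsq[OF t]]], intro exI[of _ 0] allI impI)
    fix N
    have "(\<Sum>k\<in>modes N. 1 * (cmod (fourier_coeff (v t) k))\<^sup>2) \<le> (\<Sum>k\<in>modes N. Hs_weight s k * (cmod (fourier_coeff (v t) k))\<^sup>2)"
      by (intro sum_mono mult_right_mono Hs_weight_ge_1 s) simp
    also have "\<dots> \<le> C\<^sup>2" by (rule bound[OF t finite_modes])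
    finally show "(2 * pi) ^ CARD('d) * (\<Sum>k\<in>modes N. (cmod (fourier_coeff (v t) k))\<^sup>2) \<le> (2 * pi) ^ CARD('d) * C\<^sup>2"
      by (intro mult_left_mono) auto
  qed
  have "cis (of_int (freq_sq k) * t) * fourier_coeff (v t) k = fourier_coeff (v 0) k +
        \<i> * of_real lam * (LINT s|?M. indicator {..t} s *
           (cis (of_int (freq_sq k) * s) * fourier_coeff (\<lambda>x. log_nonlin (v s x)) k))" if t: "t \<in> {0..T}" for k t
  proof -
    define X where "X t = cis (of_int (freq_sq k) * t) * fourier_coeff (w t) k" for t
    define Y where "Y t = cis (of_int (freq_sq k) * t) * fourier_coeff (\<lambda>x. log_nonlin (v t x)) k" for t
    have ec: "continuous_on S (\<lambda>t. cis (of_int (freq_sq k) * t))" for S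
      by (intro continuous_intros)
    have Xc: "continuous_on {0..T} X"
      unfolding X_def by (rule continuous_on_mult[OF ec wc])
    have Yi: "integrable ?M Y"
      unfolding Y_def by (rule integrable_continuous_mult[OF fourier_coeff_log_integrable[OF vm vsq L2] ec])
    have uk: "AE t in ?M. fourier_coeff (w t) k = fourier_coeff (u t) k"
      using uv AE_space by eventually_elim (simp add: vc)
    have um: "(\<lambda>t. fourier_coeff (u t) k) \<in> borel_measurable ?M"
      by (rule borel_measurable_AE_cong[OF complete_measure_Icc wm uk])
    have ui: "integrable ?M (\<lambda>t. fourier_coeff (u t) k)"
      by (rule integrable_cong_AE_imp[OF continuous_imp_integrable_real[OF wc] um]) (use uk in \<open>auto elim: AE_mp\<close>)
    have gv: "(\<lambda>t. fourier_coeff (\<lambda>x. log_nonlin (v t x)) k) \<in> borel_measurable ?M"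
      using fourier_coeff_log_integrable[OF vm vsq L2] by (rule borel_measurable_integrable)
    have gk: "AE t in ?M. fourier_coeff (\<lambda>x. log_nonlin (v t x)) k = fourier_coeff (\<lambda>x. log_nonlin (u t x)) k"
      using uv by eventually_elim simp
    have gu: "(\<lambda>t. fourier_coeff (\<lambda>x. log_nonlin (u t x)) k) \<in> borel_measurable ?M"
      by (rule borel_measurable_AE_cong[OF complete_measure_Icc gv gk])
    have em: "(\<lambda>t. cis (of_int (freq_sq k) * t)) \<in> borel_measurable ?M"
      by (rule continuous_on_measurable_Icc[OF ec])
    have "X t = X 0 + \<i> * of_real lam * (LINT s|?M. indicator {..t} s * Y s)"
    proof (rule weak_ODE[OF T Xc Yi _ t])
      fix \<psi> \<psi>' assume cut: "cutoff_on T \<psi> \<psi>'"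
      have D: "(\<psi> has_real_derivative \<psi>' t) (at t)" and c': "continuous_on UNIV \<psi>'" for t
        using cut unfolding cutoff_on_def by blast+
      have pc: "continuous_on {0..T} (\<lambda>t. complex_of_real (\<psi> t))" "continuous_on {0..T} (\<lambda>t. complex_of_real (\<psi>' t))"
        by (intro continuous_on_of_real, rule DERIV_continuous_on, rule has_field_derivative_at_within, rule D)
           (intro continuous_on_of_real continuous_on_subset[OF c' subset_UNIV])
      note pm = pc[THEN continuous_on_measurable_Icc]
      have "(LINT t|?M. of_real (\<psi>' t) * X t) =
         (LINT t|?M. of_real (\<psi>' t) * (cis (of_int (freq_sq k) * t) * fourier_coeff (u t) k))"
        unfolding X_def
        by (rule integral_cong_AE) (intro borel_measurable_times pm em wm um, intro borel_measurable_times pm em wm um,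
            use uk in eventually_elim, simp)
      also have "\<dots> = - (\<i> * of_real lam) * (LINT t|?M. of_real (\<psi> t) *
        (cis (of_int (freq_sq k) * t) * fourier_coeff (\<lambda>x. log_nonlin (u t x)) k))"
        by (rule logNLS_cutoff[OF cut eq ui])
      also have "(LINT t|?M. of_real (\<psi> t) *
        (cis (of_int (freq_sq k) * t) * fourier_coeff (\<lambda>x. log_nonlin (u t x)) k)) = (LINT t|?M. of_real (\<psi> t) * Y t)"
        unfolding Y_def
        by (rule integral_cong_AE) (intro borel_measurable_times pm em gu gv, intro borel_measurable_times pm em gu gv,
            use gk in eventually_elim, simp)
      finally show "(LINT t|?M. of_real (\<psi>' t) * X t) = - (\<i> * of_real lam) * (LINT t|?M. of_real (\<psi> t) * Y t)" .
    qed
    moreover have "X 0 = fourier_coeff (v 0) k" using T by (simp add: X_def vc)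
    ultimately show ?thesis using vc[OF t] by (simp add: X_def Y_def)
  qed
  then have "duhamel lam T v"
    unfolding duhamel_def using vm vsq L2 by blast
  with w vw bound show thesis by (intro that[of w v]) blast+
qed

section \<open>The energy estimate\<close>

text \<open>The logarithms are real, so only their difference survives in the imaginary part.\<close>

lemma Cazenave_Haraux: "\<bar>Im ((log_nonlin a - log_nonlin b) * cnj (a - b))\<bar> \<le> 2 * (cmod (a - b))\<^sup>2"
proof -
  have wlog: "\<bar>Im ((log_nonlin a - log_nonlin b) * cnj (a - b))\<bar> \<le> 2 * (cmod (a - b))\<^sup>2"
    if le: "cmod b \<le> cmod a" for a b
  proof (cases "b = 0")
    case True
    have "Im (log_nonlin a * cnj a) = 0" by (simp add: log_nonlin_def)
    then show ?thesis using True by (simp add: log_nonlin_def)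
  next
    case False
    define r where "r = cmod a"
    define q where "q = cmod b"
    have q: "0 < q" "q \<le> r" using False le by (auto simp: q_def r_def)
    have "Im ((log_nonlin a - log_nonlin b) * cnj (a - b)) = (ln (q\<^sup>2) - ln (r\<^sup>2)) * Im ((a - b) * cnj b)"
      by (simp add: log_nonlin_def r_def q_def algebra_simps)
    then have "\<bar>Im ((log_nonlin a - log_nonlin b) * cnj (a - b))\<bar> = \<bar>ln (q\<^sup>2) - ln (r\<^sup>2)\<bar> * \<bar>Im ((a - b) * cnj b)\<bar>"
      by (simp add: abs_mult)
    \<comment> \<open>The difference of logarithms costs 1/q, where q is the smaller modulus. The
      other factor is written with b, the number of modulus q, so that q is gained back.\<close>
    also have "\<dots> \<le> (2 * (cmod (a - b) / q)) * (cmod (a - b) * q)"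
    proof (rule mult_mono)
      have "ln (r / q) \<le> r / q - 1" using q by (intro ln_le_minus_one) auto
      also have "r / q - 1 = (r - q) / q" using q by (simp add: field_simps)
      also have "\<dots> \<le> cmod (a - b) / q"
        using q norm_triangle_ineq2[of a b] by (intro divide_right_mono) (auto simp: r_def q_def)
      finally have "ln r - ln q \<le> cmod (a - b) / q" using q by (simp add: ln_div)
      moreover have "ln q \<le> ln r" using q by simp
      ultimately show "\<bar>ln (q\<^sup>2) - ln (r\<^sup>2)\<bar> \<le> 2 * (cmod (a - b) / q)" using q by (simp add: ln_realpow)
      have "\<bar>Im ((a - b) * cnj b)\<bar> \<le> cmod ((a - b) * cnj b)" by (rule abs_Im_le_cmod)
      then show "\<bar>Im ((a - b) * cnj b)\<bar> \<le> cmod (a - b) * q" by (simp add: norm_mult q_def)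
    qed (use q in auto)
    also have "\<dots> = 2 * (cmod (a - b))\<^sup>2" using q by (simp add: power2_eq_square)
    finally show ?thesis .
  qed
  show ?thesis
  proof (cases "cmod b \<le> cmod a")
    case False
    have "(log_nonlin b - log_nonlin a) * cnj (b - a) = (log_nonlin a - log_nonlin b) * cnj (a - b)"
      by (simp add: algebra_simps)
    then show ?thesis using wlog[of a b] False by (simp add: norm_minus_commute)
  qed (rule wlog)
qed

section \<open>An integrated product rule and Gronwall's inequality\<close>

lemma integrable_product_mult:
  fixes f :: "'a \<Rightarrow> complex" and g :: "'b \<Rightarrow> complex"
  assumes "pair_sigma_finite M N" and f: "integrable M f" and g: "integrable N g"
  shows "integrable (M \<Otimes>\<^sub>M N) (\<lambda>(x, y). f x * g y)"
proof -
  interpret pair_sigma_finite M N by fact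
  have [measurable]: "f \<in> borel_measurable M" "g \<in> borel_measurable N" using f g by auto
  show ?thesis
  proof (rule Fubini_integrable)
    show "integrable M (\<lambda>x. LINT y|N. norm (case (x, y) of (x, y) \<Rightarrow> f x * g y))"
      using f by (simp add: norm_mult)
    show "AE x in M. integrable N (\<lambda>y. case (x, y) of (x, y) \<Rightarrow> f x * g y)"
      using g by simp
  qed measurable
qed

lemma indicator_atMost_measurable [measurable]:
  "(\<lambda>s. indicator {..t} s :: complex) \<in> borel_measurable (lebesgue_on {0..T::real})"
  by (intro measurable_restrict_space1 borel_measurable_indicator) auto

lemma integrable_indicator_atMost:
  fixes G :: "real \<Rightarrow> complex"
  assumes "integrable (lebesgue_on {0..T}) G"
  shows "integrable (lebesgue_on {0..T}) (\<lambda>s. indicator {..t} s * G s)"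
  by (rule integrable_bounded_mult[OF assms indicator_atMost_measurable, of _ 1]) (auto simp: indicator_def)

lemma borel_measurable_id_Icc [measurable]: "(\<lambda>s. s) \<in> borel_measurable (lebesgue_on {0..T::real})"
  by (intro measurable_restrict_space1 measurable_completion) simp

lemma pair_sigma_finite_Icc_Icc: "pair_sigma_finite (lebesgue_on {0..T::real}) (lebesgue_on {0..T})"
  by (intro pair_sigma_finite.intro finite_measure.axioms(1) finite_measure_Icc)

text \<open>The square \<open>{..t} \<times> {..t}\<close> is split into two triangles, and Fubini swaps one of them.\<close>

lemma integral_times_indefinite:
  fixes G H :: "real \<Rightarrow> complex"
  assumes G: "integrable (lebesgue_on {0..T}) G" and H: "integrable (lebesgue_on {0..T}) H"
  defines "IG \<equiv> \<lambda>t. LINT s|lebesgue_on {0..T}. indicator {..t} s * G s"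
    and "IH \<equiv> \<lambda>t. LINT s|lebesgue_on {0..T}. indicator {..t} s * H s"
  shows "IG t * IH t = (LINT s|lebesgue_on {0..T}. indicator {..t} s * (G s * IH s + H s * IG s))"
proof -
  let ?M = "lebesgue_on {0..T}"
  interpret P: pair_sigma_finite ?M ?M by (rule pair_sigma_finite_Icc_Icc)
  have [measurable]: "G \<in> borel_measurable ?M" "H \<in> borel_measurable ?M" using G H by auto
  have IGI: "integrable ?M (\<lambda>s. indicator {..t} s * G s)" for t by (rule integrable_indicator_atMost[OF G])
  have IHI: "integrable ?M (\<lambda>s. indicator {..t} s * H s)" for t by (rule integrable_indicator_atMost[OF H])
  have IHc: "continuous_on {0..T} IH" "continuous_on {0..T} IG"
    unfolding IH_def IG_def by (rule continuous_on_indefinite[OF H], rule continuous_on_indefinite[OF G])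
  have tri: "integrable (?M \<Otimes>\<^sub>M ?M) (\<lambda>(s, r). (if s \<le> r \<and> r \<le> t then G s * H r else 0))"
    by (rule Bochner_Integration.integrable_bound[OF integrable_product_mult[OF pair_sigma_finite_Icc_Icc G H]])
       (auto intro!: AE_I2)
  have split: "indicator {..t} s * G s * IH t = indicator {..t} s * (G s * IH s) + (LINT r|?M. (if s \<le> r \<and> r \<le> t then G s * H r else 0))" for s
  proof (cases "s \<le> t")
    case True
    have "(LINT r|?M. indicator {..t} r * H r) - (LINT r|?M. indicator {..s} r * H r) = (LINT r|?M. indicator {..t} r * H r - indicator {..s} r * H r)"
      by (rule Bochner_Integration.integral_diff[OF IHI IHI, symmetric])
    also have "\<dots> = (LINT r|?M. (if s \<le> r \<and> r \<le> t then H r else 0))"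
    proof (rule integral_cong_AE)
      \<comment> \<open>The two sides differ at most at r = s, where the difference of the half-line
        indicators vanishes but the triangle is closed.\<close>
      show "AE r in ?M. indicator {..t} r * H r - indicator {..s} r * H r = (if s \<le> r \<and> r \<le> t then H r else 0)"
        using AE_lebesgue_on_neq[of s T] by eventually_elim (use True in \<open>auto simp: indicator_def\<close>)
    qed measurable
    finally have "IH t = IH s + (LINT r|?M. (if s \<le> r \<and> r \<le> t then H r else 0))"
      unfolding IH_def by (simp add: algebra_simps)
    moreover have "(LINT r|?M. (if s \<le> r \<and> r \<le> t then G s * H r else 0)) = G s * (LINT r|?M. (if s \<le> r \<and> r \<le> t then H r else 0))"
      by (subst integral_mult_right_zero[symmetric]) (rule Bochner_Integration.integral_cong, auto)
    ultimately show ?thesis using True by (simp add: distrib_left)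
  next
    case False
    then have "(if s \<le> r \<and> r \<le> t then G s * H r else 0) = 0" for r by auto
    then show ?thesis using False by simp
  qed
  have GH: "integrable ?M (\<lambda>s. indicator {..t} s * (G s * IH s))"
    using integrable_indicator_atMost[OF integrable_continuous_mult[OF G IHc(1)]] by (simp add: mult.commute)
  have HG: "integrable ?M (\<lambda>s. indicator {..t} s * (H s * IG s))"
    using integrable_indicator_atMost[OF integrable_continuous_mult[OF H IHc(2)]] by (simp add: mult.commute)
  have "IG t * IH t = (LINT s|?M. indicator {..t} s * G s * IH t)"
    unfolding IG_def by (rule integral_mult_left_zero[symmetric])
  also have "\<dots> = (LINT s|?M. indicator {..t} s * (G s * IH s) + (LINT r|?M. (if s \<le> r \<and> r \<le> t then G s * H r else 0)))"
    by (simp only: split)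
  also have "\<dots> = (LINT s|?M. indicator {..t} s * (G s * IH s)) + (LINT s|?M. LINT r|?M. (if s \<le> r \<and> r \<le> t then G s * H r else 0))"
    by (rule Bochner_Integration.integral_add[OF GH P.integrable_fst[OF tri]])
  also have "(LINT s|?M. LINT r|?M. (if s \<le> r \<and> r \<le> t then G s * H r else 0)) = (LINT r|?M. LINT s|?M. (if s \<le> r \<and> r \<le> t then G s * H r else 0))"
    by (rule P.Fubini_integral[OF tri, symmetric])
  also have "\<dots> = (LINT r|?M. indicator {..t} r * (H r * IG r))"
  proof (rule Bochner_Integration.integral_cong[OF refl])
    fix r
    have "(LINT s|?M. (if s \<le> r \<and> r \<le> t then G s * H r else 0)) = (LINT s|?M. (indicator {..t} r * H r) * (indicator {..r} s * G s))"
      by (rule Bochner_Integration.integral_cong) (auto simp: indicator_def)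
    also have "\<dots> = (indicator {..t} r * H r) * IG r" unfolding IG_def by (rule integral_mult_right_zero)
    finally show "(LINT s|?M. (if s \<le> r \<and> r \<le> t then G s * H r else 0)) = indicator {..t} r * (H r * IG r)"
      by (simp only: mult.assoc)
  qed
  also have "(LINT s|?M. indicator {..t} s * (G s * IH s)) + \<dots> = (LINT s|?M. indicator {..t} s * (G s * IH s) + indicator {..t} s * (H s * IG s))"
    by (rule Bochner_Integration.integral_add[OF GH HG, symmetric])
  finally show ?thesis by (simp only: distrib_left)
qed

lemma integral_exp_atMost:
  fixes t T c :: real
  assumes t: "t \<in> {0..T}" and c: "c > 0"
  shows "integrable (lebesgue_on {0..T}) (\<lambda>s. indicator {..t} s * exp (c * s))"
    and "(LINT s|lebesgue_on {0..T}. indicator {..t} s * exp (c * s)) = (exp (c * t) - 1) / c"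
proof -
  have m: "(\<lambda>s. indicator {..t} s :: real) \<in> borel_measurable (lebesgue_on {0..T})"
    by (intro measurable_restrict_space1 borel_measurable_indicator) auto
  have cont: "continuous_on S (\<lambda>s. exp (c * s))" for S by (intro continuous_intros)
  show "integrable (lebesgue_on {0..T}) (\<lambda>s. indicator {..t} s * exp (c * s))"
    by (rule Bochner_Integration.integrable_bound[OF continuous_imp_integrable_real[OF cont[of "{0..T}"]]])
       (use m cont[THEN continuous_on_measurable_Icc] in \<open>auto intro!: AE_I2 simp: indicator_def\<close>)
  have "(LINT s|lebesgue_on {0..T}. indicator {..t} s * exp (c * s)) = (LINT s|lebesgue. indicator {0..T} s *\<^sub>R (indicator {..t} s * exp (c * s)))"
    by (rule integral_restrict_space) auto
  also have "\<dots> = (LINT s|lebesgue. indicator {0..t} s *\<^sub>R exp (c * s))"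
    by (rule Bochner_Integration.integral_cong) (use t in \<open>auto simp: indicator_def\<close>)
  also have "\<dots> = (LINT s|lebesgue_on {0..t}. exp (c * s))"
    by (rule integral_restrict_space[symmetric]) auto
  also have "\<dots> = integral {0..t} (\<lambda>s. exp (c * s))"
    by (rule lebesgue_integral_eq_integral[OF continuous_imp_integrable_real[OF cont]]) auto
  also have "\<dots> = exp (c * t) / c - exp (c * 0) / c"
  proof (rule integral_unique, rule fundamental_theorem_of_calculus)
    show "((\<lambda>s. exp (c * s) / c) has_vector_derivative exp (c * s)) (at s within {0..t})" for s
      unfolding has_real_derivative_iff_has_vector_derivative[symmetric]
      using c by (auto intro!: derivative_eq_intros)
  qed (use t in auto)
  also have "\<dots> = (exp (c * t) - 1) / c" by (simp add: diff_divide_distrib)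
  finally show "(LINT s|lebesgue_on {0..T}. indicator {..t} s * exp (c * s)) = (exp (c * t) - 1) / c" .
qed

text \<open>Iteration in the weight e^(2ct): the integral of c e^(2cs) up to t is at most e^(2ct) /
  2, so each use of the inequality halves the constant in front.\<close>

lemma Gronwall_zero:
  fixes y :: "real \<Rightarrow> real"
  assumes ym: "y \<in> borel_measurable (lebesgue_on {0..T})"
    and y0: "\<And>t. t \<in> {0..T} \<Longrightarrow> 0 \<le> y t" and yC: "\<And>t. t \<in> {0..T} \<Longrightarrow> y t \<le> C" and c: "c > 0"
    and le: "\<And>t. t \<in> {0..T} \<Longrightarrow> y t \<le> (LINT s|lebesgue_on {0..T}. indicator {..t} s * (c * y s))"
    and t: "t \<in> {0..T}"
  shows "y t = 0"
proof -
  let ?M = "lebesgue_on {0..T}"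
  have indm: "(\<lambda>s. indicator {..t} s :: real) \<in> borel_measurable ?M" for t
    by (intro measurable_restrict_space1 borel_measurable_indicator) auto
  have C0: "0 \<le> C" using y0[OF t] yC[OF t] by linarith
  have yI: "integrable ?M (\<lambda>s. indicator {..t} s * (c * y s))" for t
  proof (rule finite_measure.integrable_const_bound[OF finite_measure_Icc, where B="c * C"])
    show "AE s in ?M. norm (indicator {..t} s * (c * y s)) \<le> c * C"
    proof (rule AE_I2)
      fix s assume "s \<in> space ?M"
      then have "0 \<le> y s" "y s \<le> C" using y0 yC by auto
      then have "0 \<le> c * y s" "c * y s \<le> c * C" using c by auto
      then show "norm (indicator {..t} s * (c * y s)) \<le> c * C" by (auto simp: indicator_def)
    qed
  qed (use ym indm in auto)
  have step: "y t \<le> C * (1/2) ^ n * exp (2 * c * t)" if "t \<in> {0..T}" for n t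
    using that
  proof (induction n arbitrary: t)
    case 0
    have "C * 1 \<le> C * exp (2 * c * t)" using 0 c C0 by (intro mult_left_mono) auto
    then show ?case using yC[OF 0] by simp
  next
    case (Suc n)
    let ?D = "c * (C * (1/2) ^ n)"
    have e: "integrable ?M (\<lambda>s. indicator {..t} s * exp ((2 * c) * s))"
      by (rule integral_exp_atMost(1)[OF Suc.prems]) (use c in simp)
    have "y t \<le> (LINT s|?M. indicator {..t} s * (c * y s))" by (rule le[OF Suc.prems])
    also have "\<dots> \<le> (LINT s|?M. ?D * (indicator {..t} s * exp ((2 * c) * s)))"
    proof (rule integral_mono[OF yI integrable_mult_right[OF e]])
      fix s assume "s \<in> space ?M"
      then have "y s \<le> C * (1/2) ^ n * exp (2 * c * s)" using Suc.IH by simp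
      then have "c * y s \<le> c * (C * (1/2) ^ n * exp (2 * c * s))" using c by (intro mult_left_mono) auto
      then show "indicator {..t} s * (c * y s) \<le> ?D * (indicator {..t} s * exp ((2 * c) * s))"
        by (auto simp: indicator_def)
    qed
    also have "\<dots> = ?D * ((exp ((2 * c) * t) - 1) / (2 * c))"
      unfolding integral_mult_right_zero using integral_exp_atMost(2)[OF Suc.prems, of "2 * c"] c by simp
    also have "\<dots> = C * (1/2) ^ Suc n * (exp (2 * c * t) - 1)" using c by simp
    also have "\<dots> \<le> C * (1/2) ^ Suc n * exp (2 * c * t)" using C0 by (intro mult_left_mono) auto
    finally show ?case .
  qed
  have "(\<lambda>n. C * (1/2) ^ n * exp (2 * c * t)) \<longlonglongrightarrow> C * 0 * exp (2 * c * t)"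
    by (intro tendsto_mult tendsto_const LIMSEQ_power_zero) simp
  then have "y t \<le> C * 0 * exp (2 * c * t)"
    by (rule LIMSEQ_le_const) (use step[OF t] in blast)
  then show ?thesis using y0[OF t] by simp
qed

text \<open>In the interaction picture the difference of the coefficients is the indefinite integral
  of \<open>G\<close>, because the data agree. The integrated product rule applied to
  \<open>G\<close> and its conjugate gives the squared modulus, and the phases have modulus 1 and
  cancel.\<close>

lemma duhamel_difference_energy:
  fixes u v :: "real \<Rightarrow> real ^ 'd::finite \<Rightarrow> complex"
  assumes u: "duhamel lam T u" and v: "duhamel lam T v"
    and init: "\<And>k. fourier_coeff (u 0) k = fourier_coeff (v 0) k" and t: "t \<in> {0..T}"
  shows "(cmod (fourier_coeff (u t) k - fourier_coeff (v t) k))\<^sup>2 =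
    (LINT s|lebesgue_on {0..T}. indicator {..t} s * (- 2 * lam * Im ((fourier_coeff (\<lambda>x. log_nonlin (u s x)) k
        - fourier_coeff (\<lambda>x. log_nonlin (v s x)) k) * cnj (fourier_coeff (u s) k - fourier_coeff (v s) k))))"
proof -
  let ?M = "lebesgue_on {0..T}"
  obtain Cu Cv where C: "\<And>t. t \<in> {0..T} \<Longrightarrow> (LINT x|torus. (cmod (u t x))\<^sup>2) \<le> Cu"
    "\<And>t. t \<in> {0..T} \<Longrightarrow> (LINT x|torus. (cmod (v t x))\<^sup>2) \<le> Cv"
    using duhamel_bounded[OF u] duhamel_bounded[OF v] by metis
  define e where "e s = cis (of_int (freq_sq k) * s)" for s
  have ec: "continuous_on S e" for S unfolding e_def by (intro continuous_intros)
  define a where "a s = fourier_coeff (\<lambda>x. log_nonlin (u s x)) k" for s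
  define b where "b s = fourier_coeff (\<lambda>x. log_nonlin (v s x)) k" for s
  define w where "w s = fourier_coeff (u s) k - fourier_coeff (v s) k" for s
  have ai: "integrable ?M (\<lambda>s. e s * a s)"
    unfolding a_def by (rule integrable_continuous_mult[OF fourier_coeff_log_integrable[OF duhamelD(1,2)[OF u] C(1)] ec])
  have bi: "integrable ?M (\<lambda>s. e s * b s)"
    unfolding b_def by (rule integrable_continuous_mult[OF fourier_coeff_log_integrable[OF duhamelD(1,2)[OF v] C(2)] ec])
  define G where "G s = \<i> * of_real lam * (e s * a s - e s * b s)" for s
  have Gi: "integrable ?M G" unfolding G_def by (intro integrable_mult_right Bochner_Integration.integrable_diff ai bi)
  have Gc: "integrable ?M (\<lambda>s. cnj (G s))" using Gi by simp
  have W: "e s * w s = (LINT r|?M. indicator {..s} r * G r)" if s: "s \<in> {0..T}" for s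
  proof -
    note da = duhamelD(3)[OF u s, of k, folded e_def a_def] and db = duhamelD(3)[OF v s, of k, folded e_def b_def]
    have "e s * w s = \<i> * of_real lam * ((LINT r|?M. indicator {..s} r * (e r * a r)) - (LINT r|?M. indicator {..s} r * (e r * b r)))"
      unfolding w_def right_diff_distrib da db init by simp
    also have "(LINT r|?M. indicator {..s} r * (e r * a r)) - (LINT r|?M. indicator {..s} r * (e r * b r))
       = (LINT r|?M. indicator {..s} r * (e r * a r) - indicator {..s} r * (e r * b r))"
      by (rule Bochner_Integration.integral_diff[OF integrable_indicator_atMost[OF ai] integrable_indicator_atMost[OF bi], symmetric])
    also have "\<i> * of_real lam * \<dots> = (LINT r|?M. \<i> * of_real lam * (indicator {..s} r * (e r * a r) - indicator {..s} r * (e r * b r)))"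
      by (rule integral_mult_right_zero[symmetric])
    also have "\<dots> = (LINT r|?M. indicator {..s} r * G r)"
      by (rule Bochner_Integration.integral_cong) (auto simp: G_def indicator_def)
    finally show ?thesis .
  qed
  have Wc: "cnj (e s * w s) = (LINT r|?M. indicator {..s} r * cnj (G r))" if s: "s \<in> {0..T}" for s
    unfolding W[OF s] Bochner_Integration.integral_cnj[symmetric]
    by (rule Bochner_Integration.integral_cong) (auto simp: indicator_def)
  have ee: "e s * cnj (e s) = 1" for s by (simp add: e_def complex_norm_square[symmetric])
  have "complex_of_real ((cmod (w t))\<^sup>2) = (e t * w t) * cnj (e t * w t)"
    using ee[of t] by (simp only: complex_norm_square complex_cnj_mult) (simp add: algebra_simps)
  also have "\<dots> = (LINT s|?M. indicator {..t} s * (G s * (LINT r|?M. indicator {..s} r * cnj (G r)) + cnj (G s) * (LINT r|?M. indicator {..s} r * G r)))"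
    unfolding W[OF t] Wc[OF t, unfolded W[OF t]] by (rule integral_times_indefinite[OF Gi Gc])
  also have "\<dots> = (LINT s|?M. of_real (indicator {..t} s * (- 2 * lam * Im ((a s - b s) * cnj (w s)))))"
  proof (rule Bochner_Integration.integral_cong[OF refl])
    fix s assume "s \<in> space ?M"
    then have s: "s \<in> {0..T}" by simp
    have "G s * cnj (e s * w s) = \<i> * of_real lam * ((e s * cnj (e s)) * ((a s - b s) * cnj (w s)))"
      by (simp add: G_def algebra_simps)
    then have 1: "G s * cnj (e s * w s) = \<i> * of_real lam * ((a s - b s) * cnj (w s))" by (simp add: ee)
    have "cnj (G s) * (e s * w s) = cnj (G s * cnj (e s * w s))" by simp
    then have "G s * cnj (e s * w s) + cnj (G s) * (e s * w s) = of_real (2 * Re (G s * cnj (e s * w s)))"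
      by (simp only: complex_add_cnj)
    also have "Re (G s * cnj (e s * w s)) = - lam * Im ((a s - b s) * cnj (w s))" unfolding 1 by simp
    finally have "G s * cnj (e s * w s) + cnj (G s) * (e s * w s) = of_real (- 2 * lam * Im ((a s - b s) * cnj (w s)))"
      by simp
    then show "indicator {..t} s * (G s * (LINT r|?M. indicator {..s} r * cnj (G r)) + cnj (G s) * (LINT r|?M. indicator {..s} r * G r))
       = of_real (indicator {..t} s * (- 2 * lam * Im ((a s - b s) * cnj (w s))))"
      unfolding W[OF s, symmetric] Wc[OF s, symmetric] by (simp add: indicator_def)
  qed
  also have "\<dots> = of_real (LINT s|?M. indicator {..t} s * (- 2 * lam * Im ((a s - b s) * cnj (w s))))"
    by (rule integral_complex_of_real)
  finally show ?thesis unfolding of_real_eq_iff a_def b_def w_def .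
qed

text \<open>Square integrability of the nonlinearities is what lets the number of modes tend to
  infinity: Bessel's inequality turns it into a dominating function in time, and Parseval identifies
  the limit as the pairing of \<open>F\<close> with \<open>w\<close>. Only for the full pairing is
  the pointwise inequality \<open>Cazenave_Haraux\<close> available.\<close>

lemma duhamel_unique:
  fixes u v :: "real \<Rightarrow> real ^ 'd::finite \<Rightarrow> complex"
  assumes u: "duhamel lam T u" and v: "duhamel lam T v"
    and init: "\<And>k. fourier_coeff (u 0) k = fourier_coeff (v 0) k"
    and gu: "integrable (lebesgue_on {0..T} \<Otimes>\<^sub>M torus) (\<lambda>(s, x). (cmod (log_nonlin (u s x)))\<^sup>2)"
    and gv: "integrable (lebesgue_on {0..T} \<Otimes>\<^sub>M torus) (\<lambda>(s, x). (cmod (log_nonlin (v s x)))\<^sup>2)"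
    and lam: "lam \<noteq> 0" and t: "t \<in> {0..T}"
  shows "AE x in torus. u t x = v t x"
proof -
  let ?M = "lebesgue_on {0..T}"
  interpret P: pair_sigma_finite ?M "torus :: (real ^ 'd) measure" by (rule pair_sigma_finite_Icc_torus)
  interpret N: finite_measure "torus :: (real ^ 'd) measure" by (rule finite_measure_torus)
  define V where "V = (2 * pi) ^ CARD('d)"
  have V: "V > 0" by (simp add: V_def)
  note [measurable] = duhamelD(1)[OF u] duhamelD(1)[OF v]
  note mg [measurable] = log_nonlin_measurable_joint[OF duhamelD(1)[OF u]] log_nonlin_measurable_joint[OF duhamelD(1)[OF v]]
  define w where "w s x = u s x - v s x" for s x
  define F where "F s x = log_nonlin (u s x) - log_nonlin (v s x)" for s x
  define a where "a k s = fourier_coeff (\<lambda>x. log_nonlin (u s x)) k - fourier_coeff (\<lambda>x. log_nonlin (v s x)) k" for k s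
  define b where "b k s = fourier_coeff (u s) k - fourier_coeff (v s) k" for k s
  have am [measurable]: "a k \<in> borel_measurable ?M" for k
    unfolding a_def by (intro borel_measurable_diff fourier_coeff_measurable_time mg)
  have bm [measurable]: "b k \<in> borel_measurable ?M" for k
    unfolding b_def by (intro borel_measurable_diff fourier_coeff_measurable_time duhamelD(1)[OF u] duhamelD(1)[OF v])
  obtain Cu Cv where C: "\<And>t. t \<in> {0..T} \<Longrightarrow> (LINT x|torus. (cmod (u t x))\<^sup>2) \<le> Cu"
    "\<And>t. t \<in> {0..T} \<Longrightarrow> (LINT x|torus. (cmod (v t x))\<^sup>2) \<le> Cv"
    using duhamel_bounded[OF u] duhamel_bounded[OF v] by metis
  have wsq: "sq_integrable torus (w s)" if "s \<in> {0..T}" for s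
    unfolding w_def by (rule sq_integrable_diff[OF duhamelD(2)[OF u that] duhamelD(2)[OF v that]])
  have wb: "fourier_coeff (w s) k = b k s" if "s \<in> {0..T}" for s k
    using fourier_coeff_add[OF duhamelD(2)[OF u that] sq_integrable_cmult[OF duhamelD(2)[OF v that], of "-1"], of k]
    unfolding fourier_coeff_cmult by (simp add: w_def[abs_def] b_def)
  define y where "y s = (LINT x|torus. (cmod (w s x))\<^sup>2)" for s
  define z where "z s = (LINT x|torus. (cmod (F s x))\<^sup>2)" for s
  have ym [measurable]: "y \<in> borel_measurable ?M" unfolding y_def w_def by measurable
  have gu': "AE s in ?M. integrable torus (\<lambda>x. (cmod (log_nonlin (u s x)))\<^sup>2)"
    and gv': "AE s in ?M. integrable torus (\<lambda>x. (cmod (log_nonlin (v s x)))\<^sup>2)"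
    using P.AE_integrable_fst[OF gu] P.AE_integrable_fst[OF gv] by auto
  have sqg: "AE s in ?M. s \<in> {0..T} \<and> sq_integrable torus (\<lambda>x. log_nonlin (u s x)) \<and> sq_integrable torus (\<lambda>x. log_nonlin (v s x))"
    using gu' gv' AE_space
  proof eventually_elim
    case (elim s)
    then show ?case
      using measurable_pair_const_snd[OF mg(1), of s] measurable_pair_const_snd[OF mg(2), of s]
      by (simp add: sq_integrable_def)
  qed
  have Fi: "integrable (?M \<Otimes>\<^sub>M torus) (\<lambda>(s, x). (cmod (F s x))\<^sup>2)"
  proof (rule Bochner_Integration.integrable_bound)
    show "integrable (?M \<Otimes>\<^sub>M torus) (\<lambda>p. 2 * (case p of (s, x) \<Rightarrow> (cmod (log_nonlin (u s x)))\<^sup>2) + 2 * (case p of (s, x) \<Rightarrow> (cmod (log_nonlin (v s x)))\<^sup>2))"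
      by (intro Bochner_Integration.integrable_add integrable_mult_right gu gv)
    show "(\<lambda>(s, x). (cmod (F s x))\<^sup>2) \<in> borel_measurable (?M \<Otimes>\<^sub>M torus)"
      unfolding F_def by measurable
    show "AE p in ?M \<Otimes>\<^sub>M torus. norm (case p of (s, x) \<Rightarrow> (cmod (F s x))\<^sup>2) \<le>
        norm (2 * (case p of (s, x) \<Rightarrow> (cmod (log_nonlin (u s x)))\<^sup>2) + 2 * (case p of (s, x) \<Rightarrow> (cmod (log_nonlin (v s x)))\<^sup>2))"
    proof (rule AE_I2)
      fix p :: "real \<times> (real ^ 'd)"
      obtain s x where p: "p = (s, x)" by fastforce
      show "norm (case p of (s, x) \<Rightarrow> (cmod (F s x))\<^sup>2) \<le>
        norm (2 * (case p of (s, x) \<Rightarrow> (cmod (log_nonlin (u s x)))\<^sup>2) + 2 * (case p of (s, x) \<Rightarrow> (cmod (log_nonlin (v s x)))\<^sup>2))"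
        unfolding p using cmod_add_square_le[of "log_nonlin (u s x)" "- log_nonlin (v s x)"] by (simp add: F_def)
    qed
  qed
  have zi: "integrable ?M z" unfolding z_def by (rule P.integrable_fst[OF Fi])
  have yb: "y s \<le> 2 * Cu + 2 * Cv" if s: "s \<in> {0..T}" for s
  proof -
    have "y s \<le> 2 * (LINT x|torus. (cmod (u s x))\<^sup>2) + 2 * (LINT x|torus. (cmod (v s x))\<^sup>2)"
      using LINT_sq_add_le[OF duhamelD(2)[OF u s] sq_integrable_cmult[OF duhamelD(2)[OF v s], of "-1"]]
      by (simp add: y_def w_def)
    then show ?thesis using C(1)[OF s] C(2)[OF s] by linarith
  qed
  have y0: "0 \<le> y s" for s by (simp add: y_def)
  have yi: "integrable ?M y"
    by (rule finite_measure.integrable_const_bound[OF finite_measure_Icc, where B="2 * Cu + 2 * Cv"])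
       (use yb y0 in \<open>auto intro!: AE_I2\<close>)
  have aF: "AE s in ?M. s \<in> {0..T} \<and> sq_integrable torus (F s) \<and> (\<forall>k. fourier_coeff (F s) k = a k s)"
    using sqg
  proof eventually_elim
    case (elim s)
    then have sq: "sq_integrable torus (\<lambda>x. log_nonlin (u s x))" "sq_integrable torus (\<lambda>x. log_nonlin (v s x))" by blast+
    have "fourier_coeff (F s) k = a k s" for k
      using fourier_coeff_add[OF sq(1) sq_integrable_cmult[OF sq(2), of "-1"], of k]
      unfolding fourier_coeff_cmult by (simp add: F_def[abs_def] a_def)
    then show ?case using elim sq_integrable_diff[OF sq] by (simp add: F_def[abs_def])
  qed
  \<comment> \<open>\<open>S N\<close> is the truncated right-hand side of the energy identity, and
    \<open>L\<close> is its limit.\<close>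
  define S where "S N s = - 2 * lam * Im (of_real V * (\<Sum>k\<in>modes N. a k s * cnj (b k s)))" for N s
  define L where "L s = - 2 * lam * Im (LINT x|torus. F s x * cnj (w s x))" for s
  have indm [measurable]: "(\<lambda>s. indicator {..t} s :: real) \<in> borel_measurable ?M" for t
    by (intro measurable_restrict_space1 borel_measurable_indicator) auto
  \<comment> \<open>The rate 4 |lam| is 2 |lam| from the energy identity times 2 from
    \<open>Cazenave_Haraux\<close>.\<close>
  have key: "y t \<le> (LINT s|?M. indicator {..t} s * (4 * \<bar>lam\<bar> * y s))" if t: "t \<in> {0..T}" for t
  proof -
    have ab: "integrable ?M (\<lambda>s. indicator {..t} s * (- 2 * lam * Im (a k s * cnj (b k s))))" for k
    proof (rule Bochner_Integration.integrable_bound)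
      have ak: "integrable ?M (a k)"
        unfolding a_def by (intro Bochner_Integration.integrable_diff
          fourier_coeff_log_integrable[OF duhamelD(1,2)[OF u] C(1)] fourier_coeff_log_integrable[OF duhamelD(1,2)[OF v] C(2)])
      show "integrable ?M (\<lambda>s. (2 * \<bar>lam\<bar> * sqrt ((2 * Cu + 2 * Cv) / V)) * cmod (a k s))"
        using ak by (intro integrable_mult_right integrable_norm)
      show "AE s in ?M. norm (indicator {..t} s * (- 2 * lam * Im (a k s * cnj (b k s)))) \<le>
          norm ((2 * \<bar>lam\<bar> * sqrt ((2 * Cu + 2 * Cv) / V)) * cmod (a k s))"
      proof (rule AE_I2)
        fix s assume "s \<in> space ?M"
        then have s: "s \<in> {0..T}" by simp
        have "V * (cmod (b k s))\<^sup>2 \<le> y s"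
          using Bessel_inequality[OF wsq[OF s], of "{k}"] by (simp add: wb[OF s] V_def y_def)
        then have "(cmod (b k s))\<^sup>2 \<le> (2 * Cu + 2 * Cv) / V"
          using yb[OF s] V by (simp add: pos_le_divide_eq mult.commute)
        then have bb: "cmod (b k s) \<le> sqrt ((2 * Cu + 2 * Cv) / V)" by (rule real_le_rsqrt)
        have "\<bar>Im (a k s * cnj (b k s))\<bar> \<le> cmod (a k s * cnj (b k s))" by (rule abs_Im_le_cmod)
        also have "\<dots> \<le> sqrt ((2 * Cu + 2 * Cv) / V) * cmod (a k s)"
          using mult_left_mono[OF bb, of "cmod (a k s)"] by (simp add: norm_mult mult.commute)
        finally have "2 * \<bar>lam\<bar> * \<bar>Im (a k s * cnj (b k s))\<bar> \<le> 2 * \<bar>lam\<bar> * (sqrt ((2 * Cu + 2 * Cv) / V) * cmod (a k s))"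
          by (intro mult_left_mono) auto
        moreover have "norm (indicator {..t} s * (- 2 * lam * Im (a k s * cnj (b k s)))) \<le> 2 * \<bar>lam\<bar> * \<bar>Im (a k s * cnj (b k s))\<bar>"
          by (simp add: indicator_def abs_mult)
        moreover have "2 * \<bar>lam\<bar> * (sqrt ((2 * Cu + 2 * Cv) / V) * cmod (a k s)) \<le> norm ((2 * \<bar>lam\<bar> * sqrt ((2 * Cu + 2 * Cv) / V)) * cmod (a k s))"
          by (simp add: mult.assoc)
        ultimately show "norm (indicator {..t} s * (- 2 * lam * Im (a k s * cnj (b k s)))) \<le>
          norm ((2 * \<bar>lam\<bar> * sqrt ((2 * Cu + 2 * Cv) / V)) * cmod (a k s))" by linarith
      qed
    qed measurable
    have E: "V * (\<Sum>k\<in>modes N. (cmod (fourier_coeff (w t) k))\<^sup>2) = (LINT s|?M. indicator {..t} s * S N s)" for N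
    proof -
      have "V * (\<Sum>k\<in>modes N. (cmod (fourier_coeff (w t) k))\<^sup>2) = V * (\<Sum>k\<in>modes N. (LINT s|?M. indicator {..t} s * (- 2 * lam * Im (a k s * cnj (b k s)))))"
        using duhamel_difference_energy[OF u v init t] by (simp add: wb[OF t] b_def a_def)
      also have "(\<Sum>k\<in>modes N. (LINT s|?M. indicator {..t} s * (- 2 * lam * Im (a k s * cnj (b k s))))) =
          (LINT s|?M. (\<Sum>k\<in>modes N. indicator {..t} s * (- 2 * lam * Im (a k s * cnj (b k s)))))"
        by (rule Bochner_Integration.integral_sum[symmetric]) (rule ab)
      also have "V * \<dots> = (LINT s|?M. V * (\<Sum>k\<in>modes N. indicator {..t} s * (- 2 * lam * Im (a k s * cnj (b k s)))))"
        by (rule integral_mult_right_zero[symmetric])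
      also have "\<dots> = (LINT s|?M. indicator {..t} s * S N s)"
      proof (rule Bochner_Integration.integral_cong[OF refl])
        fix s
        have "Im (of_real V * (\<Sum>k\<in>modes N. a k s * cnj (b k s))) = V * (\<Sum>k\<in>modes N. Im (a k s * cnj (b k s)))"
          by (simp only: Im_complex_of_real Re_complex_of_real times_complex.sel Im_sum mult_zero_left add_0_right)
        then show "V * (\<Sum>k\<in>modes N. indicator {..t} s * (- 2 * lam * Im (a k s * cnj (b k s)))) = indicator {..t} s * S N s"
          unfolding S_def sum_distrib_left[symmetric] by (simp only: mult.left_commute)
      qed
      finally show ?thesis .
    qed
    have lim: "(\<lambda>N. LINT s|?M. indicator {..t} s * S N s) \<longlonglongrightarrow> (LINT s|?M. indicator {..t} s * L s)"
    \<comment> \<open>\<open>z\<close> bounds the truncated sums for \<open>F\<close> and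
      \<open>y\<close> those for \<open>w\<close>, uniformly in N. The factor 2 |lam| is halved by
      |a b| <= (|a|^2 + |b|^2) / 2.\<close>
    proof (rule integral_dominated_convergence[where w = "\<lambda>s. \<bar>lam\<bar> * (z s + y s)"])
      show "(\<lambda>s. indicator {..t} s * S N s) \<in> borel_measurable ?M" for N unfolding S_def by measurable
      show "(\<lambda>s. indicator {..t} s * L s) \<in> borel_measurable ?M" unfolding L_def F_def w_def by measurable
      show "integrable ?M (\<lambda>s. \<bar>lam\<bar> * (z s + y s))" by (intro integrable_mult_right Bochner_Integration.integrable_add zi yi)
      show "AE s in ?M. (\<lambda>N. indicator {..t} s * S N s) \<longlonglongrightarrow> indicator {..t} s * L s"
        using aF
      proof eventually_elim
        case (elim s)
        then have s: "s \<in> {0..T}" and F: "sq_integrable torus (F s)" and Fa: "\<And>k. fourier_coeff (F s) k = a k s" by blast+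
        from Parseval_inner[OF F wsq[OF s]]
        have "(\<lambda>N. of_real V * (\<Sum>k\<in>modes N. a k s * cnj (b k s))) \<longlonglongrightarrow> (LINT x|torus. F s x * cnj (w s x))"
          by (simp only: Fa wb[OF s] V_def)
        then show ?case unfolding S_def L_def by (intro tendsto_mult tendsto_const tendsto_Im)
      qed
      show "AE s in ?M. norm (indicator {..t} s * S N s) \<le> \<bar>lam\<bar> * (z s + y s)" for N
        using aF
      proof eventually_elim
        case (elim s)
        then have s: "s \<in> {0..T}" and F: "sq_integrable torus (F s)" and Fa: "\<And>k. fourier_coeff (F s) k = a k s" by blast+
        have "cmod (\<Sum>k\<in>modes N. a k s * cnj (b k s)) \<le> (\<Sum>k\<in>modes N. ((cmod (a k s))\<^sup>2 + (cmod (b k s))\<^sup>2) / 2)"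
          by (rule sum_norm_le) (use cmod_mult_le[of _ "cnj _"] in simp)
        also have "\<dots> = ((\<Sum>k\<in>modes N. (cmod (a k s))\<^sup>2) + (\<Sum>k\<in>modes N. (cmod (b k s))\<^sup>2)) / 2"
          by (simp only: sum_divide_distrib[symmetric] sum.distrib)
        finally have "V * cmod (\<Sum>k\<in>modes N. a k s * cnj (b k s)) \<le> V * (((\<Sum>k\<in>modes N. (cmod (a k s))\<^sup>2) + (\<Sum>k\<in>modes N. (cmod (b k s))\<^sup>2)) / 2)"
          using V by (intro mult_left_mono) auto
        moreover have "V * (\<Sum>k\<in>modes N. (cmod (a k s))\<^sup>2) \<le> z s"
          using Bessel_inequality[OF F finite_modes[of N]] by (simp only: Fa V_def z_def)
        moreover have "V * (\<Sum>k\<in>modes N. (cmod (b k s))\<^sup>2) \<le> y s"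
          using Bessel_inequality[OF wsq[OF s] finite_modes[of N]] by (simp only: wb[OF s] V_def y_def)
        ultimately have le: "V * cmod (\<Sum>k\<in>modes N. a k s * cnj (b k s)) \<le> (z s + y s) / 2"
          unfolding add_divide_distrib distrib_left by (simp add: field_simps)
        have "\<bar>Im (of_real V * (\<Sum>k\<in>modes N. a k s * cnj (b k s)))\<bar> \<le> cmod (of_real V * (\<Sum>k\<in>modes N. a k s * cnj (b k s)))"
          by (rule abs_Im_le_cmod)
        also have "\<dots> = V * cmod (\<Sum>k\<in>modes N. a k s * cnj (b k s))" using V by (simp only: norm_mult norm_of_real abs_of_pos)
        finally have "\<bar>Im (of_real V * (\<Sum>k\<in>modes N. a k s * cnj (b k s)))\<bar> \<le> (z s + y s) / 2" using le by linarith
        then have "(2 * \<bar>lam\<bar>) * \<bar>Im (of_real V * (\<Sum>k\<in>modes N. a k s * cnj (b k s)))\<bar> \<le> (2 * \<bar>lam\<bar>) * ((z s + y s) / 2)"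
          by (intro mult_left_mono) auto
        then have "\<bar>S N s\<bar> \<le> \<bar>lam\<bar> * (z s + y s)" unfolding S_def by (simp add: abs_mult)
        moreover have "norm (indicator {..t} s * S N s) \<le> \<bar>S N s\<bar>" by (simp add: indicator_def)
        ultimately show ?case by linarith
      qed
    qed
    have "y t = (LINT s|?M. indicator {..t} s * L s)"
    proof (rule LIMSEQ_unique)
      show "(\<lambda>N. LINT s|?M. indicator {..t} s * S N s) \<longlonglongrightarrow> y t"
        using Parseval[OF wsq[OF t]] by (simp only: E[symmetric] V_def y_def)
    qed (rule lim)
    also have "\<dots> \<le> (LINT s|?M. indicator {..t} s * (4 * \<bar>lam\<bar> * y s))"
    proof (rule integral_mono_AE)
      have Lb: "AE s in ?M. \<bar>L s\<bar> \<le> 4 * \<bar>lam\<bar> * y s"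
        using aF
      proof eventually_elim
        case (elim s)
        then have s: "s \<in> {0..T}" and F: "sq_integrable torus (F s)" by blast+
        have I: "integrable torus (\<lambda>x. F s x * cnj (w s x))" by (rule sq_integrable_mult[OF F sq_integrable_cnj[OF wsq[OF s]]])
        have "\<bar>Im (LINT x|torus. F s x * cnj (w s x))\<bar> = \<bar>LINT x|torus. Im (F s x * cnj (w s x))\<bar>"
          using integral_Im[OF I] by simp
        also have "\<dots> \<le> (LINT x|torus. \<bar>Im (F s x * cnj (w s x))\<bar>)" by (rule integral_abs_bound)
        also have "\<dots> \<le> (LINT x|torus. 2 * (cmod (w s x))\<^sup>2)"
        proof (rule integral_mono)
          show "integrable torus (\<lambda>x. \<bar>Im (F s x * cnj (w s x))\<bar>)" using I by (intro integrable_abs integrable_Im)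
          show "integrable torus (\<lambda>x. 2 * (cmod (w s x))\<^sup>2)" using wsq[OF s] by (simp add: sq_integrable_def)
          show "\<bar>Im (F s x * cnj (w s x))\<bar> \<le> 2 * (cmod (w s x))\<^sup>2" for x
            unfolding F_def w_def by (rule Cazenave_Haraux)
        qed
        also have "\<dots> = 2 * y s" unfolding y_def by (rule integral_mult_right_zero)
        finally have "(2 * \<bar>lam\<bar>) * \<bar>Im (LINT x|torus. F s x * cnj (w s x))\<bar> \<le> (2 * \<bar>lam\<bar>) * (2 * y s)"
          by (intro mult_left_mono) auto
        then show ?case unfolding L_def by (simp add: abs_mult)
      qed
      show "AE s in ?M. indicator {..t} s * L s \<le> indicator {..t} s * (4 * \<bar>lam\<bar> * y s)"
        using Lb by eventually_elim (auto simp: indicator_def)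
      have yI: "integrable ?M (\<lambda>s. 4 * \<bar>lam\<bar> * y s)" by (intro integrable_mult_right yi)
      show "integrable ?M (\<lambda>s. indicator {..t} s * L s)"
      proof (rule Bochner_Integration.integrable_bound[OF yI])
        show "(\<lambda>s. indicator {..t} s * L s) \<in> borel_measurable ?M" unfolding L_def F_def w_def by measurable
        show "AE s in ?M. norm (indicator {..t} s * L s) \<le> norm (4 * \<bar>lam\<bar> * y s)"
          using Lb by eventually_elim (use y0 in \<open>auto simp: indicator_def abs_mult\<close>)
      qed
      show "integrable ?M (\<lambda>s. indicator {..t} s * (4 * \<bar>lam\<bar> * y s))"
        by (rule Bochner_Integration.integrable_bound[OF yI]) (auto simp: indicator_def intro!: AE_I2)
    qed
    finally show ?thesis .
  qed
  have "y t = 0"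
    by (rule Gronwall_zero[OF ym y0 yb _ key t]) (use lam in auto)
  then have "AE x in torus. (cmod (w t x))\<^sup>2 = 0"
    unfolding y_def by (subst (asm) integral_nonneg_eq_0_iff_AE) (use wsq[OF t] in \<open>auto simp: sq_integrable_def\<close>)
  then show ?thesis by eventually_elim (simp add: w_def)
qed

section \<open>Square integrability of the nonlinearity\<close>

lemma Suc_times_power_le:
  fixes q :: real
  assumes "0 < q" "q < 1"
  shows "real (Suc j) * q ^ j \<le> 1 / (1 - q)"
proof -
  have "real (Suc j) * q ^ j = (\<Sum>i<Suc j. q ^ j)" by simp
  also have "\<dots> \<le> (\<Sum>i<Suc j. q ^ i)"
    by (intro sum_mono power_decreasing) (use assms in auto)
  also have "\<dots> \<le> (\<Sum>i. q ^ i)"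
    by (intro sum_le_suminf summable_geometric) (use assms in auto)
  also have "\<dots> = 1 / (1 - q)" using assms by (intro suminf_geometric) auto
  finally show ?thesis .
qed

text \<open>The ratio is written as a cube: two of the factors q^j absorb (j+1)^2, and the third one
  is summed.\<close>

lemma summable_square_geometric:
  fixes q :: real
  assumes "0 < q" "q < 1"
  shows "summable (\<lambda>j. (real (Suc j))\<^sup>2 * (q ^ 3) ^ j)"
proof (rule summable_comparison_test)
  show "summable (\<lambda>j. (1 / (1 - q))\<^sup>2 * q ^ j)"
    using assms by (intro summable_mult summable_geometric) auto
  have "(real (Suc j))\<^sup>2 * (q ^ 3) ^ j \<le> (1 / (1 - q))\<^sup>2 * q ^ j" for j
  proof -
    have "(real (Suc j))\<^sup>2 * (q ^ 3) ^ j = (real (Suc j) * q ^ j)\<^sup>2 * q ^ j"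
      by (simp add: power_mult[symmetric] power_add[symmetric] power_mult_distrib mult.commute flip: power_mult)
    also have "\<dots> \<le> (1 / (1 - q))\<^sup>2 * q ^ j"
      using assms by (intro mult_right_mono power_mono Suc_times_power_le) auto
    finally show ?thesis .
  qed
  then show "\<exists>N. \<forall>n\<ge>N. norm ((real (Suc n))\<^sup>2 * (q ^ 3) ^ n) \<le> (1 / (1 - q))\<^sup>2 * q ^ n"
    using assms by auto
qed

lemma cmod_log_nonlin_small: "cmod z < 1 \<Longrightarrow> cmod (log_nonlin z) \<le> 4"
proof -
  assume "cmod z < 1"
  then have "(cmod z)\<^sup>2 \<le> 1\<^sup>2" by (intro power_mono) auto
  then show ?thesis using cmod_log_nonlin_le[of z] by simp
qed

lemma cmod_log_nonlin_dyadic: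
  assumes "1 \<le> cmod z" "cmod z < 2 ^ Suc j"
  shows "cmod (log_nonlin z) \<le> 2 * real (Suc j) * cmod z"
proof -
  have "ln (cmod z) \<le> ln (2 ^ Suc j)" using assms by (subst ln_le_cancel_iff) auto
  also have "\<dots> = real (Suc j) * ln 2" by (simp only: ln_realpow)
  also have "\<dots> \<le> real (Suc j) * 1" using ln_le_minus_one[of "2::real"] by (intro mult_left_mono) auto
  finally have l: "ln (cmod z) \<le> real (Suc j)" by simp
  have "ln ((cmod z)\<^sup>2) = 2 * ln (cmod z)" using assms by (simp add: ln_realpow)
  moreover have "0 \<le> ln (cmod z)" using assms by simp
  ultimately have "cmod (log_nonlin z) = cmod z * (2 * ln (cmod z))"
    by (simp add: log_nonlin_def norm_mult abs_mult)
  also have "\<dots> \<le> cmod z * (2 * real (Suc j))" using l by (intro mult_left_mono) auto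
  finally show ?thesis by (simp add: mult_ac)
qed

text \<open>A dyadic decomposition of the values of \<open>f\<close>. In the j-th shell the square
  of the logarithm costs a multiple of (j+1)^2 while the mass is O(2^(-j \<sigma>)); the region |f|
  < 1 contributes at most 16 = 4^2 pointwise, integrable on a finite measure space.\<close>

lemma log_nonlin_sq_integrable:
  fixes f :: "'a \<Rightarrow> complex"
  assumes M: "finite_measure M" and f: "sq_integrable M f" and q: "0 < \<sigma>"
    and bound: "\<And>R. 1 \<le> R \<Longrightarrow> (LINT x|M. indicator {r. R \<le> r \<and> r < 2 * R} (cmod (f x)) * (cmod (f x))\<^sup>2) \<le> D * R powr (- \<sigma>)"
  shows "integrable M (\<lambda>x. (cmod (log_nonlin (f x)))\<^sup>2)"
proof (rule integrableI_nonneg)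
  interpret finite_measure M by fact
  have [measurable]: "f \<in> borel_measurable M" using f by (simp add: sq_integrable_def)
  show "(\<lambda>x. (cmod (log_nonlin (f x)))\<^sup>2) \<in> borel_measurable M" by measurable
  define h where "h j x = indicator {r. 2 ^ j \<le> r \<and> r < 2 * 2 ^ j} (cmod (f x)) * (cmod (f x))\<^sup>2" for j :: nat and x
  have hm [measurable]: "h j \<in> borel_measurable M" for j unfolding h_def by measurable
  have h0: "0 \<le> h j x" for j x by (simp add: h_def)
  have hi: "integrable M (h j)" for j
    by (rule Bochner_Integration.integrable_bound[of M "\<lambda>x. (cmod (f x))\<^sup>2"])
       (use f in \<open>auto simp: h_def sq_integrable_def indicator_def intro!: AE_I2\<close>)
  \<comment> \<open>The cube root of 2^(-\<sigma>), to match the form of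
    \<open>summable_square_geometric\<close>.\<close>
  define \<rho> where "\<rho> = 2 powr (- \<sigma> / 3)"
  have \<rho>: "0 < \<rho>" "\<rho> < 1" using q powr_less_mono[of "- \<sigma> / 3" 0 2] by (auto simp: \<rho>_def)
  have hb: "integral\<^sup>L M (h j) \<le> \<bar>D\<bar> * (\<rho> ^ 3) ^ j" for j
  proof -
    have "\<rho> ^ 3 = 2 powr (- \<sigma>)" by (simp add: \<rho>_def powr_realpow[symmetric] powr_powr)
    then have eq: "(\<rho> ^ 3) ^ j = (2 ^ j) powr (- \<sigma>)"
      by (simp add: powr_realpow[symmetric] powr_powr mult.commute)
    have "D * (2 ^ j) powr (- \<sigma>) \<le> \<bar>D\<bar> * (2 ^ j) powr (- \<sigma>)" by (intro mult_right_mono) auto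
    moreover have "integral\<^sup>L M (h j) \<le> D * (2 ^ j) powr (- \<sigma>)" using bound[of "2 ^ j"] by (simp add: h_def[abs_def])
    ultimately show ?thesis unfolding eq by linarith
  qed
  have pw: "ennreal ((cmod (log_nonlin (f x)))\<^sup>2) \<le> ennreal 16 + (\<Sum>j. ennreal (4 * (real (Suc j))\<^sup>2 * h j x))" for x
  proof (cases "cmod (f x) < 1")
    case True
    have "(cmod (log_nonlin (f x)))\<^sup>2 \<le> 4\<^sup>2" by (intro power_mono cmod_log_nonlin_small True) auto
    then have "ennreal ((cmod (log_nonlin (f x)))\<^sup>2) \<le> ennreal 16" by (intro ennreal_leI) simp
    then show ?thesis by (simp add: add_increasing2)
  next
    case False
    \<comment> \<open>Minimality gives 2^j <= |f x|; for j = 0 this is the case assumption |f x| >=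
      1.\<close>
    define j where "j = (LEAST n. cmod (f x) < 2 ^ Suc n)"
    obtain n where n: "cmod (f x) < 2 ^ n" using real_arch_pow[of 2 "cmod (f x)"] by auto
    then have "cmod (f x) < 2 ^ Suc n" by simp (smt (verit) norm_ge_zero)
    then have j1: "cmod (f x) < 2 ^ Suc j" unfolding j_def by (rule LeastI)
    have j2: "2 ^ j \<le> cmod (f x)"
    proof (cases j)
      case 0
      then show ?thesis using False by simp
    next
      case (Suc i)
      then have "\<not> cmod (f x) < 2 ^ Suc i" using not_less_Least[of i "\<lambda>n. cmod (f x) < 2 ^ Suc n"] by (simp add: j_def)
      then show ?thesis using Suc by simp
    qed
    have "(cmod (log_nonlin (f x)))\<^sup>2 \<le> (2 * real (Suc j) * cmod (f x))\<^sup>2"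
      using False j1 by (intro power_mono cmod_log_nonlin_dyadic) auto
    also have "\<dots> = 4 * (real (Suc j))\<^sup>2 * h j x" using j1 j2 by (simp add: h_def power_mult_distrib del: of_nat_Suc)
    finally have "ennreal ((cmod (log_nonlin (f x)))\<^sup>2) \<le> ennreal (4 * (real (Suc j))\<^sup>2 * h j x)" by (rule ennreal_leI)
    also have "\<dots> = (\<Sum>j\<in>{j}. ennreal (4 * (real (Suc j))\<^sup>2 * h j x))" by simp
    also have "\<dots> \<le> (\<Sum>j. ennreal (4 * (real (Suc j))\<^sup>2 * h j x))"
      by (rule sum_le_suminf) (auto intro: summableI)
    finally show ?thesis by (simp add: add_increasing)
  qed
  have "(\<integral>\<^sup>+x. ennreal ((cmod (log_nonlin (f x)))\<^sup>2) \<partial>M) \<le> (\<integral>\<^sup>+x. ennreal 16 + (\<Sum>j. ennreal (4 * (real (Suc j))\<^sup>2 * h j x)) \<partial>M)"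
    by (rule nn_integral_mono) (rule pw)
  also have "\<dots> = (\<integral>\<^sup>+x. ennreal 16 \<partial>M) + (\<Sum>j. \<integral>\<^sup>+x. ennreal (4 * (real (Suc j))\<^sup>2 * h j x) \<partial>M)"
    by (subst nn_integral_add) (auto simp: nn_integral_suminf)
  also have "(\<Sum>j. \<integral>\<^sup>+x. ennreal (4 * (real (Suc j))\<^sup>2 * h j x) \<partial>M) \<le> (\<Sum>j. ennreal (4 * \<bar>D\<bar> * ((real (Suc j))\<^sup>2 * (\<rho> ^ 3) ^ j)))"
  proof (intro suminf_le summableI allI)
    fix j
    have "(\<integral>\<^sup>+x. ennreal (4 * (real (Suc j))\<^sup>2 * h j x) \<partial>M) = ennreal (LINT x|M. 4 * (real (Suc j))\<^sup>2 * h j x)"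
      by (rule nn_integral_eq_integral) (use hi h0 in \<open>auto intro!: AE_I2\<close>)
    also have "(LINT x|M. 4 * (real (Suc j))\<^sup>2 * h j x) = 4 * (real (Suc j))\<^sup>2 * integral\<^sup>L M (h j)"
      by (rule integral_mult_right_zero)
    also have "\<dots> \<le> 4 * (real (Suc j))\<^sup>2 * (\<bar>D\<bar> * (\<rho> ^ 3) ^ j)" by (intro mult_left_mono hb) auto
    finally show "(\<integral>\<^sup>+x. ennreal (4 * (real (Suc j))\<^sup>2 * h j x) \<partial>M) \<le> ennreal (4 * \<bar>D\<bar> * ((real (Suc j))\<^sup>2 * (\<rho> ^ 3) ^ j))"
      by (simp add: mult_ac ennreal_leI)
  qed
  also have "(\<integral>\<^sup>+x. ennreal 16 \<partial>M) + (\<Sum>j. ennreal (4 * \<bar>D\<bar> * ((real (Suc j))\<^sup>2 * (\<rho> ^ 3) ^ j))) < \<infinity>"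
  proof -
    have "(\<Sum>j. ennreal (4 * \<bar>D\<bar> * ((real (Suc j))\<^sup>2 * (\<rho> ^ 3) ^ j))) = ennreal (\<Sum>j. 4 * \<bar>D\<bar> * ((real (Suc j))\<^sup>2 * (\<rho> ^ 3) ^ j))"
      using \<rho> by (intro suminf_ennreal2 summable_mult summable_square_geometric) auto
    then show ?thesis by (simp add: ennreal_mult_less_top emeasure_eq_measure)
  qed
  finally show "(\<integral>\<^sup>+x. ennreal ((cmod (log_nonlin (f x)))\<^sup>2) \<partial>M) < \<infinity>" by (simp add: add_left_mono)
qed (auto intro!: AE_I2)

section \<open>Decay of large values for positive Sobolev regularity\<close>

lemma Hs_weight_outside_modes:
  fixes k :: "int ^ 'd::finite"
  assumes k: "k \<notin> modes N" and s: "0 \<le> s"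
  shows "(real (Suc N)) powr (2 * s) \<le> Hs_weight s k"
proof -
  obtain j where j: "int N < \<bar>k $ j\<bar>" using k by (auto simp: modes_def not_le)
  have "(real (Suc N))\<^sup>2 \<le> (real_of_int \<bar>k $ j\<bar>)\<^sup>2" using j by (intro power_mono) auto
  also have "\<dots> \<le> (\<Sum>j\<in>UNIV. (real_of_int (k $ j))\<^sup>2)"
    using member_le_sum[of j UNIV "\<lambda>j. (real_of_int (k $ j))\<^sup>2"] by simp
  finally have le: "(real (Suc N))\<^sup>2 \<le> 1 + (\<Sum>j\<in>UNIV. (real_of_int (k $ j))\<^sup>2)" by simp
  have "(real (Suc N)) powr (2 * s) = ((real (Suc N))\<^sup>2) powr s"
    by (simp add: powr_powr flip: powr_numeral)
  also have "\<dots> \<le> Hs_weight s k" unfolding Hs_weight_def using s le by (intro powr_mono2) auto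
  finally show ?thesis .
qed

text \<open>Outside \<open>modes N\<close> the weight is at least (N+1)^(2s), so the weighted sum
  pays for the tail with this factor to spare.\<close>

lemma Hs_fourier_tail:
  fixes f :: "real ^ 'd::finite \<Rightarrow> complex"
  assumes f: "sq_integrable torus f" and s: "0 \<le> s"
    and C: "\<And>K. finite K \<Longrightarrow> (\<Sum>k\<in>K. Hs_weight s k * (cmod (fourier_coeff f k))\<^sup>2) \<le> C"
  shows "(LINT x|torus. (cmod (f x - fourier_sum N f x))\<^sup>2) \<le> (2 * pi) ^ CARD('d) * (C * (real (Suc N)) powr (- 2 * s))"
proof -
  define P where "P = (real (Suc N)) powr (2 * s)"
  have P: "P > 0" by (simp add: P_def)
  have "(LINT x|torus. (cmod (f x))\<^sup>2) \<le> (2 * pi) ^ CARD('d) * (\<Sum>k\<in>modes N. (cmod (fourier_coeff f k))\<^sup>2) + (2 * pi) ^ CARD('d) * (C / P)"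
  proof (rule LIMSEQ_le_const2[OF Parseval[OF f]], intro exI[of _ N] allI impI)
    fix M assume "N \<le> M"
    then have sub: "modes N \<subseteq> (modes M :: (int ^ 'd) set)" by (rule modes_mono)
    have "P * (\<Sum>k\<in>modes M - modes N. (cmod (fourier_coeff f k))\<^sup>2) \<le> (\<Sum>k\<in>modes M - modes N. Hs_weight s k * (cmod (fourier_coeff f k))\<^sup>2)"
      unfolding sum_distrib_left P_def using s by (intro sum_mono mult_right_mono Hs_weight_outside_modes) auto
    also have "\<dots> \<le> C" by (rule C) (intro finite_Diff finite_modes)
    finally have "(\<Sum>k\<in>modes M - modes N. (cmod (fourier_coeff f k))\<^sup>2) \<le> C / P"
      using P by (simp add: pos_le_divide_eq mult.commute)
    then have "(\<Sum>k\<in>modes M. (cmod (fourier_coeff f k))\<^sup>2) \<le> (\<Sum>k\<in>modes N. (cmod (fourier_coeff f k))\<^sup>2) + C / P"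
      using sum.subset_diff[OF sub finite_modes, of "\<lambda>k. (cmod (fourier_coeff f k))\<^sup>2"] by simp
    then have "(2 * pi) ^ CARD('d) * (\<Sum>k\<in>modes M. (cmod (fourier_coeff f k))\<^sup>2) \<le> (2 * pi) ^ CARD('d) * ((\<Sum>k\<in>modes N. (cmod (fourier_coeff f k))\<^sup>2) + C / P)"
      by (intro mult_left_mono) auto
    then show "(2 * pi) ^ CARD('d) * (\<Sum>k\<in>modes M. (cmod (fourier_coeff f k))\<^sup>2) \<le>
        (2 * pi) ^ CARD('d) * (\<Sum>k\<in>modes N. (cmod (fourier_coeff f k))\<^sup>2) + (2 * pi) ^ CARD('d) * (C / P)"
      by (simp only: distrib_left)
  qed
  moreover have eq: "C / P = C * (real (Suc N)) powr (- 2 * s)" by (simp add: P_def powr_minus_divide)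
  ultimately show ?thesis unfolding fourier_sum_L2_dist[OF f] eq by linarith
qed

text \<open>With N of the order of R^(1/d), a Fourier sum of about N^d bounded coefficients stays
  below R/2. Where |f| >= R this forces |f| <= 2 |f - S_N f|, and the tail is O(N^(-2s)) =
  O(R^(-2s/d)).\<close>

lemma Hs_large_values:
  fixes f :: "real ^ 'd::finite \<Rightarrow> complex"
  assumes f: "sq_integrable torus f" and s: "0 < s" and C1: "1 \<le> C"
    and C: "\<And>K. finite K \<Longrightarrow> (\<Sum>k\<in>K. Hs_weight s k * (cmod (fourier_coeff f k))\<^sup>2) \<le> C" and R: "1 \<le> R"
  shows "(LINT x|torus. indicator {r. R \<le> r \<and> r < 2 * R} (cmod (f x)) * (cmod (f x))\<^sup>2) \<le>
     4 * ((2 * pi) ^ CARD('d) * C * ((1 / (2 * C)) powr (1 / CARD('d)) / 3) powr (- 2 * s)) * R powr (- (2 * s / CARD('d)))"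
proof -
  interpret finite_measure "torus :: (real ^ 'd) measure" by (rule finite_measure_torus)
  let ?h = "\<lambda>x. indicator {r. R \<le> r \<and> r < 2 * R} (cmod (f x)) * (cmod (f x))\<^sup>2"
  have [measurable]: "f \<in> borel_measurable torus" using f by (simp add: sq_integrable_def)
  have fi: "integrable torus (\<lambda>x. (cmod (f x))\<^sup>2)" using f by (simp add: sq_integrable_def)
  have hi: "integrable torus ?h"
    by (rule Bochner_Integration.integrable_bound[OF fi]) (auto simp: indicator_def intro!: AE_I2)
  define d where "d = real CARD('d)"
  have d: "d > 0" by (simp add: d_def)
  define V where "V = (2 * pi) ^ CARD('d)"
  have V: "V > 0" by (simp add: V_def)
  \<comment> \<open>Chosen so that (3 y)^d C = R/2. When N is the integer part of \<open>y\<close>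
    and N >= 1, one has 2 N + 1 <= 3 y, so a sum over \<open>modes N\<close> with coefficients
    bounded by \<open>C\<close> is at most R/2.\<close>
  define y where "y = (R / (2 * C)) powr (1 / d) / 3"
  have y: "y > 0" using R C1 by (simp add: y_def)
  have main: "integral\<^sup>L torus ?h \<le> 4 * (V * (C * y powr (- 2 * s)))"
  proof (cases "y < 1")
    \<comment> \<open>No positive N is available below \<open>y\<close>, but then y^(-2s) >= 1 and
      the bound V C on the total mass is already good enough.\<close>
    case True
    have "integral\<^sup>L torus ?h \<le> (LINT x|torus. (cmod (f x))\<^sup>2)"
      by (rule integral_mono[OF hi fi]) (simp add: indicator_def)
    also have "\<dots> \<le> V * C"
    proof (rule LIMSEQ_le_const2[OF Parseval[OF f]], intro exI[of _ 0] allI impI)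
      fix N
      have "(\<Sum>k\<in>modes N. 1 * (cmod (fourier_coeff f k))\<^sup>2) \<le> (\<Sum>k\<in>modes N. Hs_weight s k * (cmod (fourier_coeff f k))\<^sup>2)"
        using s by (intro sum_mono mult_right_mono Hs_weight_ge_1) auto
      also have "\<dots> \<le> C" by (rule C[OF finite_modes])
      finally show "(2 * pi) ^ CARD('d) * (\<Sum>k\<in>modes N. (cmod (fourier_coeff f k))\<^sup>2) \<le> V * C"
        unfolding V_def by (intro mult_left_mono) auto
    qed
    also have "\<dots> \<le> 4 * (V * (C * y powr (- 2 * s)))"
    proof -
      have "1 \<le> y powr (- 2 * s)"
        using powr_mono2'[of "- 2 * s" y 1] True y s by simp
      then have "C * 1 \<le> C * y powr (- 2 * s)" using C1 by (intro mult_left_mono) auto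
      then have "V * C \<le> V * (C * y powr (- 2 * s))" using V by (intro mult_left_mono) auto
      moreover have "0 \<le> V * (C * y powr (- 2 * s))" using V C1 by simp
      ultimately show ?thesis by linarith
    qed
    finally show ?thesis .
  next
    case False
    define N where "N = nat \<lfloor>y\<rfloor>"
    have N: "real N \<le> y" "y < real (Suc N)" "1 \<le> N" using False by (auto simp: N_def le_nat_iff) linarith+
    have fk: "cmod (fourier_coeff f k) \<le> C" for k
    proof -
      have "1 * (cmod (fourier_coeff f k))\<^sup>2 \<le> Hs_weight s k * (cmod (fourier_coeff f k))\<^sup>2"
        using s by (intro mult_right_mono Hs_weight_ge_1) auto
      also have "\<dots> \<le> C" using C[of "{k}"] by simp
      also have "\<dots> \<le> C\<^sup>2" using C1 by (simp add: power2_eq_square)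
      finally have "(cmod (fourier_coeff f k))\<^sup>2 \<le> C\<^sup>2" by simp
      then show ?thesis by (rule power2_le_imp_le) (use C1 in simp)
    qed
    have sup: "cmod (fourier_sum N f x) \<le> R / 2" for x
    proof -
      have "cmod (fourier_sum N f x) \<le> (\<Sum>k\<in>(modes N :: (int ^ 'd) set). C)"
        unfolding fourier_sum_def by (rule sum_norm_le) (use fk in \<open>simp add: norm_mult\<close>)
      also have "\<dots> = real (card (modes N :: (int ^ 'd) set)) * C" by simp
      also have "\<dots> \<le> real ((2 * N + 1) ^ CARD('d)) * C"
        using C1 by (intro mult_right_mono of_nat_mono card_modes_le) auto
      also have "\<dots> \<le> (3 * y) ^ CARD('d) * C"
      proof -
        have "real (2 * N + 1) \<le> 3 * y" using N by simp
        then have "(real (2 * N + 1)) ^ CARD('d) \<le> (3 * y) ^ CARD('d)" by (intro power_mono) auto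
        then show ?thesis using C1 by (intro mult_right_mono) auto
      qed
      also have "(3 * y) ^ CARD('d) = R / (2 * C)"
      proof -
        have "(3 * y) ^ CARD('d) = ((R / (2 * C)) powr (1 / d)) powr d"
          using R C1 by (simp add: y_def d_def powr_realpow)
        also have "\<dots> = R / (2 * C)" using R C1 d by (simp add: powr_powr)
        finally show ?thesis .
      qed
      finally show ?thesis using C1 by simp
    qed
    have sqd: "sq_integrable torus (\<lambda>x. f x - fourier_sum N f x)"
      by (rule sq_integrable_diff[OF f sq_integrable_fourier_sum])
    have "integral\<^sup>L torus ?h \<le> (LINT x|torus. 4 * (cmod (f x - fourier_sum N f x))\<^sup>2)"
    proof (rule integral_mono[OF hi])
      show "integrable torus (\<lambda>x. 4 * (cmod (f x - fourier_sum N f x))\<^sup>2)" using sqd by (simp add: sq_integrable_def)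
      show "?h x \<le> 4 * (cmod (f x - fourier_sum N f x))\<^sup>2" for x
      proof (cases "R \<le> cmod (f x)")
        case True
        have "cmod (f x) \<le> 2 * cmod (f x - fourier_sum N f x)"
          using norm_triangle_ineq2[of "f x" "fourier_sum N f x"] sup[of x] True by linarith
        then have "(cmod (f x))\<^sup>2 \<le> (2 * cmod (f x - fourier_sum N f x))\<^sup>2" by (intro power_mono) auto
        then show ?thesis by (simp add: indicator_def power_mult_distrib)
      qed (simp add: indicator_def)
    qed
    also have "\<dots> = 4 * (LINT x|torus. (cmod (f x - fourier_sum N f x))\<^sup>2)" by (rule integral_mult_right_zero)
    also have "\<dots> \<le> 4 * (V * (C * (real (Suc N)) powr (- 2 * s)))"
      unfolding V_def using Hs_fourier_tail[OF f _ C] s by (intro mult_left_mono) auto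
    also have "\<dots> \<le> 4 * (V * (C * y powr (- 2 * s)))"
      using V C1 N(2) y s by (intro mult_left_mono powr_mono2') auto
    finally show ?thesis .
  qed
  have ye: "y = ((1 / (2 * C)) powr (1 / d) / 3) * R powr (1 / d)"
    using R C1 by (simp add: y_def powr_divide)
  have "y powr (- 2 * s) = ((1 / (2 * C)) powr (1 / d) / 3) powr (- 2 * s) * (R powr (1 / d)) powr (- 2 * s)"
    unfolding ye by (rule powr_mult)
  also have "(R powr (1 / d)) powr (- 2 * s) = R powr (- (2 * s / d))" by (simp add: powr_powr)
  finally have eq: "y powr (- 2 * s) = ((1 / (2 * C)) powr (1 / d) / 3) powr (- 2 * s) * R powr (- (2 * s / d))" .
  show ?thesis using main unfolding eq V_def d_def by (simp only: mult.assoc)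
qed

lemma duhamel_sq_integrable:
  fixes u :: "real \<Rightarrow> real ^ 'd::finite \<Rightarrow> complex"
  assumes u: "duhamel lam T u"
  shows "sq_integrable (lebesgue_on {0..T} \<Otimes>\<^sub>M torus) (\<lambda>(s, x). u s x)"
proof -
  interpret P: pair_sigma_finite "lebesgue_on {0..T}" "torus :: (real ^ 'd) measure" by (rule pair_sigma_finite_Icc_torus)
  interpret N: finite_measure "torus :: (real ^ 'd) measure" by (rule finite_measure_torus)
  note [measurable] = duhamelD(1)[OF u]
  obtain C where C: "\<And>t. t \<in> {0..T} \<Longrightarrow> (LINT x|torus. (cmod (u t x))\<^sup>2) \<le> C" using duhamel_bounded[OF u] by metis
  have "integrable (lebesgue_on {0..T} \<Otimes>\<^sub>M torus) (\<lambda>p. (cmod (case p of (s, x) \<Rightarrow> u s x))\<^sup>2)"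
  proof (rule P.Fubini_integrable)
    show "AE s in lebesgue_on {0..T}. integrable torus (\<lambda>x. (cmod (case (s, x) of (s, x) \<Rightarrow> u s x))\<^sup>2)"
      using duhamelD(2)[OF u] by (auto intro!: AE_I2 simp: sq_integrable_def)
    show "integrable (lebesgue_on {0..T}) (\<lambda>s. LINT x|torus. norm ((cmod (case (s, x) of (s, x) \<Rightarrow> u s x))\<^sup>2))"
    proof (rule finite_measure.integrable_const_bound[OF finite_measure_Icc, where B=C])
      show "AE s in lebesgue_on {0..T}. norm (LINT x|torus. norm ((cmod (case (s, x) of (s, x) \<Rightarrow> u s x))\<^sup>2)) \<le> C"
        using C by (auto intro!: AE_I2)
    qed measurable
  qed measurable
  then show ?thesis using duhamelD(1)[OF u] by (simp add: sq_integrable_def)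
qed

lemma finite_measure_space_time: "finite_measure (lebesgue_on {0..T::real} \<Otimes>\<^sub>M (torus :: (real ^ 'd::finite) measure))"
  by (intro finite_measure_pair_measure finite_measure_Icc finite_measure_torus)

lemma log_nonlin_integrable_Hs:
  fixes u :: "real \<Rightarrow> real ^ 'd::finite \<Rightarrow> complex"
  assumes u: "duhamel lam T u" and s: "0 < s" and T: "T > 0"
    and C: "\<forall>t\<in>{0..T}. \<forall>K. finite K \<longrightarrow> (\<Sum>k\<in>K. Hs_weight s k * (cmod (fourier_coeff (u t) k))\<^sup>2) \<le> C"
  shows "integrable (lebesgue_on {0..T} \<Otimes>\<^sub>M torus) (\<lambda>(s, x). (cmod (log_nonlin (u s x)))\<^sup>2)"
proof -
  let ?M = "lebesgue_on {0..T}"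
  interpret P: pair_sigma_finite ?M "torus :: (real ^ 'd) measure" by (rule pair_sigma_finite_Icc_torus)
  note [measurable] = duhamelD(1)[OF u]
  note sq = duhamel_sq_integrable[OF u]
  define C' where "C' = max C 1"
  define D where "D = 4 * ((2 * pi) ^ CARD('d) * C' * ((1 / (2 * C')) powr (1 / CARD('d)) / 3) powr (- 2 * s))"
  define \<sigma> where "\<sigma> = 2 * s / CARD('d)"
  have "integrable (?M \<Otimes>\<^sub>M torus) (\<lambda>p. (cmod (log_nonlin (case p of (s, x) \<Rightarrow> u s x)))\<^sup>2)"
  proof (rule log_nonlin_sq_integrable[OF finite_measure_space_time sq, of \<sigma> "T * D"])
    show "0 < \<sigma>" using s by (simp add: \<sigma>_def)
    fix R :: real assume R: "1 \<le> R"
    let ?h = "\<lambda>s x. indicator {r. R \<le> r \<and> r < 2 * R} (cmod (u s x)) * (cmod (u s x))\<^sup>2"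
    have hi: "integrable (?M \<Otimes>\<^sub>M torus) (\<lambda>(s, x). ?h s x)"
    proof (rule Bochner_Integration.integrable_bound)
      show "integrable (?M \<Otimes>\<^sub>M torus) (\<lambda>p. (cmod (case p of (s, x) \<Rightarrow> u s x))\<^sup>2)" using sq by (simp add: sq_integrable_def)
      show "(\<lambda>(s, x). ?h s x) \<in> borel_measurable (?M \<Otimes>\<^sub>M torus)" by measurable
    qed (auto simp: indicator_def intro!: AE_I2)
    have "(LINT p|(?M \<Otimes>\<^sub>M torus). indicator {r. R \<le> r \<and> r < 2 * R} (cmod (case p of (s, x) \<Rightarrow> u s x)) * (cmod (case p of (s, x) \<Rightarrow> u s x))\<^sup>2)
        = (LINT s|?M. LINT x|torus. ?h s x)"
      unfolding P.integral_fst[OF hi] by (simp add: case_prod_beta')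
    also have "\<dots> \<le> (LINT s|?M. D * R powr (- \<sigma>))"
    proof (rule integral_mono[OF P.integrable_fst[OF hi]])
      show "integrable ?M (\<lambda>s. D * R powr (- \<sigma>))" by (rule finite_measure.integrable_const[OF finite_measure_Icc])
      fix t assume "t \<in> space ?M"
      then have t: "t \<in> {0..T}" by simp
      have C': "1 \<le> C'" "\<And>K. finite K \<Longrightarrow> (\<Sum>k\<in>K. Hs_weight s k * (cmod (fourier_coeff (u t) k))\<^sup>2) \<le> C'"
        using C t by (auto simp: C'_def intro: order_trans[OF _ max.cobounded1])
      show "(LINT x|torus. ?h t x) \<le> D * R powr (- \<sigma>)"
        unfolding D_def \<sigma>_def by (rule Hs_large_values[OF duhamelD(2)[OF u t] s C' R])
    qed
    also have "\<dots> = T * D * R powr (- \<sigma>)" using T by (simp add: measure_restrict_space)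
    finally show "(LINT p|(?M \<Otimes>\<^sub>M torus). indicator {r. R \<le> r \<and> r < 2 * R} (cmod (case p of (s, x) \<Rightarrow> u s x)) * (cmod (case p of (s, x) \<Rightarrow> u s x))\<^sup>2)
        \<le> T * D * R powr (- \<sigma>)" .
  qed
  then show ?thesis by (simp add: case_prod_beta')
qed

section \<open>A Strichartz estimate in dimension one\<close>

lemma int_sum_square_eq:
  fixes a b c d :: int
  assumes 1: "a + b = c + d" and 2: "a\<^sup>2 + b\<^sup>2 = c\<^sup>2 + d\<^sup>2"
  shows "a = c \<and> b = d \<or> a = d \<and> b = c"
proof -
  have b: "b = c + d - a" using 1 by simp
  have "(a - c) * (a - d) = 0" using 2 unfolding b by (simp add: power2_eq_square algebra_simps)
  then show ?thesis using b by auto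
qed

text \<open>The points \<open>(k, k\<^sup>2)\<close> have no non-trivial additive quadruples.\<close>

lemma parabola_quadruple:
  fixes k l m n :: "int ^ 'd::finite"
  assumes d: "CARD('d) = 1" and 1: "k + l = m + n" and 2: "freq_sq k + freq_sq l = freq_sq m + freq_sq n"
  shows "k = m \<and> l = n \<or> k = n \<and> l = m"
proof -
  obtain j :: 'd where j: "UNIV = {j}" using d by (rule card_1_singletonE)
  then have all: "i = j" for i by auto
  have eq: "x = y \<longleftrightarrow> x $ j = y $ j" for x y :: "int ^ 'd" using all by (metis vec_eq_iff)
  have "k $ j + l $ j = m $ j + n $ j" using 1 by (metis vector_add_component)
  moreover have "(k $ j)\<^sup>2 + (l $ j)\<^sup>2 = (m $ j)\<^sup>2 + (n $ j)\<^sup>2" using 2 by (simp add: freq_sq_def j)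
  ultimately show ?thesis unfolding eq by (rule int_sum_square_eq)
qed

text \<open>The free Schroedinger evolution of the trigonometric polynomial with coefficients
  \<open>c\<close> on \<open>K\<close>.\<close>

definition free_wave :: "(int ^ 'd::finite) set \<Rightarrow> (int ^ 'd \<Rightarrow> complex) \<Rightarrow> real \<Rightarrow> real ^ 'd \<Rightarrow> complex" where
  "free_wave K c t x = (\<Sum>k\<in>K. c k * cis (- (of_int (freq_sq k) * t)) * wave k x)"

lemma cis_int_integral_period:
  "(LINT t|lebesgue_on {0..2 * pi * real m}. cis (of_int n * t)) = (if n = 0 then of_real (2 * pi * real m) else 0)"
proof -
  have meas: "(\<lambda>t. cis (of_int n * t)) \<in> borel_measurable borel"
    by (intro borel_measurable_continuous_onI continuous_intros)
  have "(LINT t|lebesgue_on {0..2 * pi * real m}. cis (of_int n * t)) = (LINT t|lebesgue. indicator {0..2 * pi * real m} t *\<^sub>R cis (of_int n * t))"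
    by (rule integral_restrict_space) auto
  also have "\<dots> = (LINT t|lborel. indicator {0..2 * pi * real m} t *\<^sub>R cis (of_int n * t))"
    by (rule integral_completion) (intro borel_measurable_scaleR borel_measurable_indicator, simp_all add: meas)
  finally show ?thesis by (simp only: integral_cis_int)
qed

lemma cmod_free_wave_power4:
  "complex_of_real ((cmod (free_wave K c t x)) ^ 4) =
    (\<Sum>(k, l, m, n)\<in>K \<times> K \<times> K \<times> K. (c k * c l * cnj (c m) * cnj (c n)) *
       cis (of_int (freq_sq m + freq_sq n - freq_sq k - freq_sq l) * t) * wave (k + l - m - n) x)"
proof -
  let ?f = "\<lambda>k. c k * cis (- (of_int (freq_sq k) * t)) * wave k x"
  have power4: "complex_of_real ((cmod z) ^ 4) = z * (z * (cnj z * cnj z))" for z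
  proof -
    have "complex_of_real ((cmod z) ^ 4) = complex_of_real ((cmod z)\<^sup>2) * complex_of_real ((cmod z)\<^sup>2)"
      by (simp flip: of_real_mult power_add)
    then show ?thesis unfolding complex_norm_square by (simp only: mult_ac)
  qed
  from power4[of "free_wave K c t x"]
  have "complex_of_real ((cmod (free_wave K c t x)) ^ 4) = (\<Sum>k\<in>K. ?f k) * ((\<Sum>l\<in>K. ?f l) * ((\<Sum>m\<in>K. cnj (?f m)) * (\<Sum>n\<in>K. cnj (?f n))))"
    unfolding free_wave_def cnj_sum .
  also have "\<dots> = (\<Sum>k\<in>K. \<Sum>l\<in>K. \<Sum>m\<in>K. \<Sum>n\<in>K. ?f k * (?f l * (cnj (?f m) * cnj (?f n))))"
    unfolding sum_product by (simp only: sum_distrib_left sum_product)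
  also have "\<dots> = (\<Sum>(k, l, m, n)\<in>K \<times> K \<times> K \<times> K. ?f k * (?f l * (cnj (?f m) * cnj (?f n))))"
    by (simp add: sum.cartesian_product)
  also have "\<dots> = (\<Sum>(k, l, m, n)\<in>K \<times> K \<times> K \<times> K. (c k * c l * cnj (c m) * cnj (c n)) *
       cis (of_int (freq_sq m + freq_sq n - freq_sq k - freq_sq l) * t) * wave (k + l - m - n) x)"
  proof (rule sum.cong[OF refl], clarify)
    fix k l m n
    have w: "wave (k + l - m - n) x = wave k x * (wave l x * (cnj (wave m x) * cnj (wave n x)))"
      using wave_add[of "k + l - m" "- n" x] wave_add[of "k + l" "- m" x] wave_add[of k l x] by (simp add: cnj_wave)
    have e: "cis (of_int (freq_sq m + freq_sq n - freq_sq k - freq_sq l) * t) =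
       cis (- (of_int (freq_sq k) * t)) * (cis (- (of_int (freq_sq l) * t)) * (cis (of_int (freq_sq m) * t) * cis (of_int (freq_sq n) * t)))"
      by (simp add: cis_mult algebra_simps)
    show "?f k * (?f l * (cnj (?f m) * cnj (?f n))) = (c k * c l * cnj (c m) * cnj (c n)) *
       cis (of_int (freq_sq m + freq_sq n - freq_sq k - freq_sq l) * t) * wave (k + l - m - n) x"
      unfolding w e by (simp add: cis_cnj mult_ac)
  qed
  finally show ?thesis .
qed

text \<open>After expansion of the fourth power, integration over whole periods keeps only the
  resonant quadruples, k + l = m + n together with the same relation for the squares. By
  \<open>parabola_quadruple\<close> each pair (k, l) leaves at most two choices of (m, n), hence the
  factor 2 in front of the measure of space-time.\<close>

lemma Zygmund_L4_period:
  fixes c :: "int ^ 'd::finite \<Rightarrow> complex"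
  assumes d: "CARD('d) = 1" and K: "finite K"
  shows "(LINT t|lebesgue_on {0..2 * pi * real j}. LINT x|torus. (cmod (free_wave K c t x)) ^ 4) \<le>
     2 * (2 * pi * real j) * (2 * pi) * (\<Sum>k\<in>K. (cmod (c k))\<^sup>2)\<^sup>2"
proof -
  let ?M = "lebesgue_on {0..2 * pi * real j}"
  let ?Q = "K \<times> K \<times> K \<times> K"
  define A where "A = (\<lambda>(k, l, m, n). c k * c l * cnj (c m) * cnj (c n))"
  define \<theta> where "\<theta> = (\<lambda>(k :: int ^ 'd, l :: int ^ 'd, m :: int ^ 'd, n :: int ^ 'd). freq_sq m + freq_sq n - freq_sq k - freq_sq l)"
  define \<kappa> where "\<kappa> = (\<lambda>(k :: int ^ 'd, l :: int ^ 'd, m :: int ^ 'd, n :: int ^ 'd). k + l - m - n)"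
  \<comment> \<open>The size of a term if it is resonant, and 0 if its integral vanishes.\<close>
  define B where "B q = (if \<theta> q = 0 \<and> \<kappa> q = 0 then cmod (A q) else 0)" for q
  have p4: "complex_of_real ((cmod (free_wave K c t x)) ^ 4) = (\<Sum>q\<in>?Q. A q * cis (of_int (\<theta> q) * t) * wave (\<kappa> q) x)" for t x
    unfolding cmod_free_wave_power4 A_def \<theta>_def \<kappa>_def by (simp add: case_prod_beta')
  have wi: "integrable torus (\<lambda>x. C * wave k x)" for C and k :: "int ^ 'd"
    by (rule sq_integrable_imp_integrable[OF finite_measure_torus sq_integrable_wave])
  have inner: "complex_of_real (LINT x|torus. (cmod (free_wave K c t x)) ^ 4) =
     (\<Sum>q\<in>?Q. (if \<kappa> q = 0 then A q * of_real (2 * pi) else 0) * cis (of_int (\<theta> q) * t))" for t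
  proof -
    have "complex_of_real (LINT x|torus. (cmod (free_wave K c t x)) ^ 4) = (LINT x|torus. complex_of_real ((cmod (free_wave K c t x)) ^ 4))"
      by (rule integral_complex_of_real[symmetric])
    also have "\<dots> = (\<Sum>q\<in>?Q. LINT x|torus. A q * cis (of_int (\<theta> q) * t) * wave (\<kappa> q) x)"
      unfolding p4 by (rule Bochner_Integration.integral_sum) (rule wi)
    also have "\<dots> = (\<Sum>q\<in>?Q. A q * cis (of_int (\<theta> q) * t) * (LINT x|torus. wave (\<kappa> q) x))"
      by (simp only: integral_mult_right_zero)
    also have "\<dots> = (\<Sum>q\<in>?Q. (if \<kappa> q = 0 then A q * of_real (2 * pi) else 0) * cis (of_int (\<theta> q) * t))"
      unfolding integral_wave d by (intro sum.cong) auto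
    finally show ?thesis .
  qed
  have ci: "integrable ?M (\<lambda>t. C * cis (of_int n * t))" for C and n :: int
    by (intro continuous_imp_integrable_real continuous_intros)
  have "complex_of_real (LINT t|?M. LINT x|torus. (cmod (free_wave K c t x)) ^ 4) =
      (LINT t|?M. complex_of_real (LINT x|torus. (cmod (free_wave K c t x)) ^ 4))"
    by (rule integral_complex_of_real[symmetric])
  also have "\<dots> = (\<Sum>q\<in>?Q. LINT t|?M. (if \<kappa> q = 0 then A q * of_real (2 * pi) else 0) * cis (of_int (\<theta> q) * t))"
    unfolding inner by (rule Bochner_Integration.integral_sum) (rule ci)
  also have "\<dots> = (\<Sum>q\<in>?Q. (if \<kappa> q = 0 then A q * of_real (2 * pi) else 0) * (LINT t|?M. cis (of_int (\<theta> q) * t)))"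
    by (simp only: integral_mult_right_zero)
  also have "\<dots> = (\<Sum>q\<in>?Q. if \<theta> q = 0 \<and> \<kappa> q = 0 then A q * of_real ((2 * pi) * (2 * pi * real j)) else 0)"
    unfolding cis_int_integral_period by (intro sum.cong) auto
  finally have eq: "complex_of_real (LINT t|?M. LINT x|torus. (cmod (free_wave K c t x)) ^ 4) = \<dots>" .
  have "(LINT t|?M. LINT x|torus. (cmod (free_wave K c t x)) ^ 4) \<le> cmod (complex_of_real (LINT t|?M. LINT x|torus. (cmod (free_wave K c t x)) ^ 4))"
    by simp
  also have "\<dots> \<le> (\<Sum>q\<in>?Q. B q * ((2 * pi) * (2 * pi * real j)))"
    unfolding eq by (rule sum_norm_le) (simp add: B_def norm_mult)
  also have "\<dots> = (\<Sum>q\<in>?Q. B q) * ((2 * pi) * (2 * pi * real j))" by (simp only: sum_distrib_right)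
  also have "(\<Sum>q\<in>?Q. B q) \<le> 2 * (\<Sum>k\<in>K. (cmod (c k))\<^sup>2)\<^sup>2"
  proof -
    have le: "(\<Sum>m\<in>K. \<Sum>n\<in>K. B (k, l, m, n)) \<le> 2 * ((cmod (c k))\<^sup>2 * (cmod (c l))\<^sup>2)" if kl: "k \<in> K" "l \<in> K" for k l
    proof -
      have z: "B (k, l, m, n) = 0" if "(m, n) \<notin> {(k, l), (l, k)}" for m n
      proof (rule ccontr)
        assume "B (k, l, m, n) \<noteq> 0"
        then have "\<theta> (k, l, m, n) = 0" "\<kappa> (k, l, m, n) = 0" unfolding B_def by presburger+
        then have "k + l = m + n" "freq_sq k + freq_sq l = freq_sq m + freq_sq n"
          by (simp_all add: \<theta>_def \<kappa>_def algebra_simps)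
        from parabola_quadruple[OF d this] show False using that by auto
      qed
      have "(\<Sum>m\<in>K. \<Sum>n\<in>K. B (k, l, m, n)) = (\<Sum>(m, n)\<in>K \<times> K. B (k, l, m, n))" by (rule sum.cartesian_product)
      also have "\<dots> = (\<Sum>(m, n)\<in>{(k, l), (l, k)}. B (k, l, m, n))"
        by (rule sum.mono_neutral_right) (use K kl z in auto)
      also have "\<dots> \<le> (\<Sum>(m, n)\<in>{(k, l), (l, k)}. (cmod (c k))\<^sup>2 * (cmod (c l))\<^sup>2)"
        by (rule sum_mono) (auto simp: B_def A_def norm_mult power2_eq_square)
      \<comment> \<open>For k = l the two pairs coincide, so the cardinality is only bounded by
        2.\<close>
      also have "\<dots> = real (card {(k, l), (l, k)}) * ((cmod (c k))\<^sup>2 * (cmod (c l))\<^sup>2)"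
        by (simp only: case_prod_beta' sum_constant)
      also have "\<dots> \<le> 2 * ((cmod (c k))\<^sup>2 * (cmod (c l))\<^sup>2)"
      proof (rule mult_right_mono)
        show "real (card {(k, l), (l, k)}) \<le> 2" using card_insert_le_m1[of 2 "{(l, k)}" "(k, l)"] by simp
      qed simp
      finally show ?thesis .
    qed
    have "(\<Sum>q\<in>?Q. B q) = (\<Sum>k\<in>K. \<Sum>l\<in>K. \<Sum>m\<in>K. \<Sum>n\<in>K. B (k, l, m, n))"
      by (simp add: sum.cartesian_product case_prod_beta')
    also have "\<dots> \<le> (\<Sum>k\<in>K. \<Sum>l\<in>K. 2 * ((cmod (c k))\<^sup>2 * (cmod (c l))\<^sup>2))"
      by (intro sum_mono le)
    also have "\<dots> = 2 * (\<Sum>k\<in>K. (cmod (c k))\<^sup>2)\<^sup>2"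
      unfolding power2_eq_square[of "\<Sum>k\<in>K. (cmod (c k))\<^sup>2"] sum_product by (simp only: sum_distrib_left)
    finally show ?thesis .
  qed
  then have "(\<Sum>q\<in>?Q. B q) * ((2 * pi) * (2 * pi * real j)) \<le> 2 * (\<Sum>k\<in>K. (cmod (c k))\<^sup>2)\<^sup>2 * ((2 * pi) * (2 * pi * real j))"
    by (intro mult_right_mono) auto
  finally show ?thesis by (simp only: mult_ac)
qed

lemma free_wave_measurable: "(\<lambda>(t, x). free_wave K c t x) \<in> borel_measurable (lebesgue_on {0..T} \<Otimes>\<^sub>M torus)"
proof -
  have [measurable]: "(\<lambda>t. cis (- (of_int n * t))) \<in> borel_measurable (lebesgue_on {0..T})" for n :: int
    by (intro continuous_on_measurable_Icc continuous_intros)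
  show ?thesis unfolding free_wave_def by measurable
qed

lemma cmod_free_wave_le: "cmod (free_wave K c t x) \<le> (\<Sum>k\<in>K. cmod (c k))"
  unfolding free_wave_def by (rule sum_norm_le) (simp add: norm_mult)

text \<open>The interval [0, T] is enlarged to \<open>j\<close> whole periods of total length at
  most T + 2 pi <= 2 pi (T + 1), and 2 times this times 2 pi is 8 pi^2 (T + 1) up to order of
  factors.\<close>

lemma Zygmund_L4:
  fixes c :: "int ^ 'd::finite \<Rightarrow> complex"
  assumes d: "CARD('d) = 1" and K: "finite K" and T: "0 < T"
  shows "integrable (lebesgue_on {0..T} \<Otimes>\<^sub>M torus) (\<lambda>(t, x). (cmod (free_wave K c t x)) ^ 4)"
    and "(LINT (t, x)|(lebesgue_on {0..T} \<Otimes>\<^sub>M torus). (cmod (free_wave K c t x)) ^ 4) \<le>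
     8 * pi\<^sup>2 * (T + 1) * (\<Sum>k\<in>K. (cmod (c k))\<^sup>2)\<^sup>2"
proof -
  let ?p = "\<lambda>t x. (cmod (free_wave K c t x)) ^ 4"
  interpret P: pair_sigma_finite "lebesgue_on {0..T}" "torus :: (real ^ 'd) measure" by (rule pair_sigma_finite_Icc_torus)
  have int: "integrable (lebesgue_on {0..S} \<Otimes>\<^sub>M torus) (\<lambda>(t, x). ?p t x)" for S
  proof (rule finite_measure.integrable_const_bound[OF finite_measure_space_time, where B="(\<Sum>k\<in>K. cmod (c k)) ^ 4"])
    show "AE p in lebesgue_on {0..S} \<Otimes>\<^sub>M torus. norm (case p of (t, x) \<Rightarrow> ?p t x) \<le> (\<Sum>k\<in>K. cmod (c k)) ^ 4"
      by (auto intro!: AE_I2 power_mono cmod_free_wave_le)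
    show "(\<lambda>(t, x). ?p t x) \<in> borel_measurable (lebesgue_on {0..S} \<Otimes>\<^sub>M torus)"
      using free_wave_measurable[of K c S] by measurable
  qed
  show "integrable (lebesgue_on {0..T} \<Otimes>\<^sub>M torus) (\<lambda>(t, x). ?p t x)" by (rule int)
  define j where "j = nat \<lceil>T / (2 * pi)\<rceil>"
  have "T / (2 * pi) \<le> real j" unfolding j_def by (rule real_nat_ceiling_ge)
  then have j1: "T \<le> 2 * pi * real j" by (simp add: pos_divide_le_eq mult.commute)
  have "real j \<le> T / (2 * pi) + 1" unfolding j_def using T by simp
  then have "2 * pi * real j \<le> 2 * pi * (T / (2 * pi) + 1)" by (intro mult_left_mono) auto
  also have "\<dots> = T + 2 * pi" by (simp add: field_simps)
  also have "\<dots> \<le> 2 * pi * (T + 1)" using T pi_ge_two by (simp add: algebra_simps)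
  finally have j2: "2 * pi * real j \<le> 2 * pi * (T + 1)" .
  define I where "I t = (LINT x|torus. ?p t x)" for t
  have I0: "0 \<le> I t" for t by (simp add: I_def)
  have Ii: "integrable (lebesgue_on {0..S}) I" for S
  proof -
    interpret P: pair_sigma_finite "lebesgue_on {0..S}" "torus :: (real ^ 'd) measure" by (rule pair_sigma_finite_Icc_torus)
    show ?thesis unfolding I_def by (rule P.integrable_fst[OF int])
  qed
  have Ii': "integrable lebesgue (\<lambda>t. indicator {0..S} t *\<^sub>R I t)" for S
    using Ii[of S] by (subst (asm) integrable_restrict_space) auto
  have "(LINT (t, x)|(lebesgue_on {0..T} \<Otimes>\<^sub>M torus). ?p t x) = (LINT t|lebesgue_on {0..T}. I t)"
    unfolding I_def by (rule P.integral_fst[OF int, symmetric])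
  also have "\<dots> = (LINT t|lebesgue. indicator {0..T} t *\<^sub>R I t)" by (rule integral_restrict_space) auto
  also have "\<dots> \<le> (LINT t|lebesgue. indicator {0..2 * pi * real j} t *\<^sub>R I t)"
    by (rule integral_mono[OF Ii' Ii']) (use j1 I0 in \<open>auto simp: indicator_def\<close>)
  also have "\<dots> = (LINT t|lebesgue_on {0..2 * pi * real j}. I t)" by (rule integral_restrict_space[symmetric]) auto
  also have "\<dots> \<le> 2 * (2 * pi * real j) * (2 * pi) * (\<Sum>k\<in>K. (cmod (c k))\<^sup>2)\<^sup>2"
    unfolding I_def by (rule Zygmund_L4_period[OF d K])
  also have "\<dots> \<le> 2 * (2 * pi * (T + 1)) * (2 * pi) * (\<Sum>k\<in>K. (cmod (c k))\<^sup>2)\<^sup>2"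
    using j2 by (intro mult_right_mono mult_left_mono) auto
  also have "\<dots> = 8 * pi\<^sup>2 * (T + 1) * (\<Sum>k\<in>K. (cmod (c k))\<^sup>2)\<^sup>2" by (simp add: power2_eq_square)
  finally show "(LINT (t, x)|(lebesgue_on {0..T} \<Otimes>\<^sub>M torus). ?p t x) \<le> \<dots>" .
qed

section \<open>Duality with the L^4 estimate\<close>

lemma dominated_time_coefficients:
  fixes u h :: "real \<Rightarrow> real ^ 'd::finite \<Rightarrow> complex"
  assumes u: "duhamel lam T u"
    and hm: "(\<lambda>(s, x). h s x) \<in> borel_measurable (lebesgue_on {0..T} \<Otimes>\<^sub>M torus)"
    and hb: "\<And>s x. cmod (h s x) \<le> B * (1 + (cmod (u s x))\<^sup>2)"
  shows "integrable (lebesgue_on {0..T} \<Otimes>\<^sub>M torus) (\<lambda>(s, x). h s x)"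
    and "\<And>t. t \<in> {0..T} \<Longrightarrow> integrable torus (h t)"
    and "\<And>k. integrable (lebesgue_on {0..T}) (\<lambda>s. cis (of_int (freq_sq k) * s) * fourier_coeff (h s) k)"
proof -
  let ?M = "lebesgue_on {0..T}"
  interpret P: pair_sigma_finite ?M "torus :: (real ^ 'd) measure" by (rule pair_sigma_finite_Icc_torus)
  interpret N: finite_measure "torus :: (real ^ 'd) measure" by (rule finite_measure_torus)
  have one: "integrable (?M \<Otimes>\<^sub>M (torus :: (real ^ 'd) measure)) (\<lambda>p. 1::real)"
    by (rule finite_measure.integrable_const[OF finite_measure_space_time])
  have ui: "integrable (?M \<Otimes>\<^sub>M torus) (\<lambda>p. B * (1 + (cmod (case p of (s, x) \<Rightarrow> u s x))\<^sup>2))"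
    using duhamel_sq_integrable[OF u] one
    by (intro integrable_mult_right Bochner_Integration.integrable_add) (simp_all add: sq_integrable_def)
  show hi: "integrable (?M \<Otimes>\<^sub>M torus) (\<lambda>(s, x). h s x)"
    by (rule Bochner_Integration.integrable_bound[OF ui hm])
       (auto intro!: AE_I2 order_trans[OF hb] simp del: abs_mult)
  show "integrable torus (h t)" if t: "t \<in> {0..T}" for t
  proof (rule Bochner_Integration.integrable_bound)
    show "integrable torus (\<lambda>x. B * (1 + (cmod (u t x))\<^sup>2))"
      using duhamelD(2)[OF u t] finite_measure.integrable_const[OF finite_measure_torus, of "1::real"]
      by (intro integrable_mult_right Bochner_Integration.integrable_add) (simp_all add: sq_integrable_def)
    show "h t \<in> borel_measurable torus" using measurable_pair_const_snd[OF hm] t by simp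
  qed (auto intro!: AE_I2 order_trans[OF hb] simp del: abs_mult)
  show "integrable ?M (\<lambda>s. cis (of_int (freq_sq k) * s) * fourier_coeff (h s) k)" for k
  proof (rule integrable_continuous_mult)
    show "continuous_on {0..T} (\<lambda>s. cis (of_int (freq_sq k) * s))" by (intro continuous_intros)
    have wm: "(\<lambda>p. cnj (wave k (snd p))) \<in> borel_measurable (?M \<Otimes>\<^sub>M torus)" by measurable
    have "integrable (?M \<Otimes>\<^sub>M torus) (\<lambda>(s, x). h s x * cnj (wave k x))"
      using integrable_bounded_mult[OF hi wm, of 1] by (simp add: case_prod_beta' mult.commute)
    from P.integrable_fst[OF this]
    show "integrable ?M (\<lambda>s. fourier_coeff (h s) k)" unfolding fourier_coeff_wave_def by simp
  qed
qed

text \<open>Let S be the sum on the left. The coefficients being estimated are themselves taken as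
  data of a free wave; then 2 pi S is the space-time pairing of \<xi> h with that wave, whose L^4
  norm is O(S^(1/2)). Squaring and cancelling one factor S leaves the bound, and the gain 1 / sqrt R
  comes from r I <= r^2 / R. The weight \<xi> allows the time integral to run over a part of
  [0, T].\<close>

lemma dual_Strichartz:
  fixes u h :: "real \<Rightarrow> real ^ 'd::finite \<Rightarrow> complex"
  assumes d: "CARD('d) = 1" and T: "0 < T" and K: "finite K" and u: "duhamel lam T u"
    and C: "\<And>t. t \<in> {0..T} \<Longrightarrow> (LINT x|torus. (cmod (u t x))\<^sup>2) \<le> C"
    and hm: "(\<lambda>(s, x). h s x) \<in> borel_measurable (lebesgue_on {0..T} \<Otimes>\<^sub>M torus)"
    and c: "0 \<le> c" and R: "1 \<le> R"
    and hb: "\<And>s x. cmod (h s x) \<le> c * (cmod (u s x) * (sqrt (sqrt (cmod (u s x))) * indicator {R..} (cmod (u s x))))"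
    and \<xi>m: "\<xi> \<in> borel_measurable (lebesgue_on {0..T})" and \<xi>: "\<And>s. 0 \<le> \<xi> s" "\<And>s. \<xi> s \<le> (1::real)"
  shows "(\<Sum>k\<in>K. (cmod (LINT s|lebesgue_on {0..T}. of_real (\<xi> s) * (cis (of_int (freq_sq k) * s) * fourier_coeff (h s) k)))\<^sup>2)
    \<le> c\<^sup>2 * (T * C * sqrt (T * C * (8 * pi\<^sup>2 * (T + 1))) / (2 * pi)\<^sup>2 / sqrt R)"
proof -
  let ?M = "lebesgue_on {0..T}"
  let ?Q = "?M \<Otimes>\<^sub>M (torus :: (real ^ 'd) measure)"
  interpret P: pair_sigma_finite ?M "torus :: (real ^ 'd) measure" by (rule pair_sigma_finite_Icc_torus)
  define b where "b k = (LINT s|?M. of_real (\<xi> s) * (cis (of_int (freq_sq k) * s) * fourier_coeff (h s) k))" for k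
  define S where "S = (\<Sum>k\<in>K. (cmod (b k))\<^sup>2)"
  have S0: "0 \<le> S" unfolding S_def by (intro sum_nonneg) auto
  define r where "r p = cmod (u (fst p) (snd p))" for p :: "real \<times> (real ^ 'd)"
  define p where "p q = cmod (free_wave K b (fst q) (snd q))" for q :: "real \<times> (real ^ 'd)"
  define I where "I q = (indicator {R..} (r q) :: real)" for q :: "real \<times> (real ^ 'd)"
  have um: "(\<lambda>q. u (fst q) (snd q)) \<in> borel_measurable ?Q" using duhamelD(1)[OF u] by (simp add: case_prod_beta')
  have hm': "(\<lambda>q. h (fst q) (snd q)) \<in> borel_measurable ?Q" using hm by (simp add: case_prod_beta')
  have rm [measurable]: "r \<in> borel_measurable ?Q" unfolding r_def using um by measurable
  have Im [measurable]: "I \<in> borel_measurable ?Q" unfolding I_def by measurable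
  have pm [measurable]: "p \<in> borel_measurable ?Q"
    using free_wave_measurable[of K b T] unfolding p_def by (simp add: case_prod_beta')
  note \<xi>m [measurable]
  have em [measurable]: "(\<lambda>t. cis (of_int n * t)) \<in> borel_measurable ?M" for n :: int
    by (intro continuous_on_measurable_Icc continuous_intros)
  have em' [measurable]: "(\<lambda>t. cis (- (of_int n * t))) \<in> borel_measurable ?M" for n :: int
    by (intro continuous_on_measurable_Icc continuous_intros)
  have r0: "0 \<le> r q" for q by (simp add: r_def)
  have p0: "0 \<le> p q" for q by (simp add: p_def)
  have I01: "I q = 0 \<or> I q = 1" for q by (simp add: I_def indicator_def)
  have II: "(I q)\<^sup>2 = I q" for q using I01[of q] by auto
  have r2: "integrable ?Q (\<lambda>q. (r q)\<^sup>2)"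
    using duhamel_sq_integrable[OF u] by (simp add: sq_integrable_def r_def case_prod_beta')
  have r2C: "(LINT q|?Q. (r q)\<^sup>2) \<le> T * C"
  proof -
    have i: "integrable ?Q (\<lambda>(s, x). (cmod (u s x))\<^sup>2)" using r2 by (simp add: r_def case_prod_beta')
    have "(LINT q|?Q. (r q)\<^sup>2) = (LINT s|?M. LINT x|torus. (cmod (u s x))\<^sup>2)"
      unfolding P.integral_fst[OF i] by (simp add: r_def case_prod_beta')
    also have "\<dots> \<le> (LINT s|?M. C)"
      by (rule integral_mono[OF P.integrable_fst[OF i] finite_measure.integrable_const[OF finite_measure_Icc]]) (use C in simp)
    also have "\<dots> = T * C" using T by (simp add: measure_restrict_space)
    finally show ?thesis .
  qed
  have C0: "0 \<le> C" using C[of 0] T by (intro order_trans[OF _ C[of 0]]) auto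
  have rI_le: "r q * I q \<le> (r q)\<^sup>2 / R" for q
  proof (cases "R \<le> r q")
    case True
    then have "R * r q \<le> r q * r q" using r0 by (intro mult_right_mono) auto
    then show ?thesis using True R by (simp add: I_def power2_eq_square field_simps)
  next
    case False
    then show ?thesis using R by (simp add: I_def)
  qed
  have rI: "integrable ?Q (\<lambda>q. r q * I q)"
    by (rule Bochner_Integration.integrable_bound[of _ "\<lambda>q. (r q)\<^sup>2 / R"])
       (use r2 rI_le r0 I01 R in \<open>auto intro!: AE_I2 simp: I_def\<close>)
  have rIC: "(LINT q|?Q. r q * I q) \<le> T * C / R"
  proof -
    have "(LINT q|?Q. r q * I q) \<le> (LINT q|?Q. (r q)\<^sup>2 / R)"
      by (rule integral_mono[OF rI]) (use r2 rI_le in auto)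
    also have "\<dots> = (LINT q|?Q. (r q)\<^sup>2) / R" by simp
    also have "\<dots> \<le> T * C / R" using r2C R by (intro divide_right_mono) auto
    finally show ?thesis .
  qed
  have p4: "integrable ?Q (\<lambda>q. (p q) ^ 4)" "(LINT q|?Q. (p q) ^ 4) \<le> 8 * pi\<^sup>2 * (T + 1) * S\<^sup>2"
    using Zygmund_L4[OF d K T, of b] by (simp_all add: p_def S_def case_prod_beta')
  \<comment> \<open>Hoelder's inequality with exponents 2, 4, 4 for r, r^(1/4) I and p is carried
    out as two Cauchy-Schwarz steps: the inner one splits g p^2, where g^2 = r I, and the outer one
    splits r f, where f^2 = g p^2.\<close>
  define g where "g q = sqrt (r q) * I q" for q
  have gm [measurable]: "g \<in> borel_measurable ?Q" unfolding g_def by measurable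
  have g2: "(g q)\<^sup>2 = r q * I q" for q using r0 by (simp add: g_def power_mult_distrib II)
  have p22: "((p q)\<^sup>2)\<^sup>2 = (p q) ^ 4" for q by (simp flip: power_mult)
  have CS2: "integrable ?Q (\<lambda>q. g q * (p q)\<^sup>2)"
    "(LINT q|?Q. g q * (p q)\<^sup>2)\<^sup>2 \<le> (LINT q|?Q. r q * I q) * (LINT q|?Q. (p q) ^ 4)"
    using Cauchy_Schwarz_integral_real[of g ?Q "\<lambda>q. (p q)\<^sup>2"] rI p4(1) by (simp_all add: g2 p22)
  define G where "G = (LINT q|?Q. g q * (p q)\<^sup>2)"
  have g0: "0 \<le> g q" for q using r0[of q] I01[of q] by (auto simp: g_def)
  have G0: "0 \<le> G" unfolding G_def using g0 by (intro Bochner_Integration.integral_nonneg) simp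
  have "G\<^sup>2 \<le> (T * C / R) * (8 * pi\<^sup>2 * (T + 1) * S\<^sup>2)"
    using CS2(2) unfolding G_def[symmetric]
    by (rule order_trans) (intro mult_mono rIC p4(2), use C0 T R in \<open>auto intro!: Bochner_Integration.integral_nonneg\<close>)
  also have "\<dots> = (sqrt (T * C * (8 * pi\<^sup>2 * (T + 1))) / sqrt R * S)\<^sup>2"
    using C0 T R by (simp add: power_mult_distrib power_divide)
  finally have GS: "G \<le> sqrt (T * C * (8 * pi\<^sup>2 * (T + 1))) / sqrt R * S"
    by (rule power2_le_imp_le) (use C0 T R S0 in auto)
  define f where "f q = sqrt (sqrt (r q)) * I q * p q" for q
  have fm [measurable]: "f \<in> borel_measurable ?Q" unfolding f_def by measurable
  have f2: "(f q)\<^sup>2 = g q * (p q)\<^sup>2" for q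
    using r0 by (simp add: f_def g_def power_mult_distrib II)
  have CS1: "integrable ?Q (\<lambda>q. r q * f q)" "(LINT q|?Q. r q * f q)\<^sup>2 \<le> (LINT q|?Q. (r q)\<^sup>2) * G"
    using Cauchy_Schwarz_integral_real[of r ?Q f] r2 CS2(1) by (simp_all add: f2 G_def)
  have hi: "integrable ?Q (\<lambda>q. h (fst q) (snd q))"
    and hcoeff: "\<And>k. integrable ?M (\<lambda>s. cis (of_int (freq_sq k) * s) * fourier_coeff (h s) k)"
  proof -
    have "cmod (h s x) \<le> c * (1 + (cmod (u s x))\<^sup>2)" for s x
    proof -
      define \<rho> where "\<rho> = cmod (u s x)"
      have "\<rho> * (sqrt (sqrt \<rho>) * indicator {R..} \<rho>) \<le> 1 + \<rho>\<^sup>2"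
      proof (cases "R \<le> \<rho>")
        case True
        then have \<rho>: "1 \<le> \<rho>" using R by simp
        then have "sqrt \<rho> \<le> \<rho>" by (intro real_le_lsqrt) (auto simp: power2_eq_square)
        moreover have "sqrt (sqrt \<rho>) \<le> sqrt \<rho>" using \<rho> \<open>sqrt \<rho> \<le> \<rho>\<close> by simp
        ultimately have "sqrt (sqrt \<rho>) \<le> \<rho>" by linarith
        then have "\<rho> * sqrt (sqrt \<rho>) \<le> \<rho> * \<rho>" using \<rho> by (intro mult_left_mono) auto
        then show ?thesis using True by (simp add: power2_eq_square)
      qed (simp add: \<rho>_def)
      then have "c * (\<rho> * (sqrt (sqrt \<rho>) * indicator {R..} \<rho>)) \<le> c * (1 + \<rho>\<^sup>2)" using c by (rule mult_left_mono)
      then show ?thesis using hb[of s x] unfolding \<rho>_def by linarith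
    qed
    note D = dominated_time_coefficients[OF u hm this]
    show "integrable ?Q (\<lambda>q. h (fst q) (snd q))" using D(1) by (simp add: case_prod_beta')
    show "integrable ?M (\<lambda>s. cis (of_int (freq_sq k) * s) * fourier_coeff (h s) k)" for k by (rule D(3))
  qed
  \<comment> \<open>The k-th summand of the pairing of \<xi> h with the free wave; integrating it
    gives back 2 pi |b k|^2.\<close>
  define F where "F k q = of_real (\<xi> (fst q)) * cnj (b k * cis (- (of_int (freq_sq k) * fst q)) * wave k (snd q)) * h (fst q) (snd q)" for k q
  have Fi: "integrable ?Q (F k)" for k
    unfolding F_def
  proof (rule integrable_bounded_mult[OF hi, where B="cmod (b k)"])
    show "(\<lambda>q. of_real (\<xi> (fst q)) * cnj (b k * cis (- (of_int (freq_sq k) * fst q)) * wave k (snd q))) \<in> borel_measurable ?Q"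
      by measurable
    show "cmod (of_real (\<xi> (fst q)) * cnj (b k * cis (- (of_int (freq_sq k) * fst q)) * wave k (snd q))) \<le> cmod (b k)" for q
      using \<xi>(1)[of "fst q"] \<xi>(2)[of "fst q"] by (simp add: norm_mult mult_left_le_one_le)
  qed
  have Fk: "integral\<^sup>L ?Q (F k) = of_real (2 * pi) * of_real ((cmod (b k))\<^sup>2)" for k
  proof -
    have i: "integrable ?Q (\<lambda>(s, x). F k (s, x))" using Fi[of k] by (simp add: case_prod_beta')
    have "integral\<^sup>L ?Q (F k) = (LINT s|?M. LINT x|torus. F k (s, x))"
      unfolding P.integral_fst[OF i] by (simp add: case_prod_beta')
    also have "\<dots> = (LINT s|?M. (of_real (2 * pi) * cnj (b k)) * (of_real (\<xi> s) * (cis (of_int (freq_sq k) * s) * fourier_coeff (h s) k)))"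
    proof (rule Bochner_Integration.integral_cong[OF refl])
      fix s
      have "(LINT x|torus. F k (s, x)) = (LINT x|torus. (of_real (\<xi> s) * cnj (b k) * cis (of_int (freq_sq k) * s)) * (h s x * cnj (wave k x)))"
        by (rule Bochner_Integration.integral_cong) (auto simp: F_def cis_cnj mult_ac)
      also have "\<dots> = (of_real (\<xi> s) * cnj (b k) * cis (of_int (freq_sq k) * s)) * (LINT x|torus. h s x * cnj (wave k x))"
        by (rule integral_mult_right_zero)
      also have "(LINT x|torus. h s x * cnj (wave k x)) = of_real (2 * pi) * fourier_coeff (h s) k"
        by (simp add: fourier_coeff_wave_def d)
      finally show "(LINT x|torus. F k (s, x)) = (of_real (2 * pi) * cnj (b k)) * (of_real (\<xi> s) * (cis (of_int (freq_sq k) * s) * fourier_coeff (h s) k))"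
        by (simp only: mult_ac)
    qed
    also have "\<dots> = (of_real (2 * pi) * cnj (b k)) * b k"
      unfolding b_def[of k] by (rule integral_mult_right_zero)
    also have "\<dots> = of_real (2 * pi) * of_real ((cmod (b k))\<^sup>2)"
      unfolding complex_norm_square by (simp only: mult_ac)
    finally show ?thesis .
  qed
  have sumF: "(\<Sum>k\<in>K. F k q) = (of_real (\<xi> (fst q)) * h (fst q) (snd q)) * cnj (free_wave K b (fst q) (snd q))" for q
    by (simp add: F_def free_wave_def sum_distrib_left mult_ac)
  have "complex_of_real (2 * pi * S) = (\<Sum>k\<in>K. integral\<^sup>L ?Q (F k))"
    unfolding Fk S_def by (simp add: sum_distrib_left)
  also have "\<dots> = (LINT q|?Q. (\<Sum>k\<in>K. F k q))" by (rule Bochner_Integration.integral_sum[symmetric]) (rule Fi)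
  finally have "2 * pi * S = cmod (LINT q|?Q. (\<Sum>k\<in>K. F k q))"
    using S0 by (metis norm_of_real abs_of_nonneg mult_nonneg_nonneg pi_ge_zero zero_le_numeral)
  also have "\<dots> \<le> (LINT q|?Q. c * (r q * f q))"
  proof (rule Bochner_Integration.integral_norm_bound_integral)
    show "integrable ?Q (\<lambda>q. \<Sum>k\<in>K. F k q)" by (rule Bochner_Integration.integrable_sum) (rule Fi)
    show "integrable ?Q (\<lambda>q. c * (r q * f q))" by (rule integrable_mult_right[OF CS1(1)])
    fix q
    have "cmod (\<Sum>k\<in>K. F k q) = (\<xi> (fst q) * cmod (h (fst q) (snd q))) * p q"
      unfolding sumF using \<xi>(1)[of "fst q"] by (simp add: norm_mult p_def)
    also have "\<dots> \<le> (1 * (c * (r q * (sqrt (sqrt (r q)) * I q)))) * p q"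
      using hb[of "fst q" "snd q"] \<xi>(1)[of "fst q"] \<xi>(2)[of "fst q"] p0[of q]
      by (intro mult_right_mono mult_mono) (auto simp: r_def I_def)
    also have "\<dots> = c * (r q * f q)" by (simp only: f_def mult_ac mult_1)
    finally show "cmod (\<Sum>k\<in>K. F k q) \<le> c * (r q * f q)" .
  qed
  also have "\<dots> = c * (LINT q|?Q. r q * f q)" by (rule integral_mult_right_zero)
  finally have VS: "2 * pi * S \<le> c * (LINT q|?Q. r q * f q)" .
  define B where "B = sqrt (T * C * (8 * pi\<^sup>2 * (T + 1))) / sqrt R"
  have "(2 * pi * S)\<^sup>2 \<le> (c * (LINT q|?Q. r q * f q))\<^sup>2"
    using VS S0 by (intro power_mono) auto
  also have "\<dots> = c\<^sup>2 * (LINT q|?Q. r q * f q)\<^sup>2" by (simp add: power_mult_distrib)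
  also have "\<dots> \<le> c\<^sup>2 * ((T * C) * (B * S))"
  proof (rule mult_left_mono[OF order_trans[OF CS1(2)]])
    show "(LINT q|?Q. (r q)\<^sup>2) * G \<le> (T * C) * (B * S)"
      using GS G0 r2C C0 T unfolding B_def by (intro mult_mono) auto
  qed simp
  finally have fin: "(2 * pi)\<^sup>2 * S * S \<le> (c\<^sup>2 * (T * C * B)) * S"
    by (simp add: power2_eq_square mult_ac)
  have "S \<le> c\<^sup>2 * (T * C * B) / (2 * pi)\<^sup>2"
  proof (cases "S = 0")
    case True
    then show ?thesis using C0 T R by (simp add: B_def)
  next
    case False
    then have "S > 0" using S0 by simp
    then have "(2 * pi)\<^sup>2 * S \<le> c\<^sup>2 * (T * C * B)" using fin by simp
    then show ?thesis by (simp add: pos_le_divide_eq mult.commute)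
  qed
  also have "\<dots> = c\<^sup>2 * (T * C * sqrt (T * C * (8 * pi\<^sup>2 * (T + 1))) / (2 * pi)\<^sup>2 / sqrt R)"
    by (simp add: B_def)
  finally show ?thesis unfolding S_def b_def .
qed

text \<open>The adjoint of integration up to s is integration over the times after r. The Fubini
  argument is already contained in \<open>integral_times_indefinite\<close>, which is read at t =
  T.\<close>

lemma swap_indefinite:
  fixes G H :: "real \<Rightarrow> complex"
  assumes G: "integrable (lebesgue_on {0..T}) G" and H: "integrable (lebesgue_on {0..T}) H"
  shows "(LINT s|lebesgue_on {0..T}. H s * (LINT r|lebesgue_on {0..T}. indicator {..s} r * G r)) =
    (LINT r|lebesgue_on {0..T}. G r * (LINT s|lebesgue_on {0..T}. of_real (1 - indicator {..r} s) * H s))"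
proof -
  let ?M = "lebesgue_on {0..T}"
  define IG where "IG t = (LINT s|?M. indicator {..t} s * G s)" for t
  define IH where "IH t = (LINT s|?M. indicator {..t} s * H s)" for t
  have full: "(LINT s|?M. indicator {..T} s * F s) = (LINT s|?M. F s)" for F :: "real \<Rightarrow> complex"
    by (rule Bochner_Integration.integral_cong) auto
  have ci: "continuous_on {0..T} IG" "continuous_on {0..T} IH"
    unfolding IG_def IH_def by (rule continuous_on_indefinite[OF G], rule continuous_on_indefinite[OF H])
  have GH: "integrable ?M (\<lambda>s. G s * IH s)" and HG: "integrable ?M (\<lambda>s. H s * IG s)"
    using integrable_continuous_mult[OF G ci(2)] integrable_continuous_mult[OF H ci(1)] by (simp_all add: mult.commute)
  have GT: "integrable ?M (\<lambda>s. G s * IH T)" using G by simp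
  have "IG T * IH T = (LINT s|?M. indicator {..T} s * (G s * IH s + H s * IG s))"
    unfolding IG_def IH_def by (rule integral_times_indefinite[OF G H])
  also have "\<dots> = (LINT s|?M. G s * IH s + H s * IG s)" by (rule full)
  also have "\<dots> = (LINT s|?M. G s * IH s) + (LINT s|?M. H s * IG s)"
    by (rule Bochner_Integration.integral_add[OF GH HG])
  finally have "(LINT s|?M. H s * IG s) = IG T * IH T - (LINT s|?M. G s * IH s)" by simp
  also have "IG T * IH T = (LINT s|?M. G s * IH T)" unfolding IG_def full by simp
  also have "(LINT s|?M. G s * IH T) - (LINT s|?M. G s * IH s) = (LINT s|?M. G s * IH T - G s * IH s)"
    by (rule Bochner_Integration.integral_diff[OF GT GH, symmetric])
  also have "\<dots> = (LINT r|?M. G r * (LINT s|?M. of_real (1 - indicator {..r} s) * H s))"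
  proof (rule Bochner_Integration.integral_cong[OF refl])
    fix r
    have "IH T - IH r = (LINT s|?M. H s) - (LINT s|?M. indicator {..r} s * H s)" by (simp add: IH_def full)
    also have "\<dots> = (LINT s|?M. H s - indicator {..r} s * H s)"
      by (rule Bochner_Integration.integral_diff[OF H integrable_indicator_atMost[OF H], symmetric])
    also have "\<dots> = (LINT s|?M. of_real (1 - indicator {..r} s) * H s)"
      by (rule Bochner_Integration.integral_cong) (auto simp: indicator_def)
    finally show "G r * IH T - G r * IH r = G r * (LINT s|?M. of_real (1 - indicator {..r} s) * H s)"
      by (simp only: right_diff_distrib[symmetric])
  qed
  finally show ?thesis unfolding IG_def .
qed

section \<open>Decay of large values in L^2, dimension one\<close>

lemma Cauchy_Schwarz_sum_cmod:
  "cmod (\<Sum>k\<in>K. a k * b k) \<le> sqrt (\<Sum>k\<in>K. (cmod (a k))\<^sup>2) * sqrt (\<Sum>k\<in>K. (cmod (b k))\<^sup>2)"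
proof -
  have "cmod (\<Sum>k\<in>K. a k * b k) \<le> (\<Sum>k\<in>K. \<bar>cmod (a k)\<bar> * \<bar>cmod (b k)\<bar>)"
    by (rule sum_norm_le) (simp add: norm_mult)
  also have "\<dots> \<le> L2_set (\<lambda>k. cmod (a k)) K * L2_set (\<lambda>k. cmod (b k)) K" by (rule L2_set_mult_ineq)
  finally show ?thesis by (simp add: L2_set_def)
qed

lemma cmod_integral_le_const:
  fixes F :: "real \<Rightarrow> complex"
  assumes T: "0 < T" and b: "\<And>s. s \<in> {0..T} \<Longrightarrow> cmod (F s) \<le> B"
  shows "cmod (LINT s|lebesgue_on {0..T}. F s) \<le> T * B"
proof (cases "integrable (lebesgue_on {0..T}) F")
  case True
  have "cmod (LINT s|lebesgue_on {0..T}. F s) \<le> (LINT s|lebesgue_on {0..T}. B)"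
    by (rule Bochner_Integration.integral_norm_bound_integral[OF True finite_measure.integrable_const[OF finite_measure_Icc]])
       (use b in simp)
  also have "\<dots> = T * B" using T by (simp add: measure_restrict_space)
  finally show ?thesis .
next
  case False
  \<comment> \<open>The integral of a non-integrable function is 0 by convention, so the sign of
    \<open>B\<close> settles this case.\<close>
  have "0 \<le> B" using b[of 0] T norm_ge_zero[of "F 0"] by (meson atLeastAtMost_iff less_imp_le order_refl order_trans)
  then show ?thesis using False T by (simp add: not_integrable_integral_eq)
qed

text \<open>The logarithm is compared with an eighth root so that it uses up half of the gain
  R^(-1/4) of the duality estimate and leaves R^(-1/8).\<close>

lemma ln_le_root8: "1 \<le> (R::real) \<Longrightarrow> 1 + ln R \<le> 8 * R powr (1/8)"
proof -
  assume R: "1 \<le> R"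
  have "ln R = 8 * ln (R powr (1/8))" using R by (simp add: ln_powr)
  also have "ln (R powr (1/8)) \<le> R powr (1/8) - 1" using R by (intro ln_le_minus_one) auto
  finally show ?thesis by simp
qed

text \<open>With \<open>h = u\<close> on \<open>{R \<le> |u| < 2 R}\<close> and \<open>0\<close> elsewhere, the left-hand side is the pairing of \<open>u\<close> with \<open>h\<close>.
  Duhamel's formula turns it into pairings of the initial datum and of \<open>g u\<close> with free evolution integrals of \<open>h\<close>;
  the part of \<open>g u\<close> where \<open>|u| \<ge> R\<close> is not square integrable a priori and is treated by putting the smallness
  on its own evolution integral instead.\<close>

lemma large_values_decay:
  fixes u :: "real \<Rightarrow> real ^ 'd::finite \<Rightarrow> complex"
  assumes d: "CARD('d) = 1" and T: "0 < T" and u: "duhamel lam T u"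
  shows "\<exists>D. \<forall>R\<ge>1. (LINT q|(lebesgue_on {0..T} \<Otimes>\<^sub>M torus). indicator {r. R \<le> r \<and> r < 2 * R} (cmod (u (fst q) (snd q))) * (cmod (u (fst q) (snd q)))\<^sup>2)
    \<le> D * R powr (- (1/8))"
proof -
  let ?M = "lebesgue_on {0..T}"
  let ?Q = "?M \<Otimes>\<^sub>M (torus :: (real ^ 'd) measure)"
  interpret P: pair_sigma_finite ?M "torus :: (real ^ 'd) measure" by (rule pair_sigma_finite_Icc_torus)
  interpret N: finite_measure "torus :: (real ^ 'd) measure" by (rule finite_measure_torus)
  obtain C where C: "C > 0" "\<And>t. t \<in> {0..T} \<Longrightarrow> (LINT x|torus. (cmod (u t x))\<^sup>2) \<le> C"
    using duhamel_bounded[OF u] by blast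
  note um = duhamelD(1)[OF u]
  note usq = duhamelD(2)[OF u]
  define m where "m = measure (torus :: (real ^ 'd) measure) (space torus)"
  have m0: "0 \<le> m" by (simp add: m_def)
  \<comment> \<open>With this constant the bound of \<open>dual_Strichartz\<close> reads c^2 (A /
    sqrt R).\<close>
  define A where "A = T * C * sqrt (T * C * (8 * pi\<^sup>2 * (T + 1))) / (2 * pi)\<^sup>2"
  have A0: "0 \<le> A" using T C by (simp add: A_def)
  \<comment> \<open>The three summands stem from the initial datum, from the nonlinearity below
    level R, and from the nonlinearity above it.\<close>
  define D0 where "D0 = sqrt (C / (2 * pi)) * sqrt A + \<bar>lam\<bar> * (T * (sqrt (8 * (m + C) / (2 * pi)) * sqrt A) + T * (8 * sqrt A * sqrt (C / (2 * pi))))"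
  have D00: "0 \<le> D0" unfolding D0_def using T C m0 A0 by (intro add_nonneg_nonneg mult_nonneg_nonneg) auto
  have main: "(LINT q|?Q. indicator {r. R \<le> r \<and> r < 2 * R} (cmod (u (fst q) (snd q))) * (cmod (u (fst q) (snd q)))\<^sup>2)
      \<le> (2 * pi * D0 * 8) * R powr (- (1/8))" if R: "1 \<le> R" for R
  proof -
    define h where "h s x = indicator {r. R \<le> r \<and> r < 2 * R} (cmod (u s x)) * u s x" for s x
    \<comment> \<open>\<open>g1\<close> is square integrable at the cost of a factor 1 + ln R;
      \<open>g2\<close> satisfies the pointwise hypothesis of
      \<open>dual_Strichartz\<close>.\<close>
    define g1 where "g1 s x = indicator {..<R} (cmod (u s x)) * log_nonlin (u s x)" for s x
    define g2 where "g2 s x = indicator {R..} (cmod (u s x)) * log_nonlin (u s x)" for s x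
    have ind: "(\<lambda>q. indicator S (cmod (u (fst q) (snd q))) :: complex) \<in> borel_measurable ?Q" if "S \<in> sets borel" for S
      using um that by (intro measurable_compose[OF _ borel_measurable_indicator[OF that]]) (simp add: case_prod_beta')
    have lm: "(\<lambda>q. log_nonlin (u (fst q) (snd q))) \<in> borel_measurable ?Q"
      using log_nonlin_measurable_joint[OF um] by (simp add: case_prod_beta')
    have um': "(\<lambda>q. u (fst q) (snd q)) \<in> borel_measurable ?Q" using um by (simp add: case_prod_beta')
    have Sb: "{r. R \<le> r \<and> r < 2 * R} \<in> sets borel" "{..<R} \<in> sets borel" "{R..} \<in> sets borel" by simp_all
    have hm: "(\<lambda>(s, x). h s x) \<in> borel_measurable ?Q"
      unfolding h_def case_prod_beta' by (intro borel_measurable_times ind um' Sb)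
    have g1m: "(\<lambda>(s, x). g1 s x) \<in> borel_measurable ?Q"
      unfolding g1_def case_prod_beta' by (intro borel_measurable_times ind lm Sb)
    have g2m: "(\<lambda>(s, x). g2 s x) \<in> borel_measurable ?Q"
      unfolding g2_def case_prod_beta' by (intro borel_measurable_times ind lm Sb)
    have hle: "cmod (h s x) \<le> cmod (u s x)" for s x by (simp add: h_def norm_mult indicator_def)
    have g12: "log_nonlin (u s x) = g1 s x + g2 s x" for s x by (simp add: g1_def g2_def indicator_def not_less)
    have b_h: "cmod (h s x) \<le> 2 * (1 + (cmod (u s x))\<^sup>2)" for s x
    proof -
      have le: "r \<le> 1 + r\<^sup>2" for r :: real
        using zero_le_power2[of "r - 1/2"] unfolding power2_diff by (simp add: field_simps)
      have "cmod (h s x) \<le> 1 * (1 + (cmod (u s x))\<^sup>2)" using order_trans[OF hle le] by simp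
      also have "\<dots> \<le> 2 * (1 + (cmod (u s x))\<^sup>2)" by (intro mult_right_mono) auto
      finally show ?thesis .
    qed
    have b_g1: "cmod (g1 s x) \<le> 2 * (1 + (cmod (u s x))\<^sup>2)" and b_g2: "cmod (g2 s x) \<le> 2 * (1 + (cmod (u s x))\<^sup>2)" for s x
      using cmod_log_nonlin_le[of "u s x"] by (auto simp: g1_def g2_def norm_mult indicator_def)
    have dual: "(\<Sum>k\<in>K. (cmod (LINT s|?M. of_real (\<xi> s) * (cis (of_int (freq_sq k) * s) * fourier_coeff (f s) k)))\<^sup>2) \<le> c\<^sup>2 * (A / sqrt R)"
      if "finite K" "(\<lambda>(s, x). f s x) \<in> borel_measurable ?Q" "0 \<le> c"
        "\<And>s x. cmod (f s x) \<le> c * (cmod (u s x) * (sqrt (sqrt (cmod (u s x))) * indicator {R..} (cmod (u s x))))"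
        "\<xi> \<in> borel_measurable ?M" "\<And>s. 0 \<le> \<xi> s" "\<And>s. \<xi> s \<le> 1" for K c \<xi> and f :: "real \<Rightarrow> real ^ 'd \<Rightarrow> complex"
      unfolding A_def by (rule dual_Strichartz[OF d T that(1) u C(2) that(2) that(3) R that(4-7)])
    have c_h: "cmod (h s x) \<le> 1 * (cmod (u s x) * (sqrt (sqrt (cmod (u s x))) * indicator {R..} (cmod (u s x))))" for s x
    proof (cases "R \<le> cmod (u s x) \<and> cmod (u s x) < 2 * R")
      case True
      then have "1 \<le> sqrt (sqrt (cmod (u s x)))" using R by simp
      then have "cmod (u s x) * 1 \<le> cmod (u s x) * sqrt (sqrt (cmod (u s x)))" by (intro mult_left_mono) auto
      then show ?thesis using True by (simp add: h_def)
    next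
      case False
      then have "h s x = 0" by (simp add: h_def)
      then show ?thesis by simp
    qed
    have c_g2: "cmod (g2 s x) \<le> 8 * (cmod (u s x) * (sqrt (sqrt (cmod (u s x))) * indicator {R..} (cmod (u s x))))" for s x
    proof (cases "R \<le> cmod (u s x)")
      case True
      define r where "r = cmod (u s x)"
      have r: "1 \<le> r" using True R by (simp add: r_def)
      \<comment> \<open>The logarithm is traded for r^(1/4), the extra power that the duality
        estimate tolerates; the constant 8 is 4 times the 2 from ln (r^2).\<close>
      have "ln r = 4 * ln (sqrt (sqrt r))" using r by (simp add: ln_sqrt)
      also have "ln (sqrt (sqrt r)) \<le> sqrt (sqrt r) - 1" using r by (intro ln_le_minus_one) auto
      finally have "ln r \<le> 4 * sqrt (sqrt r)" by simp
      then have "r * (2 * ln r) \<le> r * (2 * (4 * sqrt (sqrt r)))" using r by (intro mult_left_mono) auto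
      moreover have "cmod (log_nonlin (u s x)) = r * (2 * ln r)"
        using r by (simp add: log_nonlin_def norm_mult r_def ln_realpow abs_mult)
      ultimately show ?thesis using True by (simp add: g2_def r_def)
    next
      case False
      then show ?thesis by (simp add: g2_def)
    qed
    have c_g1: "(cmod (g1 s x))\<^sup>2 \<le> 8 * (1 + ln R)\<^sup>2 * (1 + (cmod (u s x))\<^sup>2)" for s x
    proof (cases "cmod (u s x) < R")
      case True
      define r where "r = cmod (u s x)"
      have l0: "0 \<le> ln R" using R by simp
      have "cmod (g1 s x) \<le> 2 * (1 + ln R) * (1 + r)"
      proof (cases "r < 1")
        case True
        have "cmod (log_nonlin (u s x)) \<le> 2 + 2 * r\<^sup>2" unfolding r_def by (rule cmod_log_nonlin_le)
        also have "r\<^sup>2 \<le> r" using True unfolding r_def power2_eq_square by (intro mult_left_le) auto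
        finally have "cmod (log_nonlin (u s x)) \<le> 2 * 1 * (1 + r)" by simp
        also have "\<dots> \<le> 2 * (1 + ln R) * (1 + r)" using l0 by (intro mult_right_mono mult_left_mono) (auto simp: r_def)
        finally show ?thesis by (simp add: g1_def norm_mult indicator_def r_def) (smt (verit) norm_ge_zero)
      next
        case False
        then have r: "1 \<le> r" by simp
        have "ln r \<le> ln R" using True r by (subst ln_le_cancel_iff) (auto simp: r_def)
        then have "r * (2 * ln r) \<le> (1 + r) * (2 * (1 + ln R))" using r l0 by (intro mult_mono) auto
        moreover have "cmod (log_nonlin (u s x)) = r * (2 * ln r)"
          using r by (simp add: log_nonlin_def norm_mult r_def ln_realpow abs_mult)
        ultimately show ?thesis using True by (simp add: g1_def r_def mult_ac)
      qed
      then have "(cmod (g1 s x))\<^sup>2 \<le> (2 * (1 + ln R) * (1 + r))\<^sup>2" by (intro power_mono) auto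
      also have "\<dots> = 4 * (1 + ln R)\<^sup>2 * (1 + r)\<^sup>2" unfolding power_mult_distrib by simp
      also have "\<dots> \<le> 4 * (1 + ln R)\<^sup>2 * (2 * (1 + r\<^sup>2))"
      proof (rule mult_left_mono)
        show "(1 + r)\<^sup>2 \<le> 2 * (1 + r\<^sup>2)"
          using zero_le_power2[of "1 - r"] by (simp add: power2_eq_square algebra_simps)
      qed simp
      also have "4 * X * (2 * Y) = 8 * X * Y" for X Y :: real by simp
      finally show ?thesis by (simp only: r_def)
    next
      case False
      then show ?thesis by (simp add: g1_def)
    qed
    note Dh = dominated_time_coefficients[OF u hm b_h]
    note D1 = dominated_time_coefficients[OF u g1m b_g1]
    note D2 = dominated_time_coefficients[OF u g2m b_g2]
    define e where "e k s = cis (of_int (freq_sq k) * s)" for k :: "int ^ 'd" and s :: real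
    define H where "H k s = e k s * fourier_coeff (h s) k" for k s
    define G1 where "G1 k s = e k s * fourier_coeff (g1 s) k" for k s
    define G2 where "G2 k s = e k s * fourier_coeff (g2 s) k" for k s
    define a where "a k = fourier_coeff (u 0) k" for k
    define I1 where "I1 k s = (LINT r|?M. indicator {..s} r * G1 k r)" for k s
    define I2 where "I2 k s = (LINT r|?M. indicator {..s} r * G2 k r)" for k s
    have Hi: "integrable ?M (H k)" and G1i: "integrable ?M (G1 k)" and G2i: "integrable ?M (G2 k)" for k
      using Dh(3)[of k] D1(3)[of k] D2(3)[of k] by (simp_all add: H_def[abs_def] G1_def[abs_def] G2_def[abs_def] e_def)
    have Hci: "integrable ?M (\<lambda>s. cnj (H k s))" for k using Hi by simp
    have hsq: "sq_integrable torus (h t)" if t: "t \<in> {0..T}" for t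
      unfolding sq_integrable_def
    proof
      show "h t \<in> borel_measurable torus" using Dh(2)[OF t] by auto
      then have hm2: "(\<lambda>x. (cmod (h t x))\<^sup>2) \<in> borel_measurable torus" by measurable
      have ui: "integrable torus (\<lambda>x. (cmod (u t x))\<^sup>2)" using usq[OF t] unfolding sq_integrable_def ..
      show "integrable torus (\<lambda>x. (cmod (h t x))\<^sup>2)"
      proof (rule Bochner_Integration.integrable_bound[OF ui hm2], rule AE_I2)
        fix x
        have "(cmod (h t x))\<^sup>2 \<le> (cmod (u t x))\<^sup>2" by (rule power_mono[OF hle norm_ge_zero])
        then show "norm ((cmod (h t x))\<^sup>2) \<le> norm ((cmod (u t x))\<^sup>2)" by simp
      qed
    qed
    have g1sq: "sq_integrable torus (g1 t)" and g1n: "(LINT x|torus. (cmod (g1 t x))\<^sup>2) \<le> (1 + ln R)\<^sup>2 * (8 * (m + C))" if t: "t \<in> {0..T}" for t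
    proof -
      have i: "integrable torus (\<lambda>x. 8 * (1 + ln R)\<^sup>2 * (1 + (cmod (u t x))\<^sup>2))"
        using usq[OF t] finite_measure.integrable_const[OF finite_measure_torus, of "1::real"]
        by (intro integrable_mult_right Bochner_Integration.integrable_add) (simp_all add: sq_integrable_def)
      show sq: "sq_integrable torus (g1 t)"
        unfolding sq_integrable_def
      proof
        show "g1 t \<in> borel_measurable torus" using D1(2)[OF t] by auto
        then show "integrable torus (\<lambda>x. (cmod (g1 t x))\<^sup>2)"
          by (intro Bochner_Integration.integrable_bound[OF i]) (auto intro!: AE_I2 order_trans[OF c_g1] simp del: abs_mult)
      qed
      have "(LINT x|torus. (cmod (g1 t x))\<^sup>2) \<le> (LINT x|torus. 8 * (1 + ln R)\<^sup>2 * (1 + (cmod (u t x))\<^sup>2))"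
        by (rule integral_mono[OF _ i c_g1]) (use sq in \<open>simp add: sq_integrable_def\<close>)
      also have "\<dots> = 8 * (1 + ln R)\<^sup>2 * (LINT x|torus. 1 + (cmod (u t x))\<^sup>2)" by (rule integral_mult_right_zero)
      also have "(LINT x|torus. 1 + (cmod (u t x))\<^sup>2) = m + (LINT x|torus. (cmod (u t x))\<^sup>2)"
        by (subst Bochner_Integration.integral_add[OF finite_measure.integrable_const[OF finite_measure_torus]])
           (use usq[OF t] in \<open>simp_all add: sq_integrable_def m_def\<close>)
      also have "8 * (1 + ln R)\<^sup>2 * \<dots> \<le> 8 * (1 + ln R)\<^sup>2 * (m + C)" using C(2)[OF t] by (intro mult_left_mono) auto
      also have "8 * X * Y = X * (8 * Y)" for X Y :: real by simp
      finally show "(LINT x|torus. (cmod (g1 t x))\<^sup>2) \<le> (1 + ln R)\<^sup>2 * (8 * (m + C))" .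
    qed
    have e1: "cmod (e k s) = 1" for k s by (simp add: e_def)
    have ecnj: "e k s * cnj (e k s) = 1" for k s by (simp add: e_def complex_norm_square[symmetric])
    have bessel: "sqrt (\<Sum>k\<in>K. (cmod (fourier_coeff f k))\<^sup>2) \<le> sqrt (B / (2 * pi))"
      if "sq_integrable torus f" "finite K" "(LINT x|torus. (cmod (f x))\<^sup>2) \<le> B" for f :: "real ^ 'd \<Rightarrow> complex" and K B
      using Bessel_inequality[OF that(1,2)] that(3) unfolding d by (simp add: pos_le_divide_eq mult.commute)
    have hC: "(LINT x|torus. (cmod (h t x))\<^sup>2) \<le> C" if t: "t \<in> {0..T}" for t
    proof -
      have "(LINT x|torus. (cmod (h t x))\<^sup>2) \<le> (LINT x|torus. (cmod (u t x))\<^sup>2)"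
        by (rule integral_mono[OF _ _ power_mono[OF hle norm_ge_zero]])
           (use usq[OF t] hsq[OF t] in \<open>simp_all add: sq_integrable_def\<close>)
      then show ?thesis using C(2)[OF t] by linarith
    qed
    have duh: "e k s * fourier_coeff (u s) k = a k + \<i> * of_real lam * (I1 k s + I2 k s)" if s: "s \<in> {0..T}" for k s
    proof -
      have "(LINT r|?M. indicator {..s} r * (e k r * fourier_coeff (\<lambda>x. log_nonlin (u r x)) k)) = (LINT r|?M. indicator {..s} r * G1 k r + indicator {..s} r * G2 k r)"
      proof (rule Bochner_Integration.integral_cong[OF refl])
        fix r assume "r \<in> space ?M"
        then have r: "r \<in> {0..T}" by simp
        have w1: "integrable torus (\<lambda>x. f x * cnj (wave k x))" if "integrable torus f" for f
          using integrable_bounded_mult[OF that, of "\<lambda>x. cnj (wave k x)" 1] by (simp add: mult.commute)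
        have "fourier_coeff (\<lambda>x. log_nonlin (u r x)) k = fourier_coeff (g1 r) k + fourier_coeff (g2 r) k"
          unfolding fourier_coeff_wave_def g12 distrib_right
          by (subst Bochner_Integration.integral_add[OF w1[OF D1(2)[OF r]] w1[OF D2(2)[OF r]]]) (rule add_divide_distrib)
        then show "indicator {..s} r * (e k r * fourier_coeff (\<lambda>x. log_nonlin (u r x)) k) = indicator {..s} r * G1 k r + indicator {..s} r * G2 k r"
          by (simp add: G1_def G2_def distrib_left)
      qed
      also have "\<dots> = I1 k s + I2 k s"
        unfolding I1_def I2_def
        by (rule Bochner_Integration.integral_add[OF integrable_indicator_atMost[OF G1i] integrable_indicator_atMost[OF G2i]])
      finally show ?thesis using duhamelD(3)[OF u s, of k] by (simp add: e_def a_def)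
    qed
    have Icont: "continuous_on {0..T} (I1 k)" "continuous_on {0..T} (I2 k)" for k
      unfolding I1_def I2_def by (rule continuous_on_indefinite[OF G1i], rule continuous_on_indefinite[OF G2i])
    \<comment> \<open>By Parseval, 2 pi times the limit of \<open>\<Phi> N s\<close> is the integral
      of |u|^2 over the shell at time \<open>s\<close>.\<close>
    define \<Phi> where "\<Phi> N s = (\<Sum>k\<in>modes N. fourier_coeff (u s) k * cnj (fourier_coeff (h s) k))" for N s
    have \<Phi>_bound: "cmod (LINT s|?M. \<Phi> N s) \<le> D0 * ((1 + ln R) / sqrt (sqrt R))" for N
    proof -
      let ?K = "modes N :: (int ^ 'd) set"
      have fK: "finite ?K" by (rule finite_modes)
      have R4: "sqrt (c\<^sup>2 * (A / sqrt R)) = \<bar>c\<bar> * (sqrt A / sqrt (sqrt R))" for c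
        by (simp add: real_sqrt_mult real_sqrt_divide)
      \<comment> \<open>The weight is the indicator of a complement: the empty set gives the whole
        interval, as the initial datum requires, and {..r} gives the times after r, as they appear
        after the exchange of integrals.\<close>
      have S_h: "sqrt (\<Sum>k\<in>?K. (cmod (LINT s|?M. of_real (1 - indicator S s) * cnj (H k s)))\<^sup>2) \<le> sqrt A / sqrt (sqrt R)"
        if S: "S \<in> sets borel" for S :: "real set"
      proof -
        have xm: "(\<lambda>s. 1 - indicator S s :: real) \<in> borel_measurable ?M"
          using S by (intro borel_measurable_diff measurable_restrict_space1 borel_measurable_indicator) auto
        have "cmod (LINT s|?M. of_real (1 - indicator S s) * cnj (H k s)) = cmod (LINT s|?M. of_real (1 - indicator S s) * H k s)" for k
        proof -
          have "(LINT s|?M. of_real (1 - indicator S s) * cnj (H k s)) = cnj (LINT s|?M. of_real (1 - indicator S s) * H k s)"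
            unfolding Bochner_Integration.integral_cnj[symmetric] complex_cnj_mult complex_cnj_complex_of_real ..
          then show ?thesis by simp
        qed
        then have "(\<Sum>k\<in>?K. (cmod (LINT s|?M. of_real (1 - indicator S s) * cnj (H k s)))\<^sup>2) \<le> 1\<^sup>2 * (A / sqrt R)"
          using dual[OF fK hm _ c_h xm] by (simp add: H_def e_def)
        then have "sqrt (\<Sum>k\<in>?K. (cmod (LINT s|?M. of_real (1 - indicator S s) * cnj (H k s)))\<^sup>2) \<le> sqrt (1\<^sup>2 * (A / sqrt R))"
          by (rule real_sqrt_le_mono)
        then show ?thesis unfolding R4 by simp
      qed
      have S_g: "sqrt (\<Sum>k\<in>?K. (cmod (I2 k t))\<^sup>2) \<le> 8 * (sqrt A / sqrt (sqrt R))" for t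
      proof -
        have xm: "(\<lambda>s. indicator {..t} s :: real) \<in> borel_measurable ?M"
          by (intro measurable_restrict_space1 borel_measurable_indicator) auto
        have "I2 k t = (LINT s|?M. of_real (indicator {..t} s) * (cis (of_int (freq_sq k) * s) * fourier_coeff (g2 s) k))" for k
          unfolding I2_def G2_def e_def by (rule Bochner_Integration.integral_cong) (auto simp: indicator_def)
        then have "(\<Sum>k\<in>?K. (cmod (I2 k t))\<^sup>2) \<le> 8\<^sup>2 * (A / sqrt R)"
          using dual[OF fK g2m _ c_g2 xm] by simp
        then have "sqrt (\<Sum>k\<in>?K. (cmod (I2 k t))\<^sup>2) \<le> sqrt (8\<^sup>2 * (A / sqrt R))"
          by (rule real_sqrt_le_mono)
        then show ?thesis unfolding R4 by simp
      qed
      define B where "B = sqrt A / sqrt (sqrt R)"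
      have B0: "0 \<le> B" using A0 R by (simp add: B_def)
      have HI1: "integrable ?M (\<lambda>s. cnj (H k s) * I1 k s)" and HI2: "integrable ?M (\<lambda>s. cnj (H k s) * I2 k s)" for k
        using integrable_continuous_mult[OF Hci Icont(1)] integrable_continuous_mult[OF Hci Icont(2)] by (simp_all add: mult.commute)
      have Ha: "integrable ?M (\<lambda>s. cnj (H k s) * a k)" for k using Hci by simp
      have \<Phi>eq: "\<Phi> N s = (\<Sum>k\<in>?K. cnj (H k s) * a k) + \<i> * of_real lam * ((\<Sum>k\<in>?K. cnj (H k s) * I1 k s) + (\<Sum>k\<in>?K. cnj (H k s) * I2 k s))"
        if s: "s \<in> {0..T}" for s
      proof -
        have "fourier_coeff (u s) k * cnj (fourier_coeff (h s) k) = cnj (H k s) * a k + \<i> * of_real lam * (cnj (H k s) * I1 k s + cnj (H k s) * I2 k s)" for k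
        proof -
          have "fourier_coeff (u s) k * cnj (fourier_coeff (h s) k) = (e k s * cnj (e k s)) * (fourier_coeff (u s) k * cnj (fourier_coeff (h s) k))"
            by (simp only: ecnj mult_1)
          also have "\<dots> = cnj (H k s) * (e k s * fourier_coeff (u s) k)" by (simp add: H_def mult_ac)
          also have "\<dots> = cnj (H k s) * (a k + \<i> * of_real lam * (I1 k s + I2 k s))" by (simp only: duh[OF s])
          finally show ?thesis by (simp add: algebra_simps)
        qed
        then show ?thesis unfolding \<Phi>_def by (simp only: sum.distrib sum_distrib_left[symmetric])
      qed
      have i0: "integrable ?M (\<lambda>s. \<Sum>k\<in>?K. cnj (H k s) * a k)" by (rule Bochner_Integration.integrable_sum) (rule Ha)
      have i1: "integrable ?M (\<lambda>s. \<Sum>k\<in>?K. cnj (H k s) * I1 k s)" by (rule Bochner_Integration.integrable_sum) (rule HI1)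
      have i2: "integrable ?M (\<lambda>s. \<Sum>k\<in>?K. cnj (H k s) * I2 k s)" by (rule Bochner_Integration.integrable_sum) (rule HI2)
      define J0 where "J0 = (LINT s|?M. (\<Sum>k\<in>?K. cnj (H k s) * a k))"
      define J1 where "J1 = (LINT s|?M. (\<Sum>k\<in>?K. cnj (H k s) * I1 k s))"
      define J2 where "J2 = (LINT s|?M. (\<Sum>k\<in>?K. cnj (H k s) * I2 k s))"
      have "(LINT s|?M. \<Phi> N s) = (LINT s|?M. (\<Sum>k\<in>?K. cnj (H k s) * a k) + \<i> * of_real lam * ((\<Sum>k\<in>?K. cnj (H k s) * I1 k s) + (\<Sum>k\<in>?K. cnj (H k s) * I2 k s)))"
        by (rule Bochner_Integration.integral_cong[OF refl]) (simp add: \<Phi>eq)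
      also have "\<dots> = J0 + (LINT s|?M. \<i> * of_real lam * ((\<Sum>k\<in>?K. cnj (H k s) * I1 k s) + (\<Sum>k\<in>?K. cnj (H k s) * I2 k s)))"
        unfolding J0_def by (rule Bochner_Integration.integral_add[OF i0 integrable_mult_right[OF Bochner_Integration.integrable_add[OF i1 i2]]])
      also have "(LINT s|?M. \<i> * of_real lam * ((\<Sum>k\<in>?K. cnj (H k s) * I1 k s) + (\<Sum>k\<in>?K. cnj (H k s) * I2 k s)))
         = \<i> * of_real lam * (LINT s|?M. (\<Sum>k\<in>?K. cnj (H k s) * I1 k s) + (\<Sum>k\<in>?K. cnj (H k s) * I2 k s))"
        by (rule integral_mult_right_zero)
      also have "(LINT s|?M. (\<Sum>k\<in>?K. cnj (H k s) * I1 k s) + (\<Sum>k\<in>?K. cnj (H k s) * I2 k s)) = J1 + J2"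
        unfolding J1_def J2_def by (rule Bochner_Integration.integral_add[OF i1 i2])
      finally have J: "(LINT s|?M. \<Phi> N s) = J0 + \<i> * of_real lam * (J1 + J2)" .
      have "cmod J0 \<le> B * sqrt (C / (2 * pi))"
      proof -
        have "J0 = (\<Sum>k\<in>?K. LINT s|?M. cnj (H k s) * a k)"
          unfolding J0_def by (rule Bochner_Integration.integral_sum) (rule Ha)
        also have "\<dots> = (\<Sum>k\<in>?K. (LINT s|?M. of_real (1 - indicator {} s) * cnj (H k s)) * a k)"
        proof -
          have "indicator {} s = (0 :: real)" for s :: real by simp
          then show ?thesis by (simp only: integral_mult_left_zero diff_zero of_real_1 mult_1)
        qed
        finally have "J0 = (\<Sum>k\<in>?K. (LINT s|?M. of_real (1 - indicator {} s) * cnj (H k s)) * a k)" .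
        then have "cmod J0 \<le> sqrt (\<Sum>k\<in>?K. (cmod (LINT s|?M. of_real (1 - indicator {} s) * cnj (H k s)))\<^sup>2) * sqrt (\<Sum>k\<in>?K. (cmod (a k))\<^sup>2)"
          by (simp only: Cauchy_Schwarz_sum_cmod)
        also have "\<dots> \<le> B * sqrt (C / (2 * pi))"
        proof (rule mult_mono)
          show "sqrt (\<Sum>k\<in>?K. (cmod (a k))\<^sup>2) \<le> sqrt (C / (2 * pi))"
            unfolding a_def using T by (intro bessel usq fK C(2)) auto
        qed (use S_h[of "{}"] B0 in \<open>auto simp: B_def intro!: sum_nonneg\<close>)
        finally show ?thesis .
      qed
      moreover have "cmod J1 \<le> T * (sqrt ((1 + ln R)\<^sup>2 * (8 * (m + C)) / (2 * pi)) * B)"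
      proof -
        \<comment> \<open>The time integrations are exchanged so that the integral of
          \<open>H\<close> over the times after r carries the smallness, while Bessel's inequality
          handles \<open>G1\<close> at the fixed time r.\<close>
        have "J1 = (\<Sum>k\<in>?K. LINT s|?M. cnj (H k s) * I1 k s)"
          unfolding J1_def by (rule Bochner_Integration.integral_sum) (rule HI1)
        also have "\<dots> = (\<Sum>k\<in>?K. LINT r|?M. G1 k r * (LINT s|?M. of_real (1 - indicator {..r} s) * cnj (H k s)))"
          unfolding I1_def by (intro sum.cong refl swap_indefinite[OF G1i Hci])
        also have "\<dots> = (LINT r|?M. (\<Sum>k\<in>?K. G1 k r * (LINT s|?M. of_real (1 - indicator {..r} s) * cnj (H k s))))"
        proof (rule Bochner_Integration.integral_sum[symmetric])
          fix k
          have "continuous_on {0..T} (\<lambda>r. (LINT s|?M. cnj (H k s)) - (LINT s|?M. indicator {..r} s * cnj (H k s)))"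
            by (intro continuous_on_diff continuous_on_const continuous_on_indefinite[OF Hci])
          moreover have "(LINT s|?M. of_real (1 - indicator {..r} s) * cnj (H k s)) = (LINT s|?M. cnj (H k s)) - (LINT s|?M. indicator {..r} s * cnj (H k s))" for r
          proof -
            have "(LINT s|?M. of_real (1 - indicator {..r} s) * cnj (H k s)) = (LINT s|?M. cnj (H k s) - indicator {..r} s * cnj (H k s))"
              by (rule Bochner_Integration.integral_cong) (auto simp: indicator_def)
            also have "\<dots> = (LINT s|?M. cnj (H k s)) - (LINT s|?M. indicator {..r} s * cnj (H k s))"
              by (rule Bochner_Integration.integral_diff[OF Hci integrable_indicator_atMost[OF Hci]])
            finally show ?thesis .
          qed
          ultimately have "continuous_on {0..T} (\<lambda>r. (LINT s|?M. of_real (1 - indicator {..r} s) * cnj (H k s)))" by (simp only:)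
          from integrable_continuous_mult[OF G1i this]
          show "integrable ?M (\<lambda>r. G1 k r * (LINT s|?M. of_real (1 - indicator {..r} s) * cnj (H k s)))" by (simp only: mult.commute)
        qed
        finally have J1: "J1 = \<dots>" .
        show ?thesis unfolding J1
        proof (rule cmod_integral_le_const[OF T])
          fix r assume r: "r \<in> {0..T}"
          have "cmod (\<Sum>k\<in>?K. G1 k r * (LINT s|?M. of_real (1 - indicator {..r} s) * cnj (H k s))) \<le>
            sqrt (\<Sum>k\<in>?K. (cmod (G1 k r))\<^sup>2) * sqrt (\<Sum>k\<in>?K. (cmod (LINT s|?M. of_real (1 - indicator {..r} s) * cnj (H k s)))\<^sup>2)"
            by (rule Cauchy_Schwarz_sum_cmod)
          also have "\<dots> \<le> sqrt ((1 + ln R)\<^sup>2 * (8 * (m + C)) / (2 * pi)) * B"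
          proof (rule mult_mono)
            have "(\<Sum>k\<in>?K. (cmod (G1 k r))\<^sup>2) = (\<Sum>k\<in>?K. (cmod (fourier_coeff (g1 r) k))\<^sup>2)" by (simp add: G1_def norm_mult e1)
            then show "sqrt (\<Sum>k\<in>?K. (cmod (G1 k r))\<^sup>2) \<le> sqrt ((1 + ln R)\<^sup>2 * (8 * (m + C)) / (2 * pi))"
              using bessel[OF g1sq[OF r] fK g1n[OF r]] by simp
          qed (use S_h[of "{..r}"] C m0 in \<open>auto simp: B_def intro!: sum_nonneg\<close>)
          finally show "cmod (\<Sum>k\<in>?K. G1 k r * (LINT s|?M. of_real (1 - indicator {..r} s) * cnj (H k s))) \<le> sqrt ((1 + ln R)\<^sup>2 * (8 * (m + C)) / (2 * pi)) * B" .
        qed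
      qed
      \<comment> \<open>Without an exchange: the evolution integral \<open>I2\<close> is small at
        every time, and Bessel's inequality handles \<open>h\<close> at the fixed time s.\<close>
      moreover have "cmod J2 \<le> T * (sqrt (C / (2 * pi)) * (8 * B))"
        unfolding J2_def
      proof (rule cmod_integral_le_const[OF T])
        fix s assume s: "s \<in> {0..T}"
        have "cmod (\<Sum>k\<in>?K. cnj (H k s) * I2 k s) \<le> sqrt (\<Sum>k\<in>?K. (cmod (cnj (H k s)))\<^sup>2) * sqrt (\<Sum>k\<in>?K. (cmod (I2 k s))\<^sup>2)"
          by (rule Cauchy_Schwarz_sum_cmod)
        also have "\<dots> \<le> sqrt (C / (2 * pi)) * (8 * B)"
        proof (rule mult_mono)
          have "(\<Sum>k\<in>?K. (cmod (cnj (H k s)))\<^sup>2) = (\<Sum>k\<in>?K. (cmod (fourier_coeff (h s) k))\<^sup>2)" by (simp add: H_def norm_mult e1)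
          then show "sqrt (\<Sum>k\<in>?K. (cmod (cnj (H k s)))\<^sup>2) \<le> sqrt (C / (2 * pi))"
            using bessel[OF hsq[OF s] fK hC[OF s]] by simp
        qed (use S_g C in \<open>auto simp: B_def intro!: sum_nonneg\<close>)
        finally show "cmod (\<Sum>k\<in>?K. cnj (H k s) * I2 k s) \<le> sqrt (C / (2 * pi)) * (8 * B)" .
      qed
      moreover have "cmod (LINT s|?M. \<Phi> N s) \<le> cmod J0 + \<bar>lam\<bar> * (cmod J1 + cmod J2)"
      proof -
        have "cmod (LINT s|?M. \<Phi> N s) \<le> cmod J0 + cmod (\<i> * of_real lam * (J1 + J2))" unfolding J by (rule norm_triangle_ineq)
        also have "cmod (\<i> * of_real lam * (J1 + J2)) = \<bar>lam\<bar> * cmod (J1 + J2)" by (simp add: norm_mult)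
        also have "\<dots> \<le> \<bar>lam\<bar> * (cmod J1 + cmod J2)" by (intro mult_left_mono norm_triangle_ineq) simp
        finally show ?thesis by simp
      qed
      ultimately have "cmod (LINT s|?M. \<Phi> N s) \<le> B * sqrt (C / (2 * pi)) + \<bar>lam\<bar> * (T * (sqrt ((1 + ln R)\<^sup>2 * (8 * (m + C)) / (2 * pi)) * B) + T * (sqrt (C / (2 * pi)) * (8 * B)))"
        by (smt (verit) mult_left_mono abs_ge_zero)
      also have "sqrt ((1 + ln R)\<^sup>2 * (8 * (m + C)) / (2 * pi)) = (1 + ln R) * sqrt (8 * (m + C) / (2 * pi))"
        using R by (simp add: real_sqrt_mult real_sqrt_divide)
      \<comment> \<open>Since ln R >= 0, all three terms can be given the common factor (1 + ln R)
        B.\<close>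
      also have "B * sqrt (C / (2 * pi)) + \<bar>lam\<bar> * (T * ((1 + ln R) * sqrt (8 * (m + C) / (2 * pi)) * B) + T * (sqrt (C / (2 * pi)) * (8 * B)))
          \<le> ((1 + ln R) * B) * sqrt (C / (2 * pi)) + \<bar>lam\<bar> * (T * ((1 + ln R) * sqrt (8 * (m + C) / (2 * pi)) * B) + T * (sqrt (C / (2 * pi)) * (8 * ((1 + ln R) * B))))"
      proof -
        have "1 * B \<le> (1 + ln R) * B" using R B0 by (intro mult_right_mono) auto
        then show ?thesis using T C by (intro add_mono mult_left_mono mult_right_mono order_refl) auto
      qed
      also have "\<dots> = D0 * ((1 + ln R) / sqrt (sqrt R))"
      proof -
        have "(L * (sA / q)) * c1 + l * (T * (L * c2 * (sA / q)) + T * (c1 * (8 * (L * (sA / q))))) =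
            (c1 * sA + l * (T * (c2 * sA) + T * (8 * sA * c1))) * (L / q)" for L sA q c1 c2 l :: real
          by (simp add: divide_inverse algebra_simps)
        then show ?thesis unfolding D0_def B_def .
      qed
      finally show ?thesis .
    qed
    have lim: "(\<lambda>N. LINT s|?M. of_real (2 * pi) * \<Phi> N s) \<longlonglongrightarrow> (LINT s|?M. LINT x|torus. u s x * cnj (h s x))"
    proof (rule integral_dominated_convergence[where w = "\<lambda>s. C"])
      show "(\<lambda>s. of_real (2 * pi) * \<Phi> N s) \<in> borel_measurable ?M" for N
        unfolding \<Phi>_def by (intro borel_measurable_times borel_measurable_sum borel_measurable_cnj borel_measurable_const
            fourier_coeff_measurable_time[OF um] fourier_coeff_measurable_time[OF hm])
      show "(\<lambda>s. LINT x|torus. u s x * cnj (h s x)) \<in> borel_measurable ?M"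
      proof (rule P.M2.borel_measurable_lebesgue_integral)
        show "(\<lambda>(s, x). u s x * cnj (h s x)) \<in> borel_measurable ?Q"
          using um hm unfolding case_prod_beta' by (intro borel_measurable_times borel_measurable_cnj)
      qed
      show "integrable ?M (\<lambda>s. C)" by (rule finite_measure.integrable_const[OF finite_measure_Icc])
      show "AE s in ?M. (\<lambda>N. of_real (2 * pi) * \<Phi> N s) \<longlonglongrightarrow> (LINT x|torus. u s x * cnj (h s x))"
        using Parseval_inner[OF usq hsq] by (intro AE_I2) (simp add: d \<Phi>_def)
      show "AE s in ?M. norm (of_real (2 * pi) * \<Phi> N s) \<le> C" for N
      proof (rule AE_I2)
        fix s assume "s \<in> space ?M"
        then have s: "s \<in> {0..T}" by simp
        have "cmod (\<Phi> N s) \<le> sqrt (\<Sum>k\<in>modes N. (cmod (fourier_coeff (u s) k))\<^sup>2) * sqrt (\<Sum>k\<in>modes N. (cmod (cnj (fourier_coeff (h s) k)))\<^sup>2)"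
          unfolding \<Phi>_def by (rule Cauchy_Schwarz_sum_cmod)
        also have "\<dots> \<le> sqrt (C / (2 * pi)) * sqrt (C / (2 * pi))"
          unfolding complex_mod_cnj
          by (intro mult_mono bessel usq[OF s] hsq[OF s] C(2)[OF s] hC[OF s] finite_modes) (use C in \<open>auto intro!: sum_nonneg\<close>)
        also have "\<dots> = C / (2 * pi)" using C by simp
        finally have "cmod (\<Phi> N s) \<le> C / (2 * pi)" .
        then show "norm (of_real (2 * pi) * \<Phi> N s) \<le> C"
          by (simp add: norm_mult pos_le_divide_eq mult_ac)
      qed
    qed
    define Z where "Z = (LINT q|?Q. indicator {r. R \<le> r \<and> r < 2 * R} (cmod (u (fst q) (snd q))) * (cmod (u (fst q) (snd q)))\<^sup>2)"
    have Zeq: "(LINT s|?M. LINT x|torus. u s x * cnj (h s x)) = of_real Z"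
    proof -
      have pt: "u s x * cnj (h s x) = of_real (indicator {r. R \<le> r \<and> r < 2 * R} (cmod (u s x)) * (cmod (u s x))\<^sup>2)" for s x
        unfolding of_real_mult complex_norm_square by (simp add: h_def indicator_def)
      have i: "integrable ?Q (\<lambda>(s, x). complex_of_real (indicator {r. R \<le> r \<and> r < 2 * R} (cmod (u s x)) * (cmod (u s x))\<^sup>2))"
      proof (rule Bochner_Integration.integrable_bound)
        show "integrable ?Q (\<lambda>p. (cmod (case p of (s, x) \<Rightarrow> u s x))\<^sup>2)" using duhamel_sq_integrable[OF u] by (simp add: sq_integrable_def)
        show "(\<lambda>(s, x). complex_of_real (indicator {r. R \<le> r \<and> r < 2 * R} (cmod (u s x)) * (cmod (u s x))\<^sup>2)) \<in> borel_measurable ?Q"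
          unfolding pt[symmetric] using um hm unfolding case_prod_beta' by (intro borel_measurable_times borel_measurable_cnj)
      qed (auto simp: indicator_def norm_power intro!: AE_I2)
      have "(LINT s|?M. LINT x|torus. u s x * cnj (h s x)) = (LINT q|?Q. complex_of_real (indicator {r. R \<le> r \<and> r < 2 * R} (cmod (u (fst q) (snd q))) * (cmod (u (fst q) (snd q)))\<^sup>2))"
        unfolding pt P.integral_fst[OF i] by (simp add: case_prod_beta')
      also have "\<dots> = of_real Z" unfolding Z_def by (rule integral_complex_of_real)
      finally show ?thesis .
    qed
    have "cmod (of_real Z) \<le> 2 * pi * (D0 * ((1 + ln R) / sqrt (sqrt R)))"
    proof (rule LIMSEQ_le_const2[OF tendsto_norm[OF lim[unfolded Zeq]]], intro exI[of _ 0] allI impI)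
      fix N
      have "cmod (LINT s|?M. of_real (2 * pi) * \<Phi> N s) = 2 * pi * cmod (LINT s|?M. \<Phi> N s)"
        unfolding integral_mult_right_zero by (simp add: norm_mult)
      also have "\<dots> \<le> 2 * pi * (D0 * ((1 + ln R) / sqrt (sqrt R)))" by (intro mult_left_mono \<Phi>_bound) auto
      finally show "cmod (LINT s|?M. of_real (2 * pi) * \<Phi> N s) \<le> 2 * pi * (D0 * ((1 + ln R) / sqrt (sqrt R)))" .
    qed
    then have "Z \<le> 2 * pi * (D0 * ((1 + ln R) / sqrt (sqrt R)))" by simp
    also have "\<dots> \<le> 2 * pi * (D0 * (8 * R powr (- (1/8))))"
    proof -
      have "sqrt (sqrt R) = R powr (1/4)" using R by (simp add: powr_half_sqrt[symmetric] powr_powr)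
      then have "(1 + ln R) / sqrt (sqrt R) \<le> 8 * R powr (1/8) / R powr (1/4)"
        using ln_le_root8[OF R] by (simp only:) (intro divide_right_mono, auto)
      also have "\<dots> = 8 * R powr (- (1/8))" using powr_diff[of R "1/8" "1/4"] by simp
      finally show ?thesis using D00 by (intro mult_left_mono) auto
    qed
    also have "2 * pi * (D0 * (8 * X)) = (2 * pi * D0 * 8) * X" for X by simp
    finally show ?thesis unfolding Z_def .
  qed
  show ?thesis by (intro exI allI impI) (rule main)
qed

lemma log_nonlin_integrable_1d:
  fixes u :: "real \<Rightarrow> real ^ 'd::finite \<Rightarrow> complex"
  assumes d: "CARD('d) = 1" and T: "0 < T" and u: "duhamel lam T u"
  shows "integrable (lebesgue_on {0..T} \<Otimes>\<^sub>M torus) (\<lambda>(s, x). (cmod (log_nonlin (u s x)))\<^sup>2)"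
proof -
  let ?Q = "lebesgue_on {0..T} \<Otimes>\<^sub>M (torus :: (real ^ 'd) measure)"
  from large_values_decay[OF d T u]
  obtain D where D: "\<forall>R\<ge>1. (LINT q|?Q. indicator {r. R \<le> r \<and> r < 2 * R} (cmod (u (fst q) (snd q))) * (cmod (u (fst q) (snd q)))\<^sup>2) \<le> D * R powr (- (1/8))" ..
  have "integrable ?Q (\<lambda>q. (cmod (log_nonlin (u (fst q) (snd q))))\<^sup>2)"
    by (rule log_nonlin_sq_integrable[OF finite_measure_space_time _ _ D[rule_format]])
       (use duhamel_sq_integrable[OF u] in \<open>simp_all add: case_prod_beta'\<close>)
  then show ?thesis by (simp add: case_prod_beta')
qed

section \<open>Uniqueness\<close>

lemma fourier_coeff_eq_imp_AE_eq:
  fixes f g :: "real ^ 'd::finite \<Rightarrow> complex"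
  assumes f: "sq_integrable torus f" and g: "sq_integrable torus g"
    and eq: "\<And>k. fourier_coeff f k = fourier_coeff g k"
  shows "AE x in torus. f x = g x"
proof -
  have d: "sq_integrable torus (\<lambda>x. f x - g x)" by (rule sq_integrable_diff[OF f g])
  have "fourier_coeff (\<lambda>x. f x - g x) k = 0" for k
    using fourier_coeff_add[OF f sq_integrable_cmult[OF g, of "-1"], of k] unfolding fourier_coeff_cmult eq by simp
  then have "(\<lambda>N :: nat. 0) \<longlonglongrightarrow> (LINT x|torus. (cmod (f x - g x))\<^sup>2)" using Parseval[OF d] by simp
  then have "(LINT x|torus. (cmod (f x - g x))\<^sup>2) = 0" using LIMSEQ_unique tendsto_const by blast
  then have "AE x in torus. (cmod (f x - g x))\<^sup>2 = 0"
    by (subst (asm) integral_nonneg_eq_0_iff_AE) (use d in \<open>auto simp: sq_integrable_def\<close>)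
  then show ?thesis by eventually_elim simp
qed

text \<open>\<open>coincide_on\<close> compares arbitrary weakly continuous representatives. Their
  Fourier coefficients are continuous in time, so agreement at almost every time extends to every
  time, and the coefficients determine the function.\<close>

lemma weakly_continuous_AE_unique:
  assumes T: "0 < T" and s: "0 \<le> s"
    and w: "weakly_continuous_Hs s {0..T} w" and z: "weakly_continuous_Hs s {0..T} z"
    and ae: "AE t in lebesgue_on {0..T}. AE x in torus. w t x = z t x" and t: "t \<in> {0..T}"
  shows "AE x in torus. w t x = z t x"
proof -
  have sq: "sq_integrable torus (w t)" "sq_integrable torus (z t)" if "t \<in> {0..T}" for t
    using w z that unfolding weakly_continuous_Hs_def by (auto intro: torus_Hs_sq_integrable)
  have c: "continuous_on {0..T} (\<lambda>t. fourier_coeff (w t) k)" "continuous_on {0..T} (\<lambda>t. fourier_coeff (z t) k)" for k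
  proof -
    have *: "\<forall>L\<in>Hs_dual s. continuous_on {0..T} (\<lambda>t. L (w t))" "\<forall>L\<in>Hs_dual s. continuous_on {0..T} (\<lambda>t. L (z t))"
      using w z unfolding weakly_continuous_Hs_def by blast+
    show "continuous_on {0..T} (\<lambda>t. fourier_coeff (w t) k)" "continuous_on {0..T} (\<lambda>t. fourier_coeff (z t) k)"
      using *[THEN bspec, OF fourier_coeff_Hs_dual[OF s, of k]] by simp_all
  qed
  show ?thesis
  proof (rule fourier_coeff_eq_imp_AE_eq[OF sq[OF t]])
    fix k
    have "cmod (fourier_coeff (w t) k - fourier_coeff (z t) k) \<le> 0"
    proof (rule AE_le_continuous[OF T _ _ t])
      show "continuous_on {0..T} (\<lambda>t. cmod (fourier_coeff (w t) k - fourier_coeff (z t) k))"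
        by (intro continuous_on_norm continuous_on_diff c)
      show "AE t in lebesgue_on {0..T}. cmod (fourier_coeff (w t) k - fourier_coeff (z t) k) \<le> 0"
        using ae AE_space
      proof eventually_elim
        case (elim t)
        then have t: "t \<in> {0..T}" by simp
        have "fourier_coeff (w t) k = fourier_coeff (z t) k"
          by (rule fourier_coeff_cong_AE) (use sq[OF t] elim(1) in \<open>auto simp: sq_integrable_def\<close>)
        then show ?case by simp
      qed
    qed
    then show "fourier_coeff (w t) k = fourier_coeff (z t) k" by simp
  qed
qed

text \<open>Both parts of the theorem share this argument and differ only in the reason why the
  nonlinearity is square integrable in space-time: positive regularity, or the L^4 estimate in
  dimension one.\<close>

lemma weak_solutions_coincide:
  fixes u v :: "real \<Rightarrow> real ^ 'd::finite \<Rightarrow> complex"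
  assumes lam: "lam \<noteq> 0" and T: "0 < T" and s: "0 \<le> s" and ds: "0 < s \<or> CARD('d) = 1"
    and u0: "sq_integrable torus u0"
    and u: "weak_Hs_solution lam s {0..T} u0 u" and v: "weak_Hs_solution lam s {0..T} u0 v"
  shows "coincide_on s {0..T} u v"
proof -
  let ?M = "lebesgue_on {0..T}"
  obtain w p where w: "weakly_continuous_rep s {0..T} u w" "AE x in torus. w 0 x = u0 x" and p: "duhamel lam T p"
    "\<And>t. t \<in> {0..T} \<Longrightarrow> AE x in torus. p t x = w t x"
    "\<exists>C. \<forall>t\<in>{0..T}. \<forall>K. finite K \<longrightarrow> (\<Sum>k\<in>K. Hs_weight s k * (cmod (fourier_coeff (p t) k))\<^sup>2) \<le> C"
    by (rule weak_solution_representative[OF T s u]) (rule that; assumption)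
  obtain z q where z: "weakly_continuous_rep s {0..T} v z" "AE x in torus. z 0 x = u0 x" and q: "duhamel lam T q"
    "\<And>t. t \<in> {0..T} \<Longrightarrow> AE x in torus. q t x = z t x"
    "\<exists>C. \<forall>t\<in>{0..T}. \<forall>K. finite K \<longrightarrow> (\<Sum>k\<in>K. Hs_weight s k * (cmod (fourier_coeff (q t) k))\<^sup>2) \<le> C"
    by (rule weak_solution_representative[OF T s v]) (rule that; assumption)
  have log: "integrable (?M \<Otimes>\<^sub>M torus) (\<lambda>(s, x). (cmod (log_nonlin (f s x)))\<^sup>2)"
    if "duhamel lam T f" "\<exists>C. \<forall>t\<in>{0..T}. \<forall>K. finite K \<longrightarrow> (\<Sum>k\<in>K. Hs_weight s k * (cmod (fourier_coeff (f t) k))\<^sup>2) \<le> C"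
    for f :: "real \<Rightarrow> real ^ 'd \<Rightarrow> complex"
  proof (cases "0 < s")
    case True
    from that(2) obtain C where "\<forall>t\<in>{0..T}. \<forall>K. finite K \<longrightarrow> (\<Sum>k\<in>K. Hs_weight s k * (cmod (fourier_coeff (f t) k))\<^sup>2) \<le> C" ..
    then show ?thesis by (rule log_nonlin_integrable_Hs[OF that(1) True T])
  next
    case False
    then show ?thesis using ds log_nonlin_integrable_1d[OF _ T that(1)] by simp
  qed
  have T0: "0 \<in> {0..T}" using T by simp
  have init: "fourier_coeff (f 0) k = fourier_coeff u0 k"
    if "duhamel lam T f" "AE x in torus. f 0 x = g 0 x" "AE x in torus. g 0 x = u0 x" for f g :: "real \<Rightarrow> real ^ 'd \<Rightarrow> complex" and k
  proof (rule fourier_coeff_cong_AE)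
    show "f 0 \<in> borel_measurable torus" using duhamelD(2)[OF that(1) T0] by (simp add: sq_integrable_def)
    show "u0 \<in> borel_measurable torus" using u0 by (simp add: sq_integrable_def)
    show "AE x in torus. f 0 x = u0 x" using that(2,3) by eventually_elim simp
  qed
  have pq: "AE x in torus. p t x = q t x" if t: "t \<in> {0..T}" for t
  proof (rule duhamel_unique[OF p(1) q(1) _ log[OF p(1,3)] log[OF q(1,3)] lam t])
    show "fourier_coeff (p 0) k = fourier_coeff (q 0) k" for k
      using init[where f = p and g = w, OF p(1) p(2)[OF T0] w(2)] init[where f = q and g = z, OF q(1) q(2)[OF T0] z(2)] by simp
  qed
  have uv: "AE t in ?M. AE x in torus. u t x = v t x"
  proof -
    have "AE t in ?M. AE x in torus. w t x = u t x" "AE t in ?M. AE x in torus. z t x = v t x"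
      using w(1) z(1) by (auto simp: weakly_continuous_rep_def)
    then show ?thesis using AE_space
    proof eventually_elim
      case (elim t)
      then have t: "t \<in> {0..T}" by simp
      show ?case using elim(1,2) p(2)[OF t] q(2)[OF t] pq[OF t] by eventually_elim simp
    qed
  qed
  show ?thesis unfolding coincide_on_def
  proof (intro conjI allI impI ballI uv)
    fix w' z' t
    assume w': "weakly_continuous_rep s {0..T} u w'" and z': "weakly_continuous_rep s {0..T} v z'" and t: "t \<in> {0..T}"
    have "AE t in ?M. AE x in torus. w' t x = z' t x"
    proof -
      have "AE t in ?M. AE x in torus. w' t x = u t x" "AE t in ?M. AE x in torus. z' t x = v t x"
        using w' z' by (auto simp: weakly_continuous_rep_def)
      then show ?thesis using uv
      proof eventually_elim
        case (elim t)
        then show ?case by eventually_elim simp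
      qed
    qed
    then show "AE x in torus. w' t x = z' t x"
      using w' z' unfolding weakly_continuous_rep_def by (intro weakly_continuous_AE_unique[OF T s _ _ _ t]) auto
  qed
qed

theorem theorem1p5:
  fixes lam T :: real
  assumes "lam \<noteq> 0" and "T > 0"
  shows "(\<forall>s u0 (u :: real \<Rightarrow> real ^ 'd::finite \<Rightarrow> complex) v.
            0 < s \<and> s < 1 \<and> u0 \<in> torus_Hs s \<and>
            weak_Hs_solution lam s {0..T} u0 u \<and> weak_Hs_solution lam s {0..T} u0 v
            \<longrightarrow> coincide_on s {0..T} u v)
       \<and> (CARD('d) = 1 \<longrightarrow>
          (\<forall>u0 (u :: real \<Rightarrow> real ^ 'd \<Rightarrow> complex) v.
            u0 \<in> torus_L2 \<and>
            weak_Hs_solution lam 0 {0..T} u0 u \<and> weak_Hs_solution lam 0 {0..T} u0 v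
            \<longrightarrow> coincide_on 0 {0..T} u v))"
proof (intro conjI allI impI; elim conjE)
  fix s u0 and u v :: "real \<Rightarrow> real ^ 'd \<Rightarrow> complex"
  assume "0 < s" and u0: "u0 \<in> torus_Hs s"
    and uv: "weak_Hs_solution lam s {0..T} u0 u" "weak_Hs_solution lam s {0..T} u0 v"
  then show "coincide_on s {0..T} u v"
    by (intro weak_solutions_coincide[OF assms _ _ torus_Hs_sq_integrable[OF u0] uv]) auto
next
  fix u0 and u v :: "real \<Rightarrow> real ^ 'd \<Rightarrow> complex"
  assume d: "CARD('d) = 1" and u0: "u0 \<in> torus_L2"
    and uv: "weak_Hs_solution lam 0 {0..T} u0 u" "weak_Hs_solution lam 0 {0..T} u0 v"
  have "sq_integrable torus u0" using u0 by (simp add: torus_L2_def sq_integrable_def)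
  then show "coincide_on 0 {0..T} u v"
    using d by (intro weak_solutions_coincide[OF assms _ _ _ uv]) auto
qed

end
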